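(* Let $M\ge1$. Let $\{f_k\}$ be a sequence of functions on $\mathbb{R}^n$ which are normalized and centered in $L^2(dm)$, i.e. $\int|f_k|^2\,dm=1$ and $\int x|f_k|^2\,dm=0$, and suppose that $\int|f_k|^4\,dm\le M$ for all $k$. If $\delta_c(f_k)\to0$ as $k\to\infty$, then $$\int|\nabla f_k|^2\,dm\to0,$$ and in particular $f_k\to1$ in $L^2(dm)$.
   Context: On $\mathbb{R}^n$, $dm=2^{n/2}e^{-2\pi|x|^2}dx$, a Gaussian probability measure. For $f\in L^2(dm)$ normalized by $\int|f|^2\,dm=1$, the deficit is $\delta_c(f)=\frac{1}{2\pi}\int|\nabla f|^2\,dm-\int|f|^2\log|f|^2\,dm$.
   Formalization: The final claim that f_k → 1 in L²(dm) is stated only for sequences with f_k ≥ 0 almost everywhere, since the constant sequence f_k = −1 meets all hypotheses with zero deficit but does not tend to 1; the claim ∫|∇f_k|² dm → 0 is for all complex-valued f_k. *)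

theory Defs
  imports "HOL-Analysis.Analysis"
begin

definition gauss_measure :: "(real^'n) measure" where
  "gauss_measure =
     density lborel (\<lambda>x. ennreal (2 powr (real CARD('n) / 2) * exp (- 2 * pi * (norm x)\<^sup>2)))"

definition partial_deriv :: "'n \<Rightarrow> (real^'n \<Rightarrow> real) \<Rightarrow> real^'n \<Rightarrow> real" where
  "partial_deriv j \<phi> x = frechet_derivative \<phi> (at x) (axis j 1)"

fun C_k :: "nat \<Rightarrow> (real^'n \<Rightarrow> real) \<Rightarrow> bool" where
  "C_k 0 \<phi> \<longleftrightarrow> continuous_on UNIV \<phi>"
| "C_k (Suc k) \<phi> \<longleftrightarrow> \<phi> differentiable_on UNIV \<and> (\<forall>j. C_k k (partial_deriv j \<phi>))"

definition test_function :: "(real^'n \<Rightarrow> real) \<Rightarrow> bool" where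
  "test_function \<phi> \<longleftrightarrow> (\<forall>k. C_k k \<phi>) \<and> compact (closure {x. \<phi> x \<noteq> 0})"

definition locally_integrable :: "(real^'n \<Rightarrow> complex) \<Rightarrow> bool" where
  "locally_integrable f \<longleftrightarrow> (\<forall>K. compact K \<longrightarrow> set_integrable lborel K f)"

text \<open>The gradient is the distributional one, with respect to Lebesgue measure.\<close>

definition has_weak_gradient :: "(real^'n \<Rightarrow> complex) \<Rightarrow> (real^'n \<Rightarrow> complex^'n) \<Rightarrow> bool" where
  "has_weak_gradient f G \<longleftrightarrow>
     locally_integrable f \<and> G \<in> borel_measurable borel \<and>
     (\<forall>j. locally_integrable (\<lambda>x. G x $ j) \<and>
       (\<forall>\<phi>. test_function \<phi> \<longrightarrow>
          (LINT x|lborel. partial_deriv j \<phi> x *\<^sub>R f x) = - (LINT x|lborel. \<phi> x *\<^sub>R (G x $ j))))"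

text \<open>A weak gradient is unique up to null sets, so the choice below does not affect integrals.\<close>

definition weak_gradient :: "(real^'n \<Rightarrow> complex) \<Rightarrow> real^'n \<Rightarrow> complex^'n" where
  "weak_gradient f = (SOME G. has_weak_gradient f G)"

text \<open>The integral of the squared gradient, with the usual value \<open>\<infinity>\<close> for functions that have
  no weak gradient.\<close>

definition dirichlet_energy :: "(real^'n \<Rightarrow> complex) \<Rightarrow> ennreal" where
  "dirichlet_energy f =
     (if \<exists>G. has_weak_gradient f G
      then \<integral>\<^sup>+x. ennreal ((norm (weak_gradient f x))\<^sup>2) \<partial>gauss_measure
      else \<infinity>)"

text \<open>The deficit takes values in \<open>(-\<infinity>, \<infinity>]\<close>. Since \<open>t ln t\<close> is bounded below, the entropy of a
  normalized function can only fail to be integrable by being \<open>\<infinity>\<close>; by the logarithmic Sobolev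
  inequality the energy is then \<open>\<infinity>\<close> as well and so is the deficit, whatever the (dummy) value of
  the Bochner integral. Note that \<open>ln 0 = 0\<close>, so \<open>0 ln 0 = 0\<close> as usual.\<close>

definition deficit :: "(real^'n \<Rightarrow> complex) \<Rightarrow> ereal" where
  "deficit f =
     enn2ereal (dirichlet_energy f) / ereal (2 * pi)
     - ereal (LINT x|gauss_measure. (cmod (f x))\<^sup>2 * ln ((cmod (f x))\<^sup>2))"

definition normalized :: "(real^'n \<Rightarrow> complex) \<Rightarrow> bool" where
  "normalized f \<longleftrightarrow> (\<integral>\<^sup>+x. ennreal ((cmod (f x))\<^sup>2) \<partial>gauss_measure) = 1"

definition centered :: "(real^'n \<Rightarrow> complex) \<Rightarrow> bool" where
  "centered f \<longleftrightarrow>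
     integrable gauss_measure (\<lambda>x. (cmod (f x))\<^sup>2 *\<^sub>R x) \<and>
     (LINT x|gauss_measure. (cmod (f x))\<^sup>2 *\<^sub>R x) = 0"

end

theory Submission
  imports Defs "HOL-Probability.Probability"
begin

text \<open>
  Let \<open>h = |f|\<^sup>2\<close> and let \<open>Q h y\<close> be the mean of \<open>h (\<rho> y + \<sigma> z)\<close> over a Gaussian \<open>z\<close>, where
  \<open>\<rho>\<^sup>2 + \<sigma>\<^sup>2 = 1\<close>. The chain rule splits the entropy of \<open>h\<close> into the entropy of \<open>Q h\<close> and the mean
  entropy of \<open>h\<close> under Gaussians of variance proportional to \<open>\<sigma>\<^sup>2\<close>; the logarithmic Sobolev inequality
  for the latter bounds the second part by \<open>\<sigma>\<^sup>2 E / (2 \<pi>)\<close>, where \<open>E\<close> is the Dirichlet energy. As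
  \<open>h - 1\<close> is orthogonal to all affine functions, the first part is \<open>O(\<parallel>Q h - 1\<parallel>\<^sup>2) = O(\<rho>\<^sup>4 \<integral> h\<^sup>2)\<close>.
  Hence \<open>\<rho>\<^sup>2 E / (2 \<pi>)\<close> is at most the deficit plus \<open>C M \<rho>\<^sup>4\<close> for every small \<open>\<rho>\<close>, and the energy tends
  to zero with the deficit. So does the entropy, and \<open>(|f| - 1)\<^sup>2 \<le> h ln h - h + 1\<close> gives the convergence
  in \<open>L\<^sup>2\<close>.

  The logarithmic Sobolev inequality itself holds because its defect is subadditive in the variance, by
  subadditivity of the entropy, and is \<open>O(s powr (3/2))\<close> for small variance \<open>s\<close>, by Taylor expansion.
  Weakly differentiable functions are reached by mollification and cutoff.
\<close>

subsection \<open>The Gaussian measure\<close>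

text \<open>Why the orders work: as an integral over x, the noise operator has kernel 1 + 4 pi
  \<rho> (x . y) + O(\<rho>^2). Its first two terms are what normalization and centering evaluate,
  so Q h - 1 is O(\<rho>^2) and its square O(\<rho>^4), while the energy gains a full factor
  \<rho>^2. A surviving linear term would leave an error of the same order as the gain. The fourth
  moment enters because the entropy of Q h is estimated through an L^2 norm, hence through that of
  h. The obstacle is that |f| may vanish and f is only weakly differentiable, whereas subadditivity
  and Taylor expansion are carried out for functions between two positive constants with Lipschitz
  gradient. For these no semigroup is differentiated: rotation invariance of a pair of Gaussians
  does the work. The passage to f costs a factor 2 in the error term, harmless since \<rho> is free.
  Energy and deficit do not change when f is multiplied by a constant of modulus one, which is why
  the convergence to 1 is stated for nonnegative functions.\<close>

definition gauss_weight :: "real^'n \<Rightarrow> real" where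
  "gauss_weight x = 2 powr (real CARD('n) / 2) * exp (- 2 * pi * (norm x)\<^sup>2)"

lemma gauss_weight_pos [simp]: "gauss_weight x > 0"
  by (simp add: gauss_weight_def)

lemma gauss_weight_nonneg [simp]: "gauss_weight x \<ge> 0"
  by (simp add: less_imp_le)

lemma continuous_gauss_weight: "continuous_on A gauss_weight"
  unfolding gauss_weight_def by (intro continuous_intros)

lemma borel_measurable_gauss_weight [measurable]: "gauss_weight \<in> borel_measurable borel"
  by (intro borel_measurable_continuous_onI continuous_gauss_weight)

lemma gauss_measure_eq: "gauss_measure = density lborel gauss_weight"
  by (simp add: gauss_measure_def gauss_weight_def)

lemma sets_gauss_measure [simp, measurable_cong]: "sets gauss_measure = sets borel"
  by (simp add: gauss_measure_def)

lemma space_gauss_measure [simp]: "space gauss_measure = UNIV"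
  by (simp add: gauss_measure_def)

lemma nn_integral_gauss_measure:
  assumes "f \<in> borel_measurable borel"
  shows "(\<integral>\<^sup>+x. f x \<partial>gauss_measure) = (\<integral>\<^sup>+x. ennreal (gauss_weight x) * f x \<partial>lborel)"
  using assms unfolding gauss_measure_eq by (subst nn_integral_density) auto

lemma nn_integral_lborel_affine:
  fixes f :: "'a::euclidean_space \<Rightarrow> ennreal" and c :: real
  assumes [measurable]: "f \<in> borel_measurable borel" and "c \<noteq> 0"
  shows "(\<integral>\<^sup>+x. f x \<partial>lborel) = ennreal (\<bar>c\<bar> ^ DIM('a)) * (\<integral>\<^sup>+x. f (t + c *\<^sub>R x) \<partial>lborel)"
  using assms
  by (subst lborel_affine[of c t])
     (simp_all add: nn_integral_density nn_integral_distr nn_integral_cmult abs_of_pos)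

lemma nn_integral_exp_square_real:
  fixes a :: real
  assumes "a > 0"
  shows "(\<integral>\<^sup>+x. ennreal (exp (- a * x\<^sup>2)) \<partial>lborel) = ennreal (sqrt (pi / a))"
proof -
  define \<sigma> where "\<sigma> = sqrt (1 / (2 * a))"
  have s: "\<sigma> > 0" "\<sigma>\<^sup>2 = 1 / (2 * a)" using assms by (auto simp: \<sigma>_def)
  have eq: "exp (- a * x\<^sup>2) = sqrt (pi / a) * normal_density 0 \<sigma> x" for x
    using assms by (simp add: normal_density_def s field_simps)
  interpret prob_space "density lborel (normal_density 0 \<sigma>)"
    by (rule prob_space_normal_density[OF s(1)])
  have "(\<integral>\<^sup>+x. ennreal (normal_density 0 \<sigma> x) \<partial>lborel) = 1"
    using emeasure_space_1 by (simp add: emeasure_density)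
  then show ?thesis
    unfolding eq using assms by (simp add: ennreal_mult nn_integral_cmult )
qed

lemma nn_integral_exp_norm_square:
  fixes a :: real
  assumes "a > 0"
  shows "(\<integral>\<^sup>+x. ennreal (exp (- a * (norm x)\<^sup>2)) \<partial>(lborel :: 'a::euclidean_space measure))
    = ennreal (sqrt (pi / a) ^ DIM('a))"
proof -
  have eq: "ennreal (exp (- a * (norm x)\<^sup>2)) = (\<Prod>b\<in>Basis. ennreal (exp (- a * (x \<bullet> b)\<^sup>2)))" for x :: 'a
    by (simp add: power2_norm_eq_inner euclidean_inner[of x x] prod_ennreal
        exp_sum[symmetric] sum_distrib_left sum_negf flip: power2_eq_square)
  show ?thesis
    unfolding eq
    by (subst nn_integral_lborel_prod)
       (use assms in \<open>simp_all only: nn_integral_exp_square_real, simp_all add: ennreal_power del: mult_minus_left\<close>)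
qed

lemma nn_integral_exp_norm_square_shift:
  fixes a :: real and t :: "'a::euclidean_space"
  assumes "a > 0"
  shows "(\<integral>\<^sup>+x. ennreal (exp (- a * (norm (x - t))\<^sup>2)) \<partial>lborel)
    = ennreal (sqrt (pi / a) ^ DIM('a))"
  using nn_integral_lborel_affine[of "\<lambda>x. ennreal (exp (- a * (norm (x - t))\<^sup>2))" 1 t]
    nn_integral_exp_norm_square[OF assms, where ?'a='a] by simp

lemma powr_half_eq: "2 powr (real CARD('n::finite) / 2) = sqrt 2 ^ CARD('n)"
proof -
  have "sqrt 2 ^ CARD('n) = (2 powr (1 / 2)) powr real CARD('n)"
    by (subst powr_realpow) (simp_all add: powr_half_sqrt)
  then show ?thesis by (simp only: powr_powr) simp
qed

interpretation gauss: prob_space "gauss_measure :: (real^'n) measure"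
proof
  have "emeasure (gauss_measure :: (real^'n) measure) UNIV
      = (\<integral>\<^sup>+x. ennreal (2 powr (real CARD('n) / 2)) * ennreal (exp (- (2 * pi) * (norm x)\<^sup>2))
          \<partial>(lborel :: (real^'n) measure))"
    unfolding gauss_measure_eq gauss_weight_def by (simp add: emeasure_density flip: ennreal_mult)
  also have "\<dots> = ennreal (2 powr (real CARD('n) / 2)) * ennreal (sqrt (pi / (2 * pi)) ^ DIM(real^'n))"
    by (subst nn_integral_cmult, measurable, subst nn_integral_exp_norm_square) simp_all
  also have "\<dots> = 1"
    by (simp add: powr_half_eq real_sqrt_divide power_one_over flip: ennreal_mult)
  finally show "emeasure gauss_measure (space gauss_measure :: (real^'n) set) = 1" by simp
qed

lemma measure_gauss_UNIV [simp]: "measure gauss_measure UNIV = 1"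
  using gauss.prob_space by simp

lemma emeasure_gauss_UNIV [simp]: "emeasure gauss_measure UNIV = 1"
  using gauss.emeasure_space_1 by simp

text \<open>Density, with respect to the Gaussian measure, of its image under \<open>z \<mapsto> v + \<sigma> z\<close>.\<close>

definition gauss_kernel :: "real \<Rightarrow> real^'n \<Rightarrow> real^'n \<Rightarrow> real" where
  "gauss_kernel \<sigma> v x = exp (2 * pi * (norm x)\<^sup>2 - 2 * pi * (norm (x - v))\<^sup>2 / \<sigma>\<^sup>2) / \<sigma> ^ CARD('n)"

lemma gauss_kernel_nonneg: "\<sigma> > 0 \<Longrightarrow> gauss_kernel \<sigma> v x \<ge> 0"
  by (simp add: gauss_kernel_def)

lemma borel_measurable_gauss_kernel [measurable]:
  assumes [measurable]: "f \<in> borel_measurable M" "g \<in> borel_measurable M"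
  shows "(\<lambda>x. gauss_kernel \<sigma> (f x) (g x)) \<in> borel_measurable M"
  unfolding gauss_kernel_def by measurable

section \<open>Affine images and rotation invariance of the Gaussian measure\<close>

lemma distr_gauss_affine:
  fixes v :: "real^'n"
  assumes "\<sigma> > 0"
  shows "distr gauss_measure borel (\<lambda>z. v + \<sigma> *\<^sub>R z) = density gauss_measure (gauss_kernel \<sigma> v)"
proof (rule measure_eqI)
  fix A :: "(real^'n) set" assume "A \<in> sets (distr gauss_measure borel (\<lambda>z. v + \<sigma> *\<^sub>R z))"
  then have [measurable]: "A \<in> sets borel" by simp
  have w: "gauss_weight x * gauss_kernel \<sigma> v x * \<sigma> ^ CARD('n) = gauss_weight ((x - v) /\<^sub>R \<sigma>)" for x
  proof -
    have "norm ((x - v) /\<^sub>R \<sigma>) = norm (x - v) / \<sigma>" using assms by (simp add: divide_inverse)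
    then show ?thesis
      using assms by (simp add: gauss_weight_def gauss_kernel_def power_divide flip: exp_add)
  qed
  have *: "gauss_weight (v + \<sigma> *\<^sub>R z) * gauss_kernel \<sigma> v (v + \<sigma> *\<^sub>R z) * \<sigma> ^ CARD('n) = gauss_weight z" for z
    unfolding w using assms by simp
  have "emeasure (distr gauss_measure borel (\<lambda>z. v + \<sigma> *\<^sub>R z)) A
      = (\<integral>\<^sup>+z. indicator A (v + \<sigma> *\<^sub>R z) \<partial>gauss_measure)"
    by (subst nn_integral_indicator[symmetric], simp, subst nn_integral_distr) auto
  also have "\<dots> = (\<integral>\<^sup>+z. ennreal (gauss_weight z) * indicator A (v + \<sigma> *\<^sub>R z) \<partial>lborel)"
    by (subst nn_integral_gauss_measure) auto
  also have "\<dots> = (\<integral>\<^sup>+z. ennreal (\<sigma> ^ CARD('n)) * (ennreal (gauss_weight (v + \<sigma> *\<^sub>R z)) *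
       (ennreal (gauss_kernel \<sigma> v (v + \<sigma> *\<^sub>R z)) * indicator A (v + \<sigma> *\<^sub>R z))) \<partial>lborel)"
    using assms by (intro nn_integral_cong, subst *[symmetric])
      (simp add: gauss_kernel_nonneg ennreal_mult mult_ac)
  also have "\<dots> = (\<integral>\<^sup>+x. ennreal (gauss_weight x) * (ennreal (gauss_kernel \<sigma> v x) * indicator A x) \<partial>lborel)"
    by (subst nn_integral_lborel_affine[of "\<lambda>x. ennreal (gauss_weight x) * (ennreal (gauss_kernel \<sigma> v x) * indicator A x)" \<sigma> v])
      (use assms in \<open>simp_all add: nn_integral_cmult\<close>)
  also have "\<dots> = emeasure (density gauss_measure (gauss_kernel \<sigma> v)) A"
    by (simp add: emeasure_density nn_integral_gauss_measure)
  finally show "emeasure (distr gauss_measure borel (\<lambda>z. v + \<sigma> *\<^sub>R z)) A = \<dots>" .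
qed simp

text \<open>With \<rho>^2 + \<sigma>^2 = 1 the exponent of the kernel is symmetric in x and y (it is
  the Mehler kernel), so completing the square in y leaves a Gaussian centred at \<rho> x, whose
  mass does not depend on x.\<close>

lemma nn_integral_gauss_kernel_1:
  fixes x :: "real^'n"
  assumes "\<sigma> > 0" "\<rho>\<^sup>2 + \<sigma>\<^sup>2 = 1"
  shows "(\<integral>\<^sup>+y. ennreal (gauss_kernel \<sigma> (\<rho> *\<^sub>R y) x) \<partial>gauss_measure) = 1"
proof -
  have r: "\<rho>\<^sup>2 = 1 - \<sigma>\<^sup>2" using assms by simp
  have "- 2 * pi * (norm y)\<^sup>2 + (2 * pi * (norm x)\<^sup>2 - 2 * pi * (norm (x - \<rho> *\<^sub>R y))\<^sup>2 / \<sigma>\<^sup>2)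
      = - (2 * pi / \<sigma>\<^sup>2) * (norm (y - \<rho> *\<^sub>R x))\<^sup>2" for y
  proof -
    have "(norm (x - \<rho> *\<^sub>R y))\<^sup>2 = (norm x)\<^sup>2 - 2 * \<rho> * (x \<bullet> y) + (1 - \<sigma>\<^sup>2) * (norm y)\<^sup>2"
      "(norm (y - \<rho> *\<^sub>R x))\<^sup>2 = (norm y)\<^sup>2 - 2 * \<rho> * (x \<bullet> y) + (1 - \<sigma>\<^sup>2) * (norm x)\<^sup>2"
      by (simp_all add: power2_norm_eq_inner inner_diff inner_commute flip: r)
        (simp_all add: power2_eq_square)
    then show ?thesis using assms(1) by (simp only:) (simp add: field_simps)
  qed
  then have eq: "ennreal (gauss_weight y) * ennreal (gauss_kernel \<sigma> (\<rho> *\<^sub>R y) x)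
      = ennreal (sqrt 2 ^ CARD('n) / \<sigma> ^ CARD('n)) * ennreal (exp (- (2 * pi / \<sigma>\<^sup>2) * (norm (y - \<rho> *\<^sub>R x))\<^sup>2))" for y
    using assms(1)
    by (simp add: gauss_weight_def gauss_kernel_def powr_half_eq flip: ennreal_mult exp_add)
  have "(\<integral>\<^sup>+y. ennreal (gauss_kernel \<sigma> (\<rho> *\<^sub>R y) x) \<partial>gauss_measure)
      = ennreal (sqrt 2 ^ CARD('n) / \<sigma> ^ CARD('n)) * ennreal (sqrt (pi / (2 * pi / \<sigma>\<^sup>2)) ^ DIM(real^'n))"
    using assms(1)
    by (subst nn_integral_gauss_measure, measurable, unfold eq, subst nn_integral_cmult, measurable,
        subst nn_integral_exp_norm_square_shift) simp_all
  also have "\<dots> = 1"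
    using assms(1) by (simp add: real_sqrt_divide power_divide real_sqrt_mult flip: ennreal_mult)
  finally show ?thesis .
qed

text \<open>Instead of an orthogonal change of variables on pairs, the inner integral over z is
  rewritten with the kernel; after Fubini the kernel integrates to 1 in y.\<close>

lemma distr_gauss_rotation:
  assumes "\<sigma> > 0" "\<rho>\<^sup>2 + \<sigma>\<^sup>2 = 1"
  shows "distr (gauss_measure \<Otimes>\<^sub>M gauss_measure) borel (\<lambda>(y, z). \<rho> *\<^sub>R y + \<sigma> *\<^sub>R z)
    = (gauss_measure :: (real^'n) measure)" (is "distr ?P _ ?T = _")
proof (rule measure_eqI)
  interpret pair_sigma_finite "gauss_measure :: (real^'n) measure" "gauss_measure :: (real^'n) measure" ..
  have [measurable]: "?T \<in> borel_measurable ?P" by measurable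
  fix A :: "(real^'n) set" assume "A \<in> sets (distr ?P borel ?T)"
  then have [measurable]: "A \<in> sets borel" by simp
  have "emeasure (distr ?P borel ?T) A = (\<integral>\<^sup>+p. indicator A (?T p) \<partial>?P)"
    by (subst nn_integral_indicator[symmetric], simp, subst nn_integral_distr) auto
  also have "\<dots> = (\<integral>\<^sup>+y. \<integral>\<^sup>+z. indicator A (\<rho> *\<^sub>R y + \<sigma> *\<^sub>R z) \<partial>gauss_measure \<partial>gauss_measure)"
    by (subst gauss.nn_integral_fst[symmetric]) auto
  also have "\<dots> = (\<integral>\<^sup>+y. \<integral>\<^sup>+x. ennreal (gauss_kernel \<sigma> (\<rho> *\<^sub>R y) x) * indicator A x \<partial>gauss_measure \<partial>gauss_measure)"
  proof (rule nn_integral_cong)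
    fix y :: "real^'n"
    have "(\<integral>\<^sup>+z. indicator A (\<rho> *\<^sub>R y + \<sigma> *\<^sub>R z) \<partial>gauss_measure)
      = (\<integral>\<^sup>+x. indicator A x \<partial>distr gauss_measure borel (\<lambda>z. \<rho> *\<^sub>R y + \<sigma> *\<^sub>R z))"
      by (subst nn_integral_distr) auto
    then show "(\<integral>\<^sup>+z. indicator A (\<rho> *\<^sub>R y + \<sigma> *\<^sub>R z) \<partial>gauss_measure)
      = (\<integral>\<^sup>+x. ennreal (gauss_kernel \<sigma> (\<rho> *\<^sub>R y) x) * indicator A x \<partial>gauss_measure)"
      unfolding distr_gauss_affine[OF assms(1)] by (subst (asm) nn_integral_density) auto
  qed
  also have "\<dots> = (\<integral>\<^sup>+x. \<integral>\<^sup>+y. ennreal (gauss_kernel \<sigma> (\<rho> *\<^sub>R y) x) * indicator A x \<partial>gauss_measure \<partial>gauss_measure)"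
    by (rule Fubini') measurable
  also have "\<dots> = (\<integral>\<^sup>+x. indicator A x \<partial>gauss_measure)"
    by (simp add: nn_integral_multc nn_integral_gauss_kernel_1[OF assms])
  finally show "emeasure (distr ?P borel ?T) A = emeasure gauss_measure A" by simp
qed simp

section \<open>Exponential and second moments of the Gaussian\<close>

lemma integrable_exp_norm_square:
  assumes "a < 2 * pi"
  shows "integrable (gauss_measure :: (real^'n) measure) (\<lambda>x. exp (a * (norm x)\<^sup>2))"
proof (rule integrableI_nonneg)
  have "(\<integral>\<^sup>+x. ennreal (exp (a * (norm x)\<^sup>2)) \<partial>(gauss_measure :: (real^'n) measure))
     = (\<integral>\<^sup>+x. ennreal (2 powr (real CARD('n) / 2)) * ennreal (exp (- (2 * pi - a) * (norm x)\<^sup>2))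
          \<partial>(lborel :: (real^'n) measure))"
  proof (subst nn_integral_gauss_measure, measurable, rule nn_integral_cong)
    fix x :: "real^'n"
    have "- 2 * pi * (norm x)\<^sup>2 + a * (norm x)\<^sup>2 = - (2 * pi - a) * (norm x)\<^sup>2"
      by (simp add: algebra_simps)
    then show "ennreal (gauss_weight x) * ennreal (exp (a * (norm x)\<^sup>2)) = ennreal (2 powr (real CARD('n) / 2)) *
        ennreal (exp (- (2 * pi - a) * (norm x)\<^sup>2))"
      by (simp add: gauss_weight_def mult.assoc flip: ennreal_mult exp_add)
  qed
  also have "\<dots> = ennreal (2 powr (real CARD('n) / 2)) * ennreal (sqrt (pi / (2 * pi - a)) ^ DIM(real^'n))"
    using assms by (subst nn_integral_cmult, measurable, subst nn_integral_exp_norm_square) auto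
  also have "\<dots> < \<infinity>" by (simp add: ennreal_mult_less_top)
  finally show "(\<integral>\<^sup>+x. ennreal (exp (a * (norm x)\<^sup>2)) \<partial>(gauss_measure :: (real^'n) measure)) < \<infinity>" .
qed auto

lemma has_bochner_integral_gauss_mgf:
  "has_bochner_integral gauss_measure (\<lambda>x. exp (b \<bullet> x)) (exp ((norm b)\<^sup>2 / (8 * pi)))" for b :: "real^'n"
proof (rule has_bochner_integral_nn_integral)
  define t where "t = (1 / (4 * pi)) *\<^sub>R b"
  have eq: "ennreal (gauss_weight x) * ennreal (exp (b \<bullet> x)) = ennreal (2 powr (real CARD('n) / 2) * exp ((norm b)\<^sup>2 / (8 * pi))) *
     ennreal (exp (- (2 * pi) * (norm (x - t))\<^sup>2))" for x
  proof -
    have "(norm (x - t))\<^sup>2 = (norm x)\<^sup>2 - (b \<bullet> x) / (2 * pi) + (norm b)\<^sup>2 / (16 * pi\<^sup>2)"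
      unfolding t_def power2_norm_eq_inner
      by (simp add: inner_diff inner_commute power2_eq_square field_simps)
    then have "- 2 * pi * (norm x)\<^sup>2 + b \<bullet> x = (norm b)\<^sup>2 / (8 * pi) + - (2 * pi) * (norm (x - t))\<^sup>2"
      by (simp add: field_simps power2_eq_square)
    then show ?thesis by (simp add: gauss_weight_def mult.assoc flip: ennreal_mult exp_add)
  qed
  have "(\<integral>\<^sup>+x. ennreal (exp (b \<bullet> x)) \<partial>gauss_measure)
     = ennreal (2 powr (real CARD('n) / 2) * exp ((norm b)\<^sup>2 / (8 * pi))) * ennreal (sqrt (pi / (2 * pi)) ^ DIM(real^'n))"
    by (subst nn_integral_gauss_measure, measurable, unfold eq, subst nn_integral_cmult, measurable,
        subst nn_integral_exp_norm_square_shift) simp_all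
  also have "\<dots> = ennreal (exp ((norm b)\<^sup>2 / (8 * pi)))"
    by (simp add: powr_half_eq real_sqrt_divide power_one_over flip: ennreal_mult)
  finally show "(\<integral>\<^sup>+x. ennreal (exp (b \<bullet> x)) \<partial>gauss_measure) = ennreal (exp ((norm b)\<^sup>2 / (8 * pi)))" .
qed auto

lemma integrable_gauss_poly:
  "integrable (gauss_measure :: (real^'n) measure) (\<lambda>x. (1 + norm x) ^ k)"
proof (rule Bochner_Integration.integrable_bound)
  show "integrable (gauss_measure :: (real^'n) measure) (\<lambda>x. exp (real k ^ 2) * exp (1 * (norm x)\<^sup>2))"
    by (intro integrable_mult_right integrable_exp_norm_square) (use pi_gt3 in simp)
  have "(1 + r) ^ k \<le> exp (real k ^ 2) * exp (1 * r\<^sup>2)" if "r \<ge> 0" for r :: real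
  proof -
    have "(1 + r) ^ k \<le> exp r ^ k"
      using that by (intro power_mono exp_ge_add_one_self) auto
    also have "\<dots> = exp (real k * r)"
      by (simp add: exp_of_nat_mult)
    also have "real k * r \<le> real k ^ 2 + 1 * r\<^sup>2"
      using sum_squares_bound[of "real k" r] that
        mult_nonneg_nonneg[of "real k" r] by linarith
    finally show ?thesis by (simp add: exp_add)
  qed
  then show "AE x in gauss_measure :: (real^'n) measure. norm ((1 + norm x) ^ k) \<le> norm (exp (real k ^ 2) * exp (1 * (norm x)\<^sup>2))"
    by (auto simp: abs_mult)
qed auto


text \<open>The right side is (2 sinh (u / 2))^2, and sinh v \<ge> v for v \<ge> 0. This turns
  exponential moments into second moments without differentiating under the integral.\<close>

lemma square_le_exp_plus_exp: "u\<^sup>2 \<le> exp u + exp (- u) - 2" for u :: real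
proof -
  have *: "2 * v \<le> exp v - exp (- v)" if "v \<ge> 0" for v :: real
  proof -
    have "\<exists>y. ((\<lambda>v. exp v - exp (- v) - 2 * v) has_real_derivative y) (at x) \<and> 0 \<le> y" for x :: real
    proof (intro exI conjI)
      show "((\<lambda>v. exp v - exp (- v) - 2 * v) has_real_derivative (exp x + exp (- x) - 2)) (at x)"
        by (auto intro!: derivative_eq_intros)
      have "0 \<le> (exp (x / 2) - exp (- (x / 2)))\<^sup>2" by simp
      also have "\<dots> = exp x + exp (- x) - 2"
        by (simp add: power2_diff flip: exp_double exp_add)
      finally show "0 \<le> exp x + exp (- x) - 2" .
    qed
    then show ?thesis
      using DERIV_nonneg_imp_nondecreasing[of 0 v "\<lambda>v. exp v - exp (- v) - 2 * v"] that by simp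
  qed
  have "\<bar>u\<bar>\<^sup>2 \<le> (exp (\<bar>u\<bar> / 2) - exp (- (\<bar>u\<bar> / 2)))\<^sup>2"
    using *[of "\<bar>u\<bar> / 2"] by (intro power_mono) auto
  also have "\<dots> = exp u + exp (- u) - 2"
    by (cases "u \<ge> 0") (simp_all add: power2_diff flip: exp_double exp_add)
  finally show ?thesis by simp
qed

lemma integrable_gauss_inner_square:
  "integrable gauss_measure (\<lambda>x. (b \<bullet> x)\<^sup>2)" for b :: "real^'n"
proof (rule Bochner_Integration.integrable_bound)
  show "integrable gauss_measure (\<lambda>x. (norm b)\<^sup>2 * (1 + norm x) ^ 2)"
    by (intro integrable_mult_right integrable_gauss_poly)
  have "(b \<bullet> x)\<^sup>2 \<le> (norm b)\<^sup>2 * (1 + norm x) ^ 2" for x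
  proof -
    have "\<bar>b \<bullet> x\<bar> \<le> norm b * (1 + norm x)"
      using Cauchy_Schwarz_ineq2[of b x] by (smt (verit) mult_left_mono norm_ge_zero)
    then show ?thesis
      by (metis power2_abs power_mono abs_ge_zero power_mult_distrib)
  qed
  then show "AE x in gauss_measure. norm ((b \<bullet> x)\<^sup>2) \<le> norm ((norm b)\<^sup>2 * (1 + norm x) ^ 2)"
    by auto
qed auto

text \<open>Put u = t (b . x) in \<open>square_le_exp_plus_exp\<close>, integrate with the moment
  generating function, divide by t^2 and let t tend to 0. The factor 1 / (4 pi) is the variance of a
  coordinate; doubled, it becomes the constant 1 / (2 pi) of the logarithmic Sobolev
  inequality.\<close>

lemma integral_gauss_inner_square:
  "(LINT x|gauss_measure. (b \<bullet> x)\<^sup>2) \<le> (norm b)\<^sup>2 / (4 * pi)" for b :: "real^'n"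
proof -
  define B where "B = (norm b)\<^sup>2 / (8 * pi)"
  have mgf: "has_bochner_integral gauss_measure (\<lambda>x. exp (t * (b \<bullet> x))) (exp (t\<^sup>2 * B))" for t
    using has_bochner_integral_gauss_mgf[of "t *\<^sub>R b"] by (simp add: B_def power_mult_distrib)
  have le: "(LINT x|gauss_measure. (b \<bullet> x)\<^sup>2) \<le> 2 * (exp (t\<^sup>2 * B) - 1) / t\<^sup>2" if "t > 0" for t
  proof -
    have i: "has_bochner_integral gauss_measure (\<lambda>x. exp (t * (b \<bullet> x)) + exp (- t * (b \<bullet> x)) - 2)
       (exp (t\<^sup>2 * B) + exp (t\<^sup>2 * B) - 2)"
      using mgf[of t] mgf[of "- t"] gauss.prob_space
      by (intro has_bochner_integral_diff has_bochner_integral_add)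
         (auto simp: has_bochner_integral_iff)
    have "(LINT x|gauss_measure. t\<^sup>2 * (b \<bullet> x)\<^sup>2) \<le> (LINT x|gauss_measure. exp (t * (b \<bullet> x)) + exp (- t * (b \<bullet> x)) - 2)"
      using i square_le_exp_plus_exp[of "t * (b \<bullet> _)"]
      by (intro integral_mono integrable_mult_right integrable_gauss_inner_square)
         (auto simp: has_bochner_integral_iff power_mult_distrib)
    then show ?thesis
      using i that integrable_gauss_inner_square[of b] by (simp add: has_bochner_integral_iff field_simps)
  qed
  have "(LINT x|gauss_measure. (b \<bullet> x)\<^sup>2) \<le> 2 * B + e" if "e > 0" for e
  proof -
    have B: "B \<ge> 0" by (simp add: B_def)
    \<comment> \<open>Here s stands for t^2. The first entry gives s B \<le> 1, as the quadratic
      bound on exp requires; the second makes the error 2 s B^2 at most e.\<close>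
    define s where "s = min (1 / (B + 1)) (e / (2 * (B\<^sup>2 + 1)))"
    have pos: "0 < 2 * (B\<^sup>2 + 1)" by (smt (verit) zero_le_power2)
    have s: "s > 0" using that B pos by (simp add: s_def)
    have "s * B \<le> 1 / (B + 1) * B" using B by (intro mult_right_mono) (auto simp: s_def)
    also have "\<dots> \<le> 1" using B by (simp add: field_simps)
    finally have 1: "s * B \<le> 1" .
    have "s * (2 * (B\<^sup>2 + 1)) \<le> e / (2 * (B\<^sup>2 + 1)) * (2 * (B\<^sup>2 + 1))"
      using pos by (intro mult_right_mono) (auto simp: s_def)
    then have "s * (2 * (B\<^sup>2 + 1)) \<le> e" using pos by simp
    then have 2: "2 * s * B\<^sup>2 + 2 * s \<le> e" by (simp add: algebra_simps)
    have "exp (s * B) \<le> 1 + s * B + (s * B)\<^sup>2" using s B 1 by (intro exp_bound) auto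
    then have "2 * (exp (s * B) - 1) / s \<le> 2 * (s * B + (s * B)\<^sup>2) / s"
      using s by (intro divide_right_mono) auto
    also have "\<dots> = 2 * B + 2 * s * B\<^sup>2" using s by (simp add: field_simps power2_eq_square)
    also have "\<dots> \<le> 2 * B + e" using 2 s by simp
    finally show ?thesis using le[of "sqrt s"] s by simp
  qed
  then have "(LINT x|gauss_measure. (b \<bullet> x)\<^sup>2) \<le> 2 * B" by (rule field_le_epsilon)
  then show ?thesis by (simp add: B_def)
qed

subsection \<open>Entropy and the logarithmic Sobolev inequality\<close>

definition entropy_of :: "'a measure \<Rightarrow> ('a \<Rightarrow> real) \<Rightarrow> real" where
  "entropy_of M f = (LINT x|M. f x * ln (f x)) - (LINT x|M. f x) * ln (LINT x|M. f x)"

lemma abs_ln_le: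
  fixes t :: real
  assumes "0 < a" "a \<le> t" "t \<le> b"
  shows "\<bar>ln t\<bar> \<le> \<bar>ln a\<bar> + \<bar>ln b\<bar>"
  using assms ln_le_cancel_iff[of a t] ln_le_cancel_iff[of t b] by linarith

text \<open>The nonnegativity of relative entropy before integration, from ln x \<le> x - 1. The
  linear terms t - q make it usable for functions of different means.\<close>

lemma gibbs_pointwise:
  fixes t q :: real
  assumes "0 < t" "0 < q"
  shows "t * ln q + t - q \<le> t * ln t"
proof -
  have "ln (q / t) \<le> q / t - 1" using assms by (intro ln_le_minus_one) auto
  then have "t * ln (q / t) \<le> q - t" using assms by (simp add: field_simps)
  then show ?thesis using assms by (simp add: ln_div algebra_simps)
qed

lemma (in prob_space) integral_in_interval:
  fixes f :: "'a \<Rightarrow> real"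
  assumes "f \<in> borel_measurable M" "\<And>x. a \<le> f x" "\<And>x. f x \<le> b"
  shows "integrable M f" "a \<le> (LINT x|M. f x)" "(LINT x|M. f x) \<le> b"
proof -
  show i: "integrable M f"
    using assms by (intro integrable_const_bound[of _ "\<bar>a\<bar> + \<bar>b\<bar>"] AE_I2) (auto simp: abs_le_iff, smt+)
  show "a \<le> (LINT x|M. f x)" "(LINT x|M. f x) \<le> b"
    using integral_mono[OF integrable_const i, of a] integral_mono[OF i integrable_const, of b] assms prob_space
    by auto
qed

lemma (in prob_space) abs_entropy_of_le:
  assumes [measurable]: "f \<in> borel_measurable M" and "0 < a" "\<And>x. a \<le> f x" "\<And>x. f x \<le> b"
  shows "integrable M (\<lambda>x. f x * ln (f x))"
    "\<bar>entropy_of M f\<bar> \<le> 2 * (b * (\<bar>ln a\<bar> + \<bar>ln b\<bar>))"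
proof -
  define K where "K = b * (\<bar>ln a\<bar> + \<bar>ln b\<bar>)"
  have le: "\<bar>t * ln t\<bar> \<le> K" if "a \<le> t" "t \<le> b" for t
    unfolding K_def abs_mult using that assms abs_ln_le[of a t b] by (intro mult_mono) auto
  note I = integral_in_interval[OF assms(1,3,4)]
  have "- K \<le> f x * ln (f x)" "f x * ln (f x) \<le> K" for x
    using le[OF assms(3,4)[of x]] by auto
  then have J: "integrable M (\<lambda>x. f x * ln (f x))" "- K \<le> (LINT x|M. f x * ln (f x))" "(LINT x|M. f x * ln (f x)) \<le> K"
    by (intro integral_in_interval[of "\<lambda>x. f x * ln (f x)" "- K" K]; simp)+
  show "integrable M (\<lambda>x. f x * ln (f x))" by (rule J)
  have "\<bar>LINT x|M. f x * ln (f x)\<bar> \<le> K" using J(2,3) by (auto simp: abs_le_iff) 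
  moreover have "\<bar>(LINT x|M. f x) * ln (LINT x|M. f x)\<bar> \<le> K" using le[OF I(2,3)] .
  ultimately show "\<bar>entropy_of M f\<bar> \<le> 2 * (b * (\<bar>ln a\<bar> + \<bar>ln b\<bar>))"
    unfolding entropy_of_def K_def by linarith
qed

text \<open>By Fubini each average on the right is the integral of F ln F minus that of
  \<open>F1 * ln F1\<close> or \<open>F2 * ln F2\<close>. The claim thus says that the relative
  entropy of F with respect to \<open>F1 x * F2 y / m\<close> is nonnegative. The bounds a and b
  keep every integrand bounded, so all integrability is immediate.\<close>

lemma entropy_of_pair_le:
  fixes F :: "'a \<times> 'b \<Rightarrow> real"
  assumes "prob_space M" "prob_space N"
    and [measurable]: "F \<in> borel_measurable (M \<Otimes>\<^sub>M N)"
    and a: "0 < a" "\<And>p. a \<le> F p" "\<And>p. F p \<le> b"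
  shows "entropy_of (M \<Otimes>\<^sub>M N) F
    \<le> (LINT x|M. entropy_of N (\<lambda>y. F (x, y))) + (LINT y|N. entropy_of M (\<lambda>x. F (x, y)))"
proof -
  interpret M: prob_space M by fact
  interpret N: prob_space N by fact
  interpret P: pair_prob_space M N ..
  define F1 where "F1 x = (LINT y|N. F (x, y))" for x
  define F2 where "F2 y = (LINT x|M. F (x, y))" for y
  define m where "m = (LINT p|(M \<Otimes>\<^sub>M N). F p)"
  have [measurable]: "F1 \<in> borel_measurable M" "F2 \<in> borel_measurable N"
    unfolding F1_def F2_def by measurable
  have F1b: "a \<le> F1 x" "F1 x \<le> b" if "x \<in> space M" for x
    unfolding F1_def by (rule N.integral_in_interval; use a that in auto)+
  have F2b: "a \<le> F2 x" "F2 x \<le> b" if "x \<in> space N" for x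
    unfolding F2_def by (rule M.integral_in_interval; use a that in auto)+
  note m = P.integral_in_interval[OF assms(3) a(2,3), folded m_def]
  have m0: "m > 0" using m a by simp
  define K where "K = b * (\<bar>ln a\<bar> + \<bar>ln b\<bar>)"
  have K: "\<bar>s * ln t\<bar> \<le> K" if "a \<le> t" "t \<le> b" "a \<le> s" "s \<le> b" for s t
    unfolding K_def abs_mult using that a abs_ln_le[of a t b] by (intro mult_mono) auto
  have i1: "integrable (M \<Otimes>\<^sub>M N) (\<lambda>(x, y). F (x, y) * ln (F1 x))"
    using a F1b by (intro P.integrable_const_bound[of _ K] AE_I2) (auto simp: space_pair_measure intro!: K)
  have i2: "integrable (M \<Otimes>\<^sub>M N) (\<lambda>(x, y). F (x, y) * ln (F2 y))"
    using a F2b by (intro P.integrable_const_bound[of _ K] AE_I2) (auto simp: space_pair_measure intro!: K)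
  have "\<bar>s * t\<bar> \<le> b * b" if "a \<le> t" "t \<le> b" "a \<le> s" "s \<le> b" for s t
    unfolding abs_mult using that a by (intro mult_mono) auto
  then have i3: "integrable (M \<Otimes>\<^sub>M N) (\<lambda>(x, y). F1 x * F2 y)"
    using F1b F2b by (intro P.integrable_const_bound[of _ "b * b"] AE_I2) (auto simp: space_pair_measure)
  have i0: "integrable (M \<Otimes>\<^sub>M N) (\<lambda>p. F p * ln (F p))"
    using P.abs_entropy_of_le[OF assms(3) a(1)] a by blast
  have j1: "(LINT p|(M \<Otimes>\<^sub>M N). (case p of (x, y) \<Rightarrow> F (x, y) * ln (F1 x))) = (LINT x|M. F1 x * ln (F1 x))"
    using i1 by (subst P.integral_fst'[symmetric]) (auto simp: F1_def)
  have j2: "(LINT p|(M \<Otimes>\<^sub>M N). (case p of (x, y) \<Rightarrow> F (x, y) * ln (F2 y))) = (LINT y|N. F2 y * ln (F2 y))"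
    using i2 by (subst P.integral_snd[symmetric]) (auto simp: F2_def)
  have mF1: "(LINT x|M. F1 x) = m" unfolding F1_def m_def using m(1) by (simp add: P.integral_fst')
  have mF2: "(LINT y|N. F2 y) = m" unfolding F2_def m_def using m(1)
    by (subst P.integral_snd) auto
  have j3: "(LINT p|(M \<Otimes>\<^sub>M N). (case p of (x, y) \<Rightarrow> F1 x * F2 y)) = m * m"
    using i3 by (subst P.integral_fst'[symmetric]) (auto simp: mF1 mF2)
  have j01: "(LINT x|M. LINT y|N. F (x, y) * ln (F (x, y))) = (LINT p|(M \<Otimes>\<^sub>M N). F p * ln (F p))"
    using P.integral_fst'[OF i0] by simp
  have j02: "(LINT y|N. LINT x|M. F (x, y) * ln (F (x, y))) = (LINT p|(M \<Otimes>\<^sub>M N). F p * ln (F p))"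
    using P.integral_snd[of "\<lambda>x y. F (x, y) * ln (F (x, y))"] i0 by (simp add: case_prod_beta')
  have k01: "integrable M (\<lambda>x. LINT y|N. F (x, y) * ln (F (x, y)))"
    using P.integrable_fst'[OF i0] by simp
  have k02: "integrable N (\<lambda>y. LINT x|M. F (x, y) * ln (F (x, y)))"
    using P.integrable_snd[of "\<lambda>x y. F (x, y) * ln (F (x, y))"] i0 by (simp add: case_prod_beta')
  have k1: "integrable M (\<lambda>x. F1 x * ln (F1 x))"
    using F1b by (intro M.integrable_const_bound[of _ K] AE_I2) (auto intro!: K)
  have k2: "integrable N (\<lambda>x. F2 x * ln (F2 x))"
    using F2b by (intro N.integrable_const_bound[of _ K] AE_I2) (auto intro!: K)
  have e1: "(LINT x|M. entropy_of N (\<lambda>y. F (x, y))) = (LINT p|(M \<Otimes>\<^sub>M N). F p * ln (F p)) - (LINT x|M. F1 x * ln (F1 x))"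
    unfolding entropy_of_def F1_def[symmetric] using k01 k1 by (simp add: j01)
  have e2: "(LINT y|N. entropy_of M (\<lambda>x. F (x, y))) = (LINT p|(M \<Otimes>\<^sub>M N). F p * ln (F p)) - (LINT y|N. F2 y * ln (F2 y))"
    unfolding entropy_of_def F2_def[symmetric] using k02 k2 by (simp add: j02)
  \<comment> \<open>Gibbs' inequality for \<open>F\<close> against the density \<open>F1 x * F2 y / m\<close>\<close>
  have "0 \<le> F p * ln (F p) - (case p of (x, y) \<Rightarrow> F (x, y) * ln (F1 x)) - (case p of (x, y) \<Rightarrow> F (x, y) * ln (F2 y))
      + F p * ln m - F p + (case p of (x, y) \<Rightarrow> F1 x * F2 y) / m" if "p \<in> space (M \<Otimes>\<^sub>M N)" for p
  proof -
    obtain x y where p: "p = (x, y)" by force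
    have pos: "F1 x > 0" "F2 y > 0" "F p > 0"
      using F1b[of x] F2b[of y] a(1) a(2)[of p] that by (auto simp: p space_pair_measure)
    show ?thesis
      using gibbs_pointwise[of "F p" "F1 x * F2 y / m"] pos m0
      by (simp add: p ln_mult ln_div algebra_simps)
  qed
  then have "0 \<le> (LINT p|(M \<Otimes>\<^sub>M N). F p * ln (F p) - (case p of (x, y) \<Rightarrow> F (x, y) * ln (F1 x)) - (case p of (x, y) \<Rightarrow> F (x, y) * ln (F2 y))
      + F p * ln m - F p + (case p of (x, y) \<Rightarrow> F1 x * F2 y) / m)"
    by (intro integral_nonneg_AE AE_I2) auto
  also have "\<dots> = (LINT p|(M \<Otimes>\<^sub>M N). F p * ln (F p)) - (LINT x|M. F1 x * ln (F1 x)) - (LINT y|N. F2 y * ln (F2 y)) + m * ln m - m + m * m / m"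
    using i0 i1 i2 i3 m(1) by (simp add: j1 j2 j3 m_def[symmetric])
  finally show ?thesis
    unfolding e1 e2 unfolding entropy_of_def m_def[symmetric] using m0 by simp
qed

text \<open>The left side vanishes to first order at t = 1 and has second derivative 4 there. For t
  \<ge> 1 the bound ln t \<le> (t - 1 / t) / 2 produces exactly the remainder (t - 1)^3. For t < 1
  the bound ln t \<le> 2 (t - 1) / (t + 1) produces (t - 1)^3 / (t + 1), which is negative.\<close>

lemma entropy_taylor_ineq:
  fixes t :: real
  assumes "t > 0"
  shows "2 * t\<^sup>2 * ln t - t\<^sup>2 + 1 \<le> 2 * (t - 1)\<^sup>2 + \<bar>t - 1\<bar> ^ 3"
proof (cases "t \<ge> 1")
  case True
  have "\<exists>y. ((\<lambda>t. (t - 1 / t) / 2 - ln t) has_real_derivative y) (at x) \<and> 0 \<le> y" if "1 \<le> x" for x :: real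
  proof (intro exI conjI)
    show "((\<lambda>t. (t - 1 / t) / 2 - ln t) has_real_derivative (x - 1)\<^sup>2 / (2 * x\<^sup>2)) (at x)"
      using that by (auto intro!: derivative_eq_intros simp: field_simps power2_eq_square)
  qed simp
  then have "ln t \<le> (t - 1 / t) / 2"
    using DERIV_nonneg_imp_nondecreasing[of 1 t "\<lambda>t. (t - 1 / t) / 2 - ln t"] True by simp
  then have "2 * t\<^sup>2 * ln t \<le> 2 * t\<^sup>2 * ((t - 1 / t) / 2)" by (intro mult_left_mono) auto
  also have "\<dots> = t ^ 3 - t" using assms by (simp add: field_simps power2_eq_square power3_eq_cube)
  finally show ?thesis using True by (simp add: power2_eq_square power3_eq_cube algebra_simps)
next
  case False
  have "\<exists>y. ((\<lambda>t. ln t - 2 * (t - 1) / (t + 1)) has_real_derivative y) (at x) \<and> 0 \<le> y" if "t \<le> x" for x :: real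
  proof (intro exI conjI)
    have x: "x > 0" using that assms by simp
    then have "((\<lambda>t. ln t - 2 * (t - 1) / (t + 1)) has_real_derivative
        (1 / x - (2 * (x + 1) - 2 * (x - 1)) / ((x + 1) * (x + 1)))) (at x)"
      by (auto intro!: derivative_eq_intros)
    also have "1 / x - (2 * (x + 1) - 2 * (x - 1)) / ((x + 1) * (x + 1)) = (x - 1)\<^sup>2 / (x * (x + 1)\<^sup>2)"
      using x by (simp add: divide_simps) (simp add: power2_eq_square algebra_simps)
    finally show "((\<lambda>t. ln t - 2 * (t - 1) / (t + 1)) has_real_derivative (x - 1)\<^sup>2 / (x * (x + 1)\<^sup>2)) (at x)" .
  qed (use that assms in simp)
  then have "ln t \<le> 2 * (t - 1) / (t + 1)"
    using DERIV_nonneg_imp_nondecreasing[of t 1 "\<lambda>t. ln t - 2 * (t - 1) / (t + 1)"] False by simp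
  then have "2 * t\<^sup>2 * ln t \<le> 2 * t\<^sup>2 * (2 * (t - 1) / (t + 1))" by (intro mult_left_mono) auto
  also have "\<dots> = 2 * (t - 1)\<^sup>2 + t\<^sup>2 - 1 + (t - 1) ^ 3 / (t + 1)"
    using assms by (simp add: divide_simps) (simp add: power2_eq_square power3_eq_cube algebra_simps)
  also have "(t - 1) ^ 3 / (t + 1) \<le> \<bar>t - 1\<bar> ^ 3"
    using assms False by (simp add: divide_nonpos_pos order_trans[of _ 0])
  finally show ?thesis by simp
qed

section \<open>Functions with Lipschitz gradient and their logarithmic Sobolev inequality\<close>

lemma abs_diff_le_of_gradient_le:
  fixes \<phi> :: "'a::euclidean_space \<Rightarrow> real"
  assumes "\<And>x. (\<phi> has_derivative (\<lambda>v. D x \<bullet> v)) (at x)" "\<And>x. norm (D x) \<le> K"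
  shows "\<bar>\<phi> x - \<phi> y\<bar> \<le> K * norm (x - y)"
proof -
  have "norm (\<phi> x - \<phi> y) \<le> K * norm (x - y)"
  proof (rule differentiable_bound[of UNIV])
    fix x
    have "norm (D x \<bullet> v) \<le> K * norm v" for v
      using Cauchy_Schwarz_ineq2[of "D x" v] mult_right_mono[OF assms(2)[of x], of "norm v"] by simp
    then show "onorm (\<lambda>v. D x \<bullet> v) \<le> K" by (rule onorm_le)
  qed (auto intro: assms)
  then show ?thesis by simp
qed

text \<open>Mean value inequality on the segment for \<phi> minus its linear part at z, whose
  gradient there is at most L |h|. This yields L in place of the optimal L / 2, which is
  harmless.\<close>

lemma taylor_lipschitz_gradient:
  fixes \<phi> :: "'a::euclidean_space \<Rightarrow> real"
  assumes deriv: "\<And>x. (\<phi> has_derivative (\<lambda>v. D x \<bullet> v)) (at x)"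
    and lipschitz: "\<And>x y. norm (D x - D y) \<le> L * norm (x - y)" and L: "L \<ge> 0"
  shows "\<bar>\<phi> (z + h) - \<phi> z - D z \<bullet> h\<bar> \<le> L * (norm h)\<^sup>2"
proof -
  have "norm ((\<phi> (z + h) - D z \<bullet> (z + h)) - (\<phi> z - D z \<bullet> z)) \<le> L * norm h * norm ((z + h) - z)"
  proof (rule differentiable_bound[of "closed_segment z (z + h)"])
    fix x assume x: "x \<in> closed_segment z (z + h)"
    show "((\<lambda>x. \<phi> x - D z \<bullet> x) has_derivative (\<lambda>v. (D x - D z) \<bullet> v)) (at x within closed_segment z (z + h))"
      by (auto intro!: derivative_eq_intros has_derivative_at_withinI[OF deriv] simp: inner_diff_left)
    have "norm ((D x - D z) \<bullet> v) \<le> L * norm h * norm v" for v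
    proof -
      have "norm (x - z) \<le> norm h"
        using segment_bound1[OF x] by simp
      then have "L * norm (x - z) \<le> L * norm h" using L by (rule mult_left_mono)
      then have "norm (D x - D z) \<le> L * norm h" using lipschitz[of x z] by simp
      then have "norm (D x - D z) * norm v \<le> L * norm h * norm v" by (rule mult_right_mono) auto
      then show ?thesis using Cauchy_Schwarz_ineq2[of "D x - D z" v] by simp
    qed
    then show "onorm (\<lambda>v. (D x - D z) \<bullet> v) \<le> L * norm h" by (rule onorm_le)
  qed auto
  then show ?thesis by (simp add: inner_add_right power2_eq_square algebra_simps)
qed

lemma continuous_on_norm_lipschitz:
  fixes D :: "'a::real_normed_vector \<Rightarrow> 'b::real_normed_vector"
  assumes "\<And>x y. norm (D x - D y) \<le> L * norm (x - y)" "L \<ge> 0"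
  shows "continuous_on A D"
  by (rule lipschitz_on_continuous_on[of L], rule lipschitz_onI) (use assms in \<open>auto simp: dist_norm\<close>)


text \<open>The two positive bounds on g make all entropies finite and keep ln away from 0. The
  bounded, Lipschitz gradient makes the Taylor remainder uniform in the base point, which is
  essential because the small-scale inequality gets averaged over shifted base points.\<close>

locale log_sobolev_class =
  fixes g :: "real^'n \<Rightarrow> real" and D :: "real^'n \<Rightarrow> real^'n" and a b L :: real
  assumes a_pos: "0 < a" and a_le: "\<And>x. a \<le> g x" and le_b: "\<And>x. g x \<le> b"
    and deriv: "\<And>x. (g has_derivative (\<lambda>v. D x \<bullet> v)) (at x)"
    and norm_D: "\<And>x. norm (D x) \<le> L"
    and lipschitz_D: "\<And>x y. norm (D x - D y) \<le> L * norm (x - y)"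
begin

lemma L_nonneg: "L \<ge> 0"
  using norm_D[of 0] norm_ge_zero order_trans by blast

lemma continuous_D: "continuous_on UNIV D"
  by (rule continuous_on_norm_lipschitz[OF lipschitz_D L_nonneg])

lemma measurable_g [measurable]: "g \<in> borel_measurable borel"
  using deriv by (intro borel_measurable_continuous_onI) (meson continuous_at_imp_continuous_on has_derivative_continuous)

lemma measurable_D [measurable]: "D \<in> borel_measurable borel"
  by (intro borel_measurable_continuous_onI continuous_D)

lemma taylor: "\<bar>g (z + h) - g z - D z \<bullet> h\<bar> \<le> L * (norm h)\<^sup>2"
  by (rule taylor_lipschitz_gradient[OF deriv lipschitz_D L_nonneg])

lemma lipschitz_g: "\<bar>g (z + h) - g z\<bar> \<le> L * norm h"
  using abs_diff_le_of_gradient_le[of g D L "z + h" z] deriv norm_D by simp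

text \<open>Entropy of g^2 under the Gaussian centred at z with variance r^2 / (4 pi) in each
  coordinate. Shift and scale sit in the argument, so one measure serves all z and r.\<close>

definition local_entropy :: "real \<Rightarrow> real^'n \<Rightarrow> real" where
  "local_entropy r z = entropy_of gauss_measure (\<lambda>x. (g (z + r *\<^sub>R x))\<^sup>2)"

definition local_energy :: "real \<Rightarrow> real^'n \<Rightarrow> real" where
  "local_energy r z = (LINT x|gauss_measure. (norm (D (z + r *\<^sub>R x)))\<^sup>2)"

lemma g2_bounds: "0 < a\<^sup>2" "a\<^sup>2 \<le> (g x)\<^sup>2" "(g x)\<^sup>2 \<le> b\<^sup>2"
proof -
  show "0 < a\<^sup>2" using a_pos by simp
  show "a\<^sup>2 \<le> (g x)\<^sup>2" using a_pos a_le[of x] by (intro power_mono) auto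
  show "(g x)\<^sup>2 \<le> b\<^sup>2" using a_pos a_le[of x] le_b[of x] by (intro power_mono) auto
qed

lemma D2_bounds: "0 \<le> (norm (D x))\<^sup>2" "(norm (D x))\<^sup>2 \<le> L\<^sup>2"
  using norm_D by (auto intro!: power_mono)

text \<open>At scale r the function g is affine up to O(r^2), so the entropy is 2 r^2 times the
  second moment of \<open>D z \<bullet> x\<close> up to O(r^3), and that moment gives r^2 / (2 pi)
  |D z|^2.\<close>

lemma local_entropy_small:
  obtains C where "C \<ge> 0"
    "\<And>r z. 0 < r \<Longrightarrow> r \<le> 1 \<Longrightarrow> local_entropy r z \<le> r\<^sup>2 / (2 * pi) * local_energy r z + C * r ^ 3"
proof -
  \<comment> \<open>P dominates every power of |x| up to the fourth, so all remainders are collected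
    in one integrable function.\<close>
  define P where "P = (\<lambda>x :: real^'n. (1 + norm x) ^ 4)"
  define K where "K = (LINT x|gauss_measure. P x)"
  have iP: "integrable gauss_measure P" unfolding P_def by (rule integrable_gauss_poly)
  have K0: "K \<ge> 0" unfolding K_def P_def by simp
  define C1 where "C1 = 6 * L\<^sup>2 + L ^ 3 / a"
  have C1: "C1 \<ge> 0" using L_nonneg a_pos by (simp add: C1_def)
  have "local_entropy r z \<le> r\<^sup>2 / (2 * pi) * local_energy r z + (C1 * K + L\<^sup>2 / pi * K) * r ^ 3"
    if r: "0 < r" "r \<le> 1" for r z
  proof -
    define G where "G x = (g (z + r *\<^sub>R x))\<^sup>2" for x
    define q where "q = g z"
    have q: "q > 0" using a_pos a_le[of z] by (simp add: q_def)
    have Gm [measurable]: "G \<in> borel_measurable gauss_measure" unfolding G_def by measurable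
    have Gb: "a\<^sup>2 \<le> G x" "G x \<le> b\<^sup>2" for x unfolding G_def by (rule g2_bounds)+
    note iG = gauss.integral_in_interval[OF Gm Gb]
    note iGlnG = gauss.abs_entropy_of_le(1)[OF Gm g2_bounds(1) Gb]
    define m where "m = (LINT x|gauss_measure. G x)"
    have m: "m > 0" using iG(2) g2_bounds(1) unfolding m_def by linarith
    have pow: "norm x ^ k \<le> P x" if "k \<le> 4" for x :: "real^'n" and k
    proof -
      have "norm x ^ k \<le> (1 + norm x) ^ k" by (intro power_mono) auto
      also have "\<dots> \<le> P x" unfolding P_def using that by (intro power_increasing) auto
      finally show ?thesis .
    qed
    have pt: "G x * ln (G x) - G x * ln (q\<^sup>2) - G x + q\<^sup>2 \<le> 2 * r\<^sup>2 * (D z \<bullet> x)\<^sup>2 + C1 * r ^ 3 * P x" for x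
    proof -
      define t where "t = g (z + r *\<^sub>R x)"
      define d where "d = t - q"
      have t: "t > 0" using a_pos a_le[of "z + r *\<^sub>R x"] by (simp add: t_def)
      have nd: "\<bar>d\<bar> \<le> L * r * norm x" "\<bar>d - r * (D z \<bullet> x)\<bar> \<le> L * r\<^sup>2 * (norm x)\<^sup>2"
        using lipschitz_g[of z "r *\<^sub>R x"] taylor[of z "r *\<^sub>R x"] r
        by (simp_all add: d_def t_def q_def power_mult_distrib mult.assoc)
      \<comment> \<open>Dividing by q reduces the estimate to the one-variable expansion at t / q =
        1.\<close>
      have "G x * ln (G x) - G x * ln (q\<^sup>2) - G x + q\<^sup>2 = q\<^sup>2 * (2 * (t / q)\<^sup>2 * ln (t / q) - (t / q)\<^sup>2 + 1)"
        using t q by (simp add: G_def t_def[symmetric] ln_realpow ln_div power_divide right_diff_distrib distrib_left)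
      also have "\<dots> \<le> q\<^sup>2 * (2 * (t / q - 1)\<^sup>2 + \<bar>t / q - 1\<bar> ^ 3)"
        using t q by (intro mult_left_mono entropy_taylor_ineq) auto
      also have "t / q - 1 = d / q" using q by (simp add: d_def field_simps)
      also have "q\<^sup>2 * (2 * (d / q)\<^sup>2 + \<bar>d / q\<bar> ^ 3) = 2 * d\<^sup>2 + \<bar>d\<bar> ^ 3 / q"
        using q by (simp add: field_simps power2_eq_square power3_eq_cube)
      finally have 1: "G x * ln (G x) - G x * ln (q\<^sup>2) - G x + q\<^sup>2 \<le> 2 * d\<^sup>2 + \<bar>d\<bar> ^ 3 / q" .
      have "\<bar>d\<bar> ^ 3 \<le> (L * r * norm x) ^ 3" using nd by (intro power_mono) auto
      also have "\<dots> = L ^ 3 * r ^ 3 * norm x ^ 3" by (simp add: power_mult_distrib)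
      also have "\<dots> \<le> L ^ 3 * r ^ 3 * P x" using pow[of 3] L_nonneg r by (intro mult_left_mono) auto
      finally have "\<bar>d\<bar> ^ 3 / q \<le> L ^ 3 * r ^ 3 * P x / q" using q by (intro divide_right_mono) auto
      also have "\<dots> \<le> L ^ 3 * r ^ 3 * P x / a"
        using L_nonneg r a_pos a_le[of z] by (intro divide_left_mono) (auto simp: q_def P_def)
      finally have 2: "\<bar>d\<bar> ^ 3 / q \<le> L ^ 3 * r ^ 3 * P x / a" .
      define e where "e = d - r * (D z \<bullet> x)"
      define u where "u = r * (D z \<bullet> x)"
      have u: "\<bar>u\<bar> \<le> r * L * norm x"
      proof -
        have "\<bar>D z \<bullet> x\<bar> \<le> L * norm x"
          using Cauchy_Schwarz_ineq2[of "D z" x] mult_right_mono[OF norm_D[of z], of "norm x"] by simp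
        then show ?thesis using r by (simp add: u_def abs_mult mult.assoc)
      \<comment> \<open>The square of d = u + e splits into the linear part u of order r and the
        Taylor error e of order r^2; the mixed term is of order r^3, and r \<le> 1 absorbs
        e^2.\<close>
      qed
      have "\<bar>u * e\<bar> \<le> (r * L * norm x) * (L * r\<^sup>2 * (norm x)\<^sup>2)"
        unfolding abs_mult using u nd(2) L_nonneg r unfolding e_def by (intro mult_mono) auto
      also have "\<dots> = L\<^sup>2 * r ^ 3 * norm x ^ 3" by (simp add: power2_eq_square power3_eq_cube)
      also have "\<dots> \<le> L\<^sup>2 * r ^ 3 * P x" using pow[of 3] r by (intro mult_left_mono) auto
      finally have 3: "\<bar>u * e\<bar> \<le> L\<^sup>2 * r ^ 3 * P x" .
      have "e\<^sup>2 \<le> (L * r\<^sup>2 * (norm x)\<^sup>2)\<^sup>2"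
        using nd(2) power_mono[of "\<bar>e\<bar>" "L * r\<^sup>2 * (norm x)\<^sup>2" 2] by (simp add: e_def)
      also have "\<dots> = L\<^sup>2 * (r ^ 4 * norm x ^ 4)" by (simp add: power_mult_distrib flip: power_mult)
      also have "\<dots> \<le> L\<^sup>2 * (r ^ 3 * P x)" using pow[of 4] r
        by (intro mult_left_mono mult_mono power_decreasing) auto
      finally have 4: "e\<^sup>2 \<le> L\<^sup>2 * (r ^ 3 * P x)" .
      have "d = u + e" by (simp add: u_def e_def)
      then have "2 * d\<^sup>2 = 2 * u\<^sup>2 + 4 * (u * e) + 2 * e\<^sup>2" by (simp add: power2_eq_square algebra_simps)
      also have "\<dots> \<le> 2 * u\<^sup>2 + 6 * (L\<^sup>2 * r ^ 3 * P x)" using 3 4 by (simp add: mult.assoc)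
      finally have "2 * d\<^sup>2 \<le> 2 * r\<^sup>2 * (D z \<bullet> x)\<^sup>2 + 6 * L\<^sup>2 * r ^ 3 * P x" by (simp add: u_def power_mult_distrib mult.assoc)
      then show ?thesis using 1 2 by (simp add: C1_def algebra_simps)
    qed
    have "local_entropy r z = (LINT x|gauss_measure. G x * ln (G x)) - m * ln m"
      by (simp add: local_entropy_def entropy_of_def G_def[symmetric] m_def)
    \<comment> \<open>m ln m lies above its tangent at q^2, so the value at the centre replaces the
      mean as the reference constant.\<close>
    also have "\<dots> \<le> (LINT x|gauss_measure. G x * ln (G x)) - m * ln (q\<^sup>2) - m + q\<^sup>2"
      using gibbs_pointwise[of m "q\<^sup>2"] m q by simp
    also have "\<dots> = (LINT x|gauss_measure. G x * ln (G x) - G x * ln (q\<^sup>2) - G x + q\<^sup>2)"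
      using iG(1) iGlnG by (simp add: m_def)
    also have "\<dots> \<le> (LINT x|gauss_measure. 2 * r\<^sup>2 * (D z \<bullet> x)\<^sup>2 + C1 * r ^ 3 * P x)"
      using iG(1) iGlnG iP pt integrable_gauss_inner_square[of "D z"] by (intro integral_mono) auto
    also have "\<dots> = 2 * r\<^sup>2 * (LINT x|gauss_measure. (D z \<bullet> x)\<^sup>2) + C1 * r ^ 3 * K"
      using iP integrable_gauss_inner_square[of "D z"] by (simp add: K_def)
    also have "\<dots> \<le> 2 * r\<^sup>2 * ((norm (D z))\<^sup>2 / (4 * pi)) + C1 * r ^ 3 * K"
      by (intro add_right_mono mult_left_mono integral_gauss_inner_square) auto
    also have "\<dots> = r\<^sup>2 / (2 * pi) * (norm (D z))\<^sup>2 + C1 * r ^ 3 * K" by simp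
    \<comment> \<open>The target is the averaged energy, not its value at the centre. The Lipschitz
      gradient makes their difference O(r), which after multiplication by r^2 joins the cubic
      error.\<close>
    also have "(norm (D z))\<^sup>2 \<le> local_energy r z + 2 * L\<^sup>2 * r * K"
    proof -
      have iD: "integrable gauss_measure (\<lambda>x. (norm (D (z + r *\<^sub>R x)))\<^sup>2)"
        by (rule gauss.integral_in_interval(1)[of _ 0 "L\<^sup>2"]) (use D2_bounds in auto)
      have "(norm (D z))\<^sup>2 \<le> (norm (D (z + r *\<^sub>R x)))\<^sup>2 + 2 * L\<^sup>2 * r * P x" for x
      proof -
        have "norm (D z) - norm (D (z + r *\<^sub>R x)) \<le> L * (r * norm x)"
          using norm_triangle_ineq2[of "D z" "D (z + r *\<^sub>R x)"] lipschitz_D[of z "z + r *\<^sub>R x"] r by simp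
        then have "(norm (D z) + norm (D (z + r *\<^sub>R x))) * (norm (D z) - norm (D (z + r *\<^sub>R x)))
            \<le> (norm (D z) + norm (D (z + r *\<^sub>R x))) * (L * (r * norm x))"
          by (intro mult_left_mono) auto
        also have "\<dots> \<le> (2 * L) * (L * (r * norm x))"
          using norm_D[of z] norm_D[of "z + r *\<^sub>R x"] L_nonneg r by (intro mult_right_mono) auto
        also have "\<dots> = 2 * L\<^sup>2 * r * norm x" by (simp add: power2_eq_square)
        also have "\<dots> \<le> 2 * L\<^sup>2 * r * P x" using pow[of 1 x] r by (intro mult_left_mono) auto
        finally show ?thesis by (simp add: power2_eq_square algebra_simps)
      qed
      then have "(LINT x|(gauss_measure :: (real^'n) measure). (norm (D z))\<^sup>2) \<le> (LINT x|gauss_measure. (norm (D (z + r *\<^sub>R x)))\<^sup>2 + 2 * L\<^sup>2 * r * P x)"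
        using iD iP by (intro integral_mono) auto
      then show ?thesis using iD iP by (simp add: local_energy_def K_def)
    qed
    then have "r\<^sup>2 / (2 * pi) * (norm (D z))\<^sup>2 \<le> r\<^sup>2 / (2 * pi) * (local_energy r z + 2 * L\<^sup>2 * r * K)"
      by (intro mult_left_mono) auto
    finally show ?thesis by (simp add: algebra_simps power2_eq_square power3_eq_cube)
  qed
  moreover have "C1 * K + L\<^sup>2 / pi * K \<ge> 0" using C1 K0 by simp
  ultimately show ?thesis using that by blast
qed

text \<open>A Gaussian at scale sqrt 2 r is the sum of two independent ones at scale r.
  Subadditivity bounds the entropy by two averages of entropies at scale r. The averaged energies
  reassemble into the energy at the larger scale without loss, so the error c is merely
  doubled.\<close>

lemma local_entropy_double:
  assumes le: "\<And>z. local_entropy r z \<le> r\<^sup>2 / (2 * pi) * local_energy r z + c"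
  shows "local_entropy (sqrt 2 * r) z \<le> (sqrt 2 * r)\<^sup>2 / (2 * pi) * local_energy (sqrt 2 * r) z + 2 * c"
proof -
  let ?\<gamma> = "gauss_measure :: (real^'n) measure"
  interpret P: pair_prob_space ?\<gamma> ?\<gamma> ..
  define T where "T = (\<lambda>(y, w). (1 / sqrt 2) *\<^sub>R y + (1 / sqrt 2) *\<^sub>R w :: real^'n)"
  have [measurable]: "T \<in> borel_measurable (?\<gamma> \<Otimes>\<^sub>M ?\<gamma>)" unfolding T_def by measurable
  have distr: "distr (?\<gamma> \<Otimes>\<^sub>M ?\<gamma>) borel T = ?\<gamma>"
    unfolding T_def by (rule distr_gauss_rotation) (auto simp: power_divide)
  have T: "z + (sqrt 2 * r) *\<^sub>R T (y, w) = (z + r *\<^sub>R y) + r *\<^sub>R w" "z + (sqrt 2 * r) *\<^sub>R T (y, w) = (z + r *\<^sub>R w) + r *\<^sub>R y" for y w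
    by (simp_all add: T_def algebra_simps)
  define F where "F p = (g (z + (sqrt 2 * r) *\<^sub>R T p))\<^sup>2" for p
  have Fm: "F \<in> borel_measurable (?\<gamma> \<Otimes>\<^sub>M ?\<gamma>)" unfolding F_def by measurable
  have "local_entropy (sqrt 2 * r) z = entropy_of (?\<gamma> \<Otimes>\<^sub>M ?\<gamma>) F"
    unfolding local_entropy_def entropy_of_def F_def
    by (subst (1 2 3) distr[symmetric], subst (1 2 3) integral_distr) auto
  also have "\<dots> \<le> (LINT y|?\<gamma>. entropy_of ?\<gamma> (\<lambda>w. F (y, w))) + (LINT w|?\<gamma>. entropy_of ?\<gamma> (\<lambda>y. F (y, w)))"
    using Fm g2_bounds by (intro entropy_of_pair_le[of _ _ _ "a\<^sup>2" "b\<^sup>2"] gauss.prob_space_axioms) (auto simp: F_def)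
  also have "\<dots> = 2 * (LINT y|?\<gamma>. local_entropy r (z + r *\<^sub>R y))"
    unfolding F_def T(1) by (simp add: T(2)[symmetric] T(1) local_entropy_def add_ac)
  also have "(LINT y|?\<gamma>. local_entropy r (z + r *\<^sub>R y)) \<le> (LINT y|?\<gamma>. r\<^sup>2 / (2 * pi) * local_energy r (z + r *\<^sub>R y) + c)"
  proof (rule integral_mono)
    define B where "B = 2 * (b\<^sup>2 * (\<bar>ln (a\<^sup>2)\<bar> + \<bar>ln (b\<^sup>2)\<bar>))"
    have "\<bar>local_entropy r (z + r *\<^sub>R y)\<bar> \<le> B" for y
      unfolding local_entropy_def B_def using g2_bounds by (intro gauss.abs_entropy_of_le) auto
    moreover have "(\<lambda>y. local_entropy r (z + r *\<^sub>R y)) \<in> borel_measurable ?\<gamma>"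
      unfolding local_entropy_def entropy_of_def by measurable
    ultimately show "integrable ?\<gamma> (\<lambda>y. local_entropy r (z + r *\<^sub>R y))"
      by (intro gauss.integrable_const_bound[of _ B] AE_I2) auto
    have "local_energy r y \<le> L\<^sup>2" "0 \<le> local_energy r y" for y
      unfolding local_energy_def using D2_bounds
        gauss.integral_in_interval[of "\<lambda>x. (norm (D (y + r *\<^sub>R x)))\<^sup>2" 0 "L\<^sup>2"] by simp_all
    moreover have "(\<lambda>y. local_energy r (z + r *\<^sub>R y)) \<in> borel_measurable ?\<gamma>"
      unfolding local_energy_def by measurable
    ultimately have "integrable ?\<gamma> (\<lambda>y. local_energy r (z + r *\<^sub>R y))"
      by (intro gauss.integrable_const_bound[of _ "L\<^sup>2"] AE_I2) auto
    then show "integrable ?\<gamma> (\<lambda>y. r\<^sup>2 / (2 * pi) * local_energy r (z + r *\<^sub>R y) + c)" by auto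
  qed (rule le)
  also have "(LINT y|?\<gamma>. r\<^sup>2 / (2 * pi) * local_energy r (z + r *\<^sub>R y) + c) = r\<^sup>2 / (2 * pi) * local_energy (sqrt 2 * r) z + c"
  proof -
    have i: "integrable (?\<gamma> \<Otimes>\<^sub>M ?\<gamma>) (\<lambda>p. (norm (D (z + (sqrt 2 * r) *\<^sub>R T p)))\<^sup>2)"
      by (rule P.integral_in_interval(1)[of _ 0 "L\<^sup>2"]) (use D2_bounds in auto)
    have "local_energy (sqrt 2 * r) z = (LINT p|(?\<gamma> \<Otimes>\<^sub>M ?\<gamma>). (norm (D (z + (sqrt 2 * r) *\<^sub>R T p)))\<^sup>2)"
      unfolding local_energy_def by (subst distr[symmetric], subst integral_distr) auto
    also have "\<dots> = (LINT y|?\<gamma>. local_energy r (z + r *\<^sub>R y))"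
      unfolding P.integral_fst'[OF i, symmetric] by (simp add: local_energy_def T)
    finally have "local_energy (sqrt 2 * r) z = (LINT y|?\<gamma>. local_energy r (z + r *\<^sub>R y))" .
    moreover have "integrable ?\<gamma> (\<lambda>y. local_energy r (z + r *\<^sub>R y))"
      using P.integrable_fst'[OF i] by (simp add: local_energy_def T)
    ultimately show ?thesis by simp
  qed
  finally show ?thesis by (simp add: power_mult_distrib algebra_simps)
qed

lemma local_entropy_iterate:
  assumes "\<And>z. local_entropy r z \<le> r\<^sup>2 / (2 * pi) * local_energy r z + c"
  shows "local_entropy (sqrt 2 ^ k * r) z \<le> (sqrt 2 ^ k * r)\<^sup>2 / (2 * pi) * local_energy (sqrt 2 ^ k * r) z + 2 ^ k * c"
proof (induction k arbitrary: z)
  case (Suc k)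
  from local_entropy_double[OF Suc.IH] show ?case by (simp add: mult.assoc)
qed (use assms in simp)

text \<open>Halving the variance \<open>r\<^sup>2\<close> divides the error bound \<open>C r\<^sup>3\<close> by \<open>2 sqrt 2\<close>, while recombining the two halves
  only doubles it.\<close>

lemma local_log_sobolev:
  assumes "r > 0"
  shows "local_entropy r z \<le> r\<^sup>2 / (2 * pi) * local_energy r z"
proof -
  obtain C where C: "C \<ge> 0"
    "\<And>r z. 0 < r \<Longrightarrow> r \<le> 1 \<Longrightarrow> local_entropy r z \<le> r\<^sup>2 / (2 * pi) * local_energy r z + C * r ^ 3"
    using local_entropy_small by blast
  have lim: "(\<lambda>k. c * (1 / sqrt 2) ^ k) \<longlonglongrightarrow> 0" for c :: real
    by (intro tendsto_mult_right_zero LIMSEQ_power_zero) simp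
  have "\<forall>\<^sub>F k in sequentially. local_entropy r z \<le> r\<^sup>2 / (2 * pi) * local_energy r z + C * r ^ 3 * (1 / sqrt 2) ^ k"
    using order_tendstoD(2)[OF lim[of r] zero_less_one]
  proof eventually_elim
    case (elim k)
    define s where "s = r * (1 / sqrt 2) ^ k"
    have s: "0 < s" "s \<le> 1" "sqrt 2 ^ k * s = r" using elim assms by (auto simp: s_def power_divide)
    have "2 ^ k * (C * s ^ 3) = C * r ^ 3 * (2 / sqrt 2 ^ 3) ^ k"
      by (simp add: s_def power_mult_distrib power_divide flip: power_mult) (simp add: mult.commute)
    also have "2 / sqrt 2 ^ 3 = 1 / sqrt 2"
      by (simp add: power3_eq_cube)
    finally show ?case using local_entropy_iterate[OF C(2)[OF s(1,2)], of k z] by (simp only: s(3))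
  qed
  moreover have "(\<lambda>k. r\<^sup>2 / (2 * pi) * local_energy r z + C * r ^ 3 * (1 / sqrt 2) ^ k) \<longlonglongrightarrow> r\<^sup>2 / (2 * pi) * local_energy r z + 0"
    by (intro tendsto_add tendsto_const lim)
  ultimately show ?thesis
    using tendsto_lowerbound[of _ "r\<^sup>2 / (2 * pi) * local_energy r z + 0" sequentially "local_entropy r z"] by simp
qed

end


subsection \<open>The noise operator\<close>

text \<open>For \<rho>^2 + \<sigma>^2 = 1 and \<rho> > 0 this is the Ornstein-Uhlenbeck operator in
  Mehler's form, \<rho> being exp (- t). Keeping both parameters avoids square roots.\<close>

definition noise :: "real \<Rightarrow> real \<Rightarrow> (real^'n \<Rightarrow> real) \<Rightarrow> real^'n \<Rightarrow> real" where
  "noise \<rho> \<sigma> h y = (LINT z|gauss_measure. h (\<rho> *\<^sub>R y + \<sigma> *\<^sub>R z))"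

lemma borel_measurable_noise [measurable]:
  fixes h :: "real^'n \<Rightarrow> real"
  assumes [measurable]: "h \<in> borel_measurable borel"
  shows "noise \<rho> \<sigma> h \<in> borel_measurable borel"
proof -
  have "(\<lambda>y. LINT z|gauss_measure. h (\<rho> *\<^sub>R y + \<sigma> *\<^sub>R z)) \<in> borel_measurable (gauss_measure :: (real^'n) measure)"
    by measurable
  then show ?thesis unfolding noise_def[abs_def] by simp
qed

lemma nn_integral_gauss_rotation:
  fixes \<phi> :: "real^'n \<Rightarrow> ennreal"
  assumes "\<sigma> > 0" "\<rho>\<^sup>2 + \<sigma>\<^sup>2 = 1" and [measurable]: "\<phi> \<in> borel_measurable borel"
  shows "(\<integral>\<^sup>+y. \<integral>\<^sup>+z. \<phi> (\<rho> *\<^sub>R y + \<sigma> *\<^sub>R z) \<partial>gauss_measure \<partial>gauss_measure) = (\<integral>\<^sup>+x. \<phi> x \<partial>gauss_measure)"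
proof -
  have "(\<integral>\<^sup>+x. \<phi> x \<partial>gauss_measure) = (\<integral>\<^sup>+p. \<phi> (case p of (y, z) \<Rightarrow> \<rho> *\<^sub>R y + \<sigma> *\<^sub>R z) \<partial>(gauss_measure \<Otimes>\<^sub>M gauss_measure))"
    by (subst distr_gauss_rotation[OF assms(1,2), symmetric], subst nn_integral_distr) auto
  also have "\<dots> = (\<integral>\<^sup>+y. \<integral>\<^sup>+z. \<phi> (\<rho> *\<^sub>R y + \<sigma> *\<^sub>R z) \<partial>gauss_measure \<partial>gauss_measure)"
    by (subst gauss.nn_integral_fst[symmetric]) auto
  finally show ?thesis by simp
qed

lemma integral_gauss_rotation:
  fixes \<phi> :: "real^'n \<Rightarrow> real"
  assumes "\<sigma> > 0" "\<rho>\<^sup>2 + \<sigma>\<^sup>2 = 1" and i: "integrable gauss_measure \<phi>"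
  shows "(LINT y|gauss_measure. LINT z|gauss_measure. \<phi> (\<rho> *\<^sub>R y + \<sigma> *\<^sub>R z)) = (LINT x|gauss_measure. \<phi> x)"
    "integrable gauss_measure (\<lambda>y. LINT z|gauss_measure. \<phi> (\<rho> *\<^sub>R y + \<sigma> *\<^sub>R z))"
proof -
  interpret P: pair_prob_space "gauss_measure :: (real^'n) measure" "gauss_measure :: (real^'n) measure" ..
  let ?T = "\<lambda>(y, z). \<rho> *\<^sub>R y + \<sigma> *\<^sub>R z"
  note distr = distr_gauss_rotation[OF assms(1,2)]
  have m[measurable]: "\<phi> \<in> borel_measurable borel" using borel_measurable_integrable[OF i] by simp
  have i': "integrable (gauss_measure \<Otimes>\<^sub>M gauss_measure) (\<lambda>p. \<phi> (?T p))"
    using i by (subst (asm) distr[symmetric], subst (asm) integrable_distr_eq) auto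
  show "(LINT y|gauss_measure. LINT z|gauss_measure. \<phi> (\<rho> *\<^sub>R y + \<sigma> *\<^sub>R z)) = (LINT x|gauss_measure. \<phi> x)"
    using P.integral_fst'[OF i'] by (subst (3) distr[symmetric], subst integral_distr) auto
  show "integrable gauss_measure (\<lambda>y. LINT z|gauss_measure. \<phi> (\<rho> *\<^sub>R y + \<sigma> *\<^sub>R z))"
    using P.integrable_fst'[OF i'] by simp
qed

text \<open>Cauchy-Schwarz in z against the constant 1, then rotation invariance.\<close>

lemma noise_contraction:
  fixes h :: "real^'n \<Rightarrow> real"
  assumes "\<sigma> > 0" "\<rho>\<^sup>2 + \<sigma>\<^sup>2 = 1" and [measurable]: "h \<in> borel_measurable borel"
  shows "(\<integral>\<^sup>+y. ennreal ((noise \<rho> \<sigma> h y)\<^sup>2) \<partial>gauss_measure) \<le> (\<integral>\<^sup>+x. ennreal ((h x)\<^sup>2) \<partial>gauss_measure)"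
proof -
  have "ennreal ((noise \<rho> \<sigma> h y)\<^sup>2) \<le> (\<integral>\<^sup>+z. ennreal ((h (\<rho> *\<^sub>R y + \<sigma> *\<^sub>R z))\<^sup>2) \<partial>gauss_measure)" for y
  proof -
    \<comment> \<open>Where the inner function is not integrable, \<open>noise\<close> takes the
      default value 0 and the bound is trivial.\<close>
    have "ennreal \<bar>noise \<rho> \<sigma> h y\<bar> \<le> (\<integral>\<^sup>+z. ennreal \<bar>h (\<rho> *\<^sub>R y + \<sigma> *\<^sub>R z)\<bar> \<partial>gauss_measure)"
      unfolding noise_def using integral_norm_bound_ennreal[of gauss_measure "\<lambda>z. h (\<rho> *\<^sub>R y + \<sigma> *\<^sub>R z)"]
      by (cases "integrable gauss_measure (\<lambda>z. h (\<rho> *\<^sub>R y + \<sigma> *\<^sub>R z))") (auto simp: not_integrable_integral_eq)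
    then have "(ennreal \<bar>noise \<rho> \<sigma> h y\<bar>)\<^sup>2 \<le> (\<integral>\<^sup>+z. ennreal \<bar>h (\<rho> *\<^sub>R y + \<sigma> *\<^sub>R z)\<bar> * 1 \<partial>gauss_measure)\<^sup>2"
      by (intro power_mono) auto
    also have "\<dots> \<le> (\<integral>\<^sup>+z. (ennreal \<bar>h (\<rho> *\<^sub>R y + \<sigma> *\<^sub>R z)\<bar>)\<^sup>2 \<partial>gauss_measure) * (\<integral>\<^sup>+z. 1\<^sup>2 \<partial>(gauss_measure :: (real^'n) measure))"
      by (rule Cauchy_Schwarz_nn_integral) auto
    finally show ?thesis by (simp add: ennreal_power)
  qed
  then have "(\<integral>\<^sup>+y. ennreal ((noise \<rho> \<sigma> h y)\<^sup>2) \<partial>gauss_measure)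
      \<le> (\<integral>\<^sup>+y. \<integral>\<^sup>+z. ennreal ((h (\<rho> *\<^sub>R y + \<sigma> *\<^sub>R z))\<^sup>2) \<partial>gauss_measure \<partial>gauss_measure)"
    by (intro nn_integral_mono)
  also have "\<dots> = (\<integral>\<^sup>+x. ennreal ((h x)\<^sup>2) \<partial>gauss_measure)"
    using assms by (intro nn_integral_gauss_rotation) auto
  finally show ?thesis .
qed

text \<open>Averaging \<open>local_log_sobolev\<close> at scale \<sigma> over the centres \<rho> y:
  by rotation invariance the left sides add up to the integral of h ln h minus that of Q ln Q, the
  right sides to the full energy. The term with the mean of g^2 minus 1 is there because g is not
  normalized; it stems from t ln t \<le> (t - 1)^2 + (t - 1).\<close>

lemma (in log_sobolev_class) entropy_le_noise:
  assumes "\<sigma> > 0" "\<rho>\<^sup>2 + \<sigma>\<^sup>2 = 1"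
  shows "(LINT x|gauss_measure. (g x)\<^sup>2 * ln ((g x)\<^sup>2))
    \<le> (LINT y|gauss_measure. (noise \<rho> \<sigma> (\<lambda>x. (g x)\<^sup>2) y - 1)\<^sup>2) + ((LINT x|gauss_measure. (g x)\<^sup>2) - 1)
      + \<sigma>\<^sup>2 / (2 * pi) * (LINT x|gauss_measure. (norm (D x))\<^sup>2)"
proof -
  let ?\<gamma> = "gauss_measure :: (real^'n) measure"
  define h where "h x = (g x)\<^sup>2" for x
  define Q where "Q = noise \<rho> \<sigma> h"
  have [measurable]: "h \<in> borel_measurable borel" unfolding h_def by measurable
  then have [measurable]: "Q \<in> borel_measurable borel" unfolding Q_def by measurable
  have hb: "a\<^sup>2 \<le> h x" "h x \<le> b\<^sup>2" for x unfolding h_def by (rule g2_bounds)+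
  have Qb: "a\<^sup>2 \<le> Q y" "Q y \<le> b\<^sup>2" for y
    unfolding Q_def noise_def by (rule gauss.integral_in_interval; use hb in auto)+
  note ih = gauss.abs_entropy_of_le(1)[of h, OF _ g2_bounds(1) hb, simplified]
  note iQ = gauss.abs_entropy_of_le(1)[of Q, OF _ g2_bounds(1) Qb, simplified]
  have ih1: "integrable ?\<gamma> h" and iQ1: "integrable ?\<gamma> Q"
    by (rule gauss.integral_in_interval[OF _ hb] gauss.integral_in_interval[OF _ Qb]; simp)+
  have iD: "integrable ?\<gamma> (\<lambda>x. (norm (D x))\<^sup>2)"
    by (rule gauss.integral_in_interval(1)[of _ 0 "L\<^sup>2"]) (use D2_bounds in auto)
  have "\<bar>Q y - 1\<bar> \<le> b\<^sup>2 + 1" for y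
    using Qb[of y] g2_bounds(1) by linarith
  then have iQ2: "integrable ?\<gamma> (\<lambda>y. (Q y - 1)\<^sup>2)"
    by (intro gauss.integrable_const_bound[of _ "(b\<^sup>2 + 1)\<^sup>2"] AE_I2)
       (auto simp: abs_le_square_iff[symmetric] intro!: power_mono[of "\<bar>_\<bar>", simplified])
  have le: "local_entropy \<sigma> (\<rho> *\<^sub>R y) \<le> \<sigma>\<^sup>2 / (2 * pi) * local_energy \<sigma> (\<rho> *\<^sub>R y)" for y
    using assms by (intro local_log_sobolev)
  have ent: "local_entropy \<sigma> (\<rho> *\<^sub>R y) = (LINT z|?\<gamma>. h (\<rho> *\<^sub>R y + \<sigma> *\<^sub>R z) * ln (h (\<rho> *\<^sub>R y + \<sigma> *\<^sub>R z))) - Q y * ln (Q y)" for y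
    by (simp add: local_entropy_def entropy_of_def Q_def noise_def h_def)
  note R1 = integral_gauss_rotation[OF assms ih]
  note R2 = integral_gauss_rotation[OF assms iD]
  note R3 = integral_gauss_rotation[OF assms ih1]
  have "(LINT x|?\<gamma>. h x * ln (h x)) - (LINT y|?\<gamma>. Q y * ln (Q y)) = (LINT y|?\<gamma>. local_entropy \<sigma> (\<rho> *\<^sub>R y))"
    unfolding ent using R1 iQ by simp
  also have "\<dots> \<le> (LINT y|?\<gamma>. \<sigma>\<^sup>2 / (2 * pi) * local_energy \<sigma> (\<rho> *\<^sub>R y))"
  proof (rule integral_mono)
    show "integrable ?\<gamma> (\<lambda>y. local_entropy \<sigma> (\<rho> *\<^sub>R y))" unfolding ent using R1 iQ by auto
    show "integrable ?\<gamma> (\<lambda>y. \<sigma>\<^sup>2 / (2 * pi) * local_energy \<sigma> (\<rho> *\<^sub>R y))"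
      unfolding local_energy_def using R2 by auto
  qed (rule le)
  also have "\<dots> = \<sigma>\<^sup>2 / (2 * pi) * (LINT x|?\<gamma>. (norm (D x))\<^sup>2)"
    using R2 by (simp add: local_energy_def)
  finally have 1: "(LINT x|?\<gamma>. h x * ln (h x)) \<le> (LINT y|?\<gamma>. Q y * ln (Q y)) + \<sigma>\<^sup>2 / (2 * pi) * (LINT x|?\<gamma>. (norm (D x))\<^sup>2)"
    by simp
  have "Q y * ln (Q y) \<le> (Q y - 1)\<^sup>2 + (Q y - 1)" for y
  proof -
    have "Q y > 0" using Qb[of y] g2_bounds(1) by linarith
    then have "Q y * ln (Q y) \<le> Q y * (Q y - 1)" by (intro mult_left_mono ln_le_minus_one) auto
    then show ?thesis by (simp add: power2_eq_square algebra_simps)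
  qed
  then have "(LINT y|?\<gamma>. Q y * ln (Q y)) \<le> (LINT y|?\<gamma>. (Q y - 1)\<^sup>2 + (Q y - 1))"
    using iQ iQ2 iQ1 by (intro integral_mono) auto
  also have "\<dots> = (LINT y|?\<gamma>. (Q y - 1)\<^sup>2) + ((LINT x|?\<gamma>. h x) - 1)"
    using iQ2 iQ1 R3 by (simp add: Q_def noise_def)
  finally have "(LINT x|?\<gamma>. h x * ln (h x)) \<le> (LINT y|?\<gamma>. (Q y - 1)\<^sup>2) + ((LINT x|?\<gamma>. h x) - 1)
     + \<sigma>\<^sup>2 / (2 * pi) * (LINT x|?\<gamma>. (norm (D x))\<^sup>2)"
    using 1 by linarith
  then show ?thesis by (simp only: Q_def h_def[abs_def])
qed

section \<open>Expansion of the noise kernel and the effect of centering\<close>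

text \<open>The kernel is exp u with u = 4 pi \<rho> (x . y) + O(\<rho>^2 (1 + |x|^2 + |y|^2)), and
  exp u is expanded to first order. N dominates the quadratic coefficients and the dimension, which
  enters through the factor 1 / \<sigma>^n. The rate 3 / 2 matters: the bound gets squared, and exp
  (3 |x|^2) is Gaussian integrable because 3 < 2 pi.\<close>

lemma gauss_kernel_taylor:
  fixes x y :: "real^'n"
  defines "N \<equiv> 8 * pi + real CARD('n)"
  assumes \<rho>: "0 < \<rho>" "\<rho> \<le> 1 / (4 * N)" and \<sigma>: "\<sigma> > 0" "\<rho>\<^sup>2 + \<sigma>\<^sup>2 = 1"
  shows "\<bar>gauss_kernel \<sigma> (\<rho> *\<^sub>R y) x - 1 - 4 * pi * \<rho> * (x \<bullet> y)\<bar>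
    \<le> \<rho>\<^sup>2 * (16 * N\<^sup>2 * exp (3 / 2)) * exp (3 / 2 * (norm x)\<^sup>2) * exp (3 / 2 * (norm y)\<^sup>2)"
proof -
  define s where "s = (norm x)\<^sup>2 + (norm y)\<^sup>2"
  have s0: "s \<ge> 0" by (simp add: s_def)
  have N1: "N \<ge> 1" "8 * pi \<le> N" "real CARD('n) \<le> N" using pi_gt3 by (simp_all add: N_def)
  have "\<rho> \<le> 1 / 4 * (1 / N)" using \<rho> by simp
  also have "\<dots> \<le> 1 / 4 * 1" using N1 by (intro mult_left_mono) auto
  finally have r4: "\<rho> \<le> 1 / 4" by simp
  have \<sigma>2_eq: "\<sigma>\<^sup>2 = 1 - \<rho>\<^sup>2" using \<sigma> by simp
  have "\<rho>\<^sup>2 \<le> (1 / 4)\<^sup>2" using r4 \<rho> by (intro power_mono) auto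
  then have r2: "\<rho>\<^sup>2 \<le> 1 / 16" by (simp add: power2_eq_square)
  have \<sigma>2: "\<sigma>\<^sup>2 \<ge> 1 / 2" using \<sigma> r2 by linarith
  define c where "c = 1 / \<sigma>\<^sup>2"
  have c: "1 \<le> c" "c \<le> 2" "c - 1 \<le> 2 * \<rho>\<^sup>2"
  proof -
    show "c \<le> 2" using \<sigma>2 \<sigma> by (simp add: c_def field_simps)
    have "c - 1 = \<rho>\<^sup>2 * c" using \<sigma> by (simp add: c_def field_simps)
    then show "1 \<le> c" "c - 1 \<le> 2 * \<rho>\<^sup>2" using \<open>c \<le> 2\<close> mult_left_mono[of c 2 "\<rho>\<^sup>2"]
      by (simp_all add: c_def) (smt (verit) zero_le_power2 divide_nonneg_nonneg mult_nonneg_nonneg)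
  qed
  define l where "l = - ln \<sigma>"
  have l: "0 \<le> l" "l \<le> \<rho>\<^sup>2"
  proof -
    have "2 * l = ln c" using \<sigma> by (simp add: l_def c_def ln_div ln_realpow)
    moreover have "ln c \<le> c - 1" using c by (intro ln_le_minus_one) auto
    moreover have "0 \<le> ln c" using c by simp
    ultimately show "0 \<le> l" "l \<le> \<rho>\<^sup>2" using c by linarith+
  qed
  have xy: "\<bar>x \<bullet> y\<bar> \<le> s / 2"
    using Cauchy_Schwarz_ineq2[of x y] sum_squares_bound[of "norm x" "norm y"] by (simp add: s_def)
  define u where "u = c * (4 * pi * \<rho> * (x \<bullet> y)) - c * (2 * pi * \<rho>\<^sup>2 * s) + real CARD('n) * l"
  have k: "gauss_kernel \<sigma> (\<rho> *\<^sub>R y) x = exp u"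
  proof -
    have n: "(norm (x - \<rho> *\<^sub>R y))\<^sup>2 = (norm x)\<^sup>2 - 2 * \<rho> * (x \<bullet> y) + \<rho>\<^sup>2 * (norm y)\<^sup>2"
      by (simp add: power2_norm_eq_inner inner_diff inner_commute) (simp add: power2_eq_square)
    have "2 * pi * (norm x)\<^sup>2 - 2 * pi * (norm (x - \<rho> *\<^sub>R y))\<^sup>2 / \<sigma>\<^sup>2
        = (2 * pi / \<sigma>\<^sup>2) * (\<sigma>\<^sup>2 * (norm x)\<^sup>2 - (norm (x - \<rho> *\<^sub>R y))\<^sup>2)"
      using \<sigma> by (simp add: field_simps)
    also have "\<sigma>\<^sup>2 * (norm x)\<^sup>2 = (norm x)\<^sup>2 - \<rho>\<^sup>2 * (norm x)\<^sup>2"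
      by (simp add: \<sigma>2_eq algebra_simps)
    finally have "2 * pi * (norm x)\<^sup>2 - 2 * pi * (norm (x - \<rho> *\<^sub>R y))\<^sup>2 / \<sigma>\<^sup>2 = u - real CARD('n) * l"
      unfolding n by (simp add: u_def c_def s_def algebra_simps)
    moreover have "1 / \<sigma> ^ CARD('n) = exp (real CARD('n) * l)"
      using \<sigma> by (simp add: l_def exp_minus exp_of_nat_mult divide_inverse flip: power_inverse)
    ultimately show ?thesis
      unfolding gauss_kernel_def by (simp add: divide_inverse exp_diff) 
  qed
  define t where "t = 4 * pi * \<rho> * (x \<bullet> y)"
  have ut: "\<bar>u - t\<bar> \<le> \<rho>\<^sup>2 * N * (1 + s)"
  proof -
    have "\<bar>u - t\<bar> = \<bar>(c - 1) * t - c * (2 * pi * \<rho>\<^sup>2 * s) + real CARD('n) * l\<bar>"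
      by (simp add: u_def t_def algebra_simps)
    also have "\<dots> \<le> \<bar>(c - 1) * t\<bar> + \<bar>c * (2 * pi * \<rho>\<^sup>2 * s)\<bar> + \<bar>real CARD('n) * l\<bar>" by linarith
    also have "\<bar>(c - 1) * t\<bar> \<le> (2 * \<rho>\<^sup>2) * (4 * pi * (1 / 4) * (s / 2))"
      unfolding abs_mult t_def using c \<rho> xy r4 by (intro mult_mono) auto
    also have "\<bar>c * (2 * pi * \<rho>\<^sup>2 * s)\<bar> \<le> 2 * (2 * pi * \<rho>\<^sup>2 * s)"
      using c s0 by (simp add: abs_mult mult_right_mono)
    also have "\<bar>real CARD('n) * l\<bar> \<le> real CARD('n) * \<rho>\<^sup>2" using l by (simp add: abs_mult)
    finally have "\<bar>u - t\<bar> \<le> \<rho>\<^sup>2 * (5 * pi * s + real CARD('n))" by (simp add: algebra_simps)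
    also have "5 * pi * s + real CARD('n) \<le> N * s + N * 1"
      using N1 s0 pi_gt_zero by (intro add_mono mult_right_mono) linarith+
    then have "\<rho>\<^sup>2 * (5 * pi * s + real CARD('n)) \<le> \<rho>\<^sup>2 * (N * s + N * 1)" by (intro mult_left_mono) auto
    finally show ?thesis by (simp add: algebra_simps)
  qed
  have uu: "\<bar>u\<bar> \<le> 2 * N * \<rho> * (1 + s)"
  proof -
    have "\<bar>t\<bar> \<le> 4 * pi * \<rho> * (s / 2)" unfolding t_def abs_mult using \<rho> xy by (intro mult_mono) auto
    also have "\<dots> = (2 * pi) * (\<rho> * s)" by simp
    also have "\<dots> \<le> N * (\<rho> * (1 + s))" using N1 \<rho> s0 pi_gt_zero by (intro mult_mono) auto
    finally have "\<bar>t\<bar> \<le> N * \<rho> * (1 + s)" by simp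
    moreover have "\<rho>\<^sup>2 * N * (1 + s) \<le> \<rho> * N * (1 + s)"
      using \<rho> r4 N1 s0 by (intro mult_right_mono) (auto simp: power2_eq_square mult_left_le)
    ultimately show ?thesis using ut by (simp add: algebra_simps)
  qed
  have "\<bar>exp u - 1 - u\<bar> \<le> exp \<bar>u\<bar> * \<bar>u\<bar>\<^sup>2"
    using Taylor_exp_field[of u 1] by (simp add: power2_eq_square algebra_simps)
  also have "\<dots> \<le> exp (1 / 2 * (1 + s)) * (2 * N * \<rho> * (1 + s))\<^sup>2"
  proof (intro mult_mono power_mono)
    \<comment> \<open>This is what \<rho> \<le> 1 / (4 N) is for: it caps |u| at (1 + s) / 2 and so
      spends only rate 1 / 2 of the Gaussian decay.\<close>
    have "2 * N * \<rho> \<le> 1 / 2" using \<rho> N1 by (simp add: field_simps)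
    then have "2 * N * \<rho> * (1 + s) \<le> 1 / 2 * (1 + s)" using s0 by (intro mult_right_mono) auto
    then show "exp \<bar>u\<bar> \<le> exp (1 / 2 * (1 + s))" using uu by simp
  qed (use uu in auto)
  also have "\<dots> = \<rho>\<^sup>2 * (4 * N\<^sup>2) * (exp (1 / 2 * (1 + s)) * (1 + s)\<^sup>2)"
    by (simp add: power_mult_distrib)
  finally have 1: "\<bar>exp u - 1 - u\<bar> \<le> \<rho>\<^sup>2 * (4 * N\<^sup>2) * (exp (1 / 2 * (1 + s)) * (1 + s)\<^sup>2)" .
  have "\<rho>\<^sup>2 * N * (1 + s) \<le> \<rho>\<^sup>2 * (4 * N\<^sup>2) * (exp (1 / 2 * (1 + s)) * (1 + s)\<^sup>2)"
  proof -
    have "N * 1 \<le> N * (4 * N)" using N1 by (intro mult_left_mono) auto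
    then have "N \<le> 4 * N\<^sup>2" by (simp add: power2_eq_square)
    moreover have "1 * (1 + s) \<le> exp (1 / 2 * (1 + s)) * (1 + s)\<^sup>2"
    proof (intro mult_mono)
      show "1 + s \<le> (1 + s)\<^sup>2" using s0 self_le_power[of "1 + s" 2] by simp
    qed (use s0 in auto)
    ultimately have "N * (1 * (1 + s)) \<le> 4 * N\<^sup>2 * (exp (1 / 2 * (1 + s)) * (1 + s)\<^sup>2)"
      using N1 s0 by (intro mult_mono[of N "4 * N\<^sup>2"]) auto
    then have "\<rho>\<^sup>2 * (N * (1 * (1 + s))) \<le> \<rho>\<^sup>2 * (4 * N\<^sup>2 * (exp (1 / 2 * (1 + s)) * (1 + s)\<^sup>2))"
      by (rule mult_left_mono) auto
    then show ?thesis by (simp only: mult.assoc mult_1)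
  qed
  with 1 ut k have 2: "\<bar>gauss_kernel \<sigma> (\<rho> *\<^sub>R y) x - 1 - t\<bar> \<le> \<rho>\<^sup>2 * (8 * N\<^sup>2) * (exp (1 / 2 * (1 + s)) * (1 + s)\<^sup>2)"
    by linarith
  \<comment> \<open>Absorbing the polynomial factor costs a further rate 1, hence 3 / 2 in
    total.\<close>
  have "(1 + s)\<^sup>2 \<le> 2 * exp (1 + s)"
    using exp_lower_Taylor_quadratic[of "1 + s"] s0 by simp
  then have "exp (1 / 2 * (1 + s)) * (1 + s)\<^sup>2 \<le> exp (1 / 2 * (1 + s)) * (2 * exp (1 + s))"
    by (intro mult_left_mono) auto
  also have "\<dots> = 2 * exp (1 / 2 * (1 + s) + (1 + s))" by (simp only: exp_add)
  also have "1 / 2 * (1 + s) + (1 + s) = 3 / 2 + (3 / 2 * (norm x)\<^sup>2 + 3 / 2 * (norm y)\<^sup>2)" by (simp add: s_def field_simps)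
  finally have "exp (1 / 2 * (1 + s)) * (1 + s)\<^sup>2 \<le> 2 * exp (3 / 2 + (3 / 2 * (norm x)\<^sup>2 + 3 / 2 * (norm y)\<^sup>2))" .
  then have "\<rho>\<^sup>2 * (8 * N\<^sup>2) * (exp (1 / 2 * (1 + s)) * (1 + s)\<^sup>2) \<le> \<rho>\<^sup>2 * (8 * N\<^sup>2) * (2 * exp (3 / 2 + (3 / 2 * (norm x)\<^sup>2 + 3 / 2 * (norm y)\<^sup>2)))"
    by (intro mult_left_mono) auto
  with 2 show ?thesis by (simp add: t_def exp_add mult_ac)
qed

text \<open>The centering of \<open>h\<close> allows the affine part \<open>4 \<pi> \<rho> (x \<bullet> y)\<close> of the kernel to be subtracted.\<close>

lemma noise_centered_bound:
  obtains C \<rho>\<^sub>0 :: real where "C \<ge> 0" "0 < \<rho>\<^sub>0" "\<rho>\<^sub>0 < 1"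
    "\<And>(h :: real^'n \<Rightarrow> real) \<rho> \<sigma>. integrable gauss_measure h \<Longrightarrow> integrable gauss_measure (\<lambda>x. (h x)\<^sup>2) \<Longrightarrow>
       (LINT x|gauss_measure. h x) = 1 \<Longrightarrow> integrable gauss_measure (\<lambda>x. h x *\<^sub>R x) \<Longrightarrow>
       (LINT x|gauss_measure. h x *\<^sub>R x) = 0 \<Longrightarrow> 0 < \<rho> \<Longrightarrow> \<rho> \<le> \<rho>\<^sub>0 \<Longrightarrow> \<sigma> > 0 \<Longrightarrow> \<rho>\<^sup>2 + \<sigma>\<^sup>2 = 1 \<Longrightarrow>
       (\<integral>\<^sup>+y. ennreal ((noise \<rho> \<sigma> h y - 1)\<^sup>2) \<partial>gauss_measure) \<le> ennreal (C * \<rho> ^ 4 * (LINT x|gauss_measure. (h x)\<^sup>2))"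
proof -
  let ?\<gamma> = "gauss_measure :: (real^'n) measure"
  define N where "N = 8 * pi + real CARD('n)"
  define B where "B = 16 * N\<^sup>2 * exp (3 / 2)"
  define J where "J = (LINT x|?\<gamma>. exp (3 * (norm x)\<^sup>2))"
  have N: "N \<ge> 8 * pi" by (simp add: N_def)
  have iE: "integrable ?\<gamma> (\<lambda>x. exp (3 * (norm x)\<^sup>2))" using pi_gt3 by (intro integrable_exp_norm_square) auto
  have J0: "J \<ge> 0" by (simp add: J_def)
  have "(\<integral>\<^sup>+y. ennreal ((noise \<rho> \<sigma> h y - 1)\<^sup>2) \<partial>?\<gamma>) \<le> ennreal (B\<^sup>2 * J\<^sup>2 * \<rho> ^ 4 * (LINT x|?\<gamma>. (h x)\<^sup>2))"
    if h: "integrable ?\<gamma> h" "integrable ?\<gamma> (\<lambda>x. (h x)\<^sup>2)" "(LINT x|?\<gamma>. h x) = 1"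
      "integrable ?\<gamma> (\<lambda>x. h x *\<^sub>R x)" "(LINT x|?\<gamma>. h x *\<^sub>R x) = 0"
      and \<rho>: "0 < \<rho>" "\<rho> \<le> 1 / (4 * N)" and \<sigma>: "\<sigma> > 0" "\<rho>\<^sup>2 + \<sigma>\<^sup>2 = 1" for h \<rho> \<sigma>
  proof -
    have hm [measurable]: "h \<in> borel_measurable borel" using borel_measurable_integrable[OF h(1)] by simp
    define H where "H = (LINT x|?\<gamma>. (h x)\<^sup>2)"
    have H0: "H \<ge> 0" by (simp add: H_def)
    have nnH: "(\<integral>\<^sup>+x. ennreal ((h x)\<^sup>2) \<partial>?\<gamma>) = ennreal H"
      unfolding H_def by (rule nn_integral_eq_integral[OF h(2)]) auto
    have nnJ: "(\<integral>\<^sup>+x. ennreal (exp (3 * (norm x)\<^sup>2)) \<partial>?\<gamma>) = ennreal J"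
      unfolding J_def by (rule nn_integral_eq_integral[OF iE]) auto
    have pt: "ennreal ((noise \<rho> \<sigma> h y - 1)\<^sup>2) \<le> ennreal (H * (\<rho> ^ 4 * B\<^sup>2 * J)) * ennreal (exp (3 * (norm y)\<^sup>2))" for y
    proof -
      define d where "d x = gauss_kernel \<sigma> (\<rho> *\<^sub>R y) x - 1 - 4 * pi * \<rho> * (x \<bullet> y)" for x
      have [measurable]: "d \<in> borel_measurable borel" unfolding d_def by measurable
      have db: "\<bar>d x\<bar> \<le> \<rho>\<^sup>2 * B * exp (3 / 2 * (norm x)\<^sup>2) * exp (3 / 2 * (norm y)\<^sup>2)" for x
        unfolding d_def B_def N_def using \<rho> \<sigma> by (intro gauss_kernel_taylor) (auto simp: N_def)
      have d2: "(d x)\<^sup>2 \<le> (\<rho> ^ 4 * B\<^sup>2 * exp (3 * (norm y)\<^sup>2)) * exp (3 * (norm x)\<^sup>2)" for x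
      proof -
        have "(d x)\<^sup>2 \<le> (\<rho>\<^sup>2 * B * exp (3 / 2 * (norm x)\<^sup>2) * exp (3 / 2 * (norm y)\<^sup>2))\<^sup>2"
          using power_mono[OF db[of x], of 2] by simp
        then show ?thesis by (simp add: power_mult_distrib mult_ac flip: exp_double power_mult)
      qed
      have nnd: "(\<integral>\<^sup>+x. ennreal ((d x)\<^sup>2) \<partial>?\<gamma>) \<le> ennreal ((\<rho> ^ 4 * B\<^sup>2 * exp (3 * (norm y)\<^sup>2)) * J)"
      proof -
        have "(\<integral>\<^sup>+x. ennreal ((d x)\<^sup>2) \<partial>?\<gamma>) \<le> (\<integral>\<^sup>+x. ennreal (\<rho> ^ 4 * B\<^sup>2 * exp (3 * (norm y)\<^sup>2)) * ennreal (exp (3 * (norm x)\<^sup>2)) \<partial>?\<gamma>)"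
          using d2 by (intro nn_integral_mono) (simp flip: ennreal_mult)
        also have "\<dots> = ennreal ((\<rho> ^ 4 * B\<^sup>2 * exp (3 * (norm y)\<^sup>2)) * J)"
          using J0 by (subst nn_integral_cmult) (auto simp: nnJ simp flip: ennreal_mult)
        finally show ?thesis .
      qed
      \<comment> \<open>This is used twice: it shows that h d is integrable, so that the kernel
        integral may be split, and it bounds the only part that survives.\<close>
      have CS: "(\<integral>\<^sup>+x. ennreal \<bar>h x * d x\<bar> \<partial>?\<gamma>)\<^sup>2 \<le> ennreal H * ennreal ((\<rho> ^ 4 * B\<^sup>2 * exp (3 * (norm y)\<^sup>2)) * J)"
      proof -
        have "(\<integral>\<^sup>+x. ennreal \<bar>h x\<bar> * ennreal \<bar>d x\<bar> \<partial>?\<gamma>)\<^sup>2 \<le> (\<integral>\<^sup>+x. ennreal \<bar>h x\<bar> ^ 2 \<partial>?\<gamma>) * (\<integral>\<^sup>+x. ennreal \<bar>d x\<bar> ^ 2 \<partial>?\<gamma>)"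
          by (rule Cauchy_Schwarz_nn_integral) auto
        also have "\<dots> = ennreal H * (\<integral>\<^sup>+x. ennreal ((d x)\<^sup>2) \<partial>?\<gamma>)" by (simp add: ennreal_power nnH)
        also have "\<dots> \<le> ennreal H * ennreal ((\<rho> ^ 4 * B\<^sup>2 * exp (3 * (norm y)\<^sup>2)) * J)"
          by (intro mult_left_mono nnd) auto
        finally show ?thesis by (simp add: abs_mult ennreal_mult)
      qed
      then have "(\<integral>\<^sup>+x. ennreal \<bar>h x * d x\<bar> \<partial>?\<gamma>)\<^sup>2 < \<infinity>"
        using H0 J0 by (auto simp flip: ennreal_mult intro: le_less_trans)
      then have fin: "(\<integral>\<^sup>+x. ennreal (norm (h x * d x)) \<partial>?\<gamma>) < \<infinity>"
        by (simp add: power_less_top_ennreal)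
      then have ihd: "integrable ?\<gamma> (\<lambda>x. h x * d x)" by (intro integrableI_bounded) auto
      have ix: "integrable ?\<gamma> (\<lambda>x. h x * (x \<bullet> y))" "(LINT x|?\<gamma>. h x * (x \<bullet> y)) = 0"
        using integrable_inner_left[OF h(4), of y] integral_inner_left[OF h(4), of y] h(5) by simp_all
      have "noise \<rho> \<sigma> h y = (LINT x|distr ?\<gamma> borel (\<lambda>z. \<rho> *\<^sub>R y + \<sigma> *\<^sub>R z). h x)"
        unfolding noise_def by (subst integral_distr) auto
      also have "\<dots> = (LINT x|?\<gamma>. gauss_kernel \<sigma> (\<rho> *\<^sub>R y) x * h x)"
        unfolding distr_gauss_affine[OF \<sigma>(1)] using \<sigma> by (subst integral_density) (auto simp: gauss_kernel_nonneg)
      also have "\<dots> = (LINT x|?\<gamma>. h x * d x + h x + 4 * pi * \<rho> * (h x * (x \<bullet> y)))"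
        by (intro Bochner_Integration.integral_cong) (auto simp: d_def algebra_simps)
      also have "\<dots> = (LINT x|?\<gamma>. h x * d x) + 1"
        using ihd h ix by simp
      finally have "ennreal \<bar>noise \<rho> \<sigma> h y - 1\<bar> \<le> (\<integral>\<^sup>+x. ennreal \<bar>h x * d x\<bar> \<partial>?\<gamma>)"
        using integral_norm_bound_ennreal[OF ihd] by simp
      then have "(ennreal \<bar>noise \<rho> \<sigma> h y - 1\<bar>)\<^sup>2 \<le> (\<integral>\<^sup>+x. ennreal \<bar>h x * d x\<bar> \<partial>?\<gamma>)\<^sup>2"
        by (intro power_mono) auto
      also note CS
      finally show ?thesis using H0 J0 by (simp add: ennreal_power mult_ac flip: ennreal_mult)
    qed
    have "(\<integral>\<^sup>+y. ennreal ((noise \<rho> \<sigma> h y - 1)\<^sup>2) \<partial>?\<gamma>) \<le> (\<integral>\<^sup>+y. ennreal (H * (\<rho> ^ 4 * B\<^sup>2 * J)) * ennreal (exp (3 * (norm y)\<^sup>2)) \<partial>?\<gamma>)"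
      by (intro nn_integral_mono pt)
    also have "\<dots> = ennreal (B\<^sup>2 * J\<^sup>2 * \<rho> ^ 4 * H)"
      using H0 J0 by (subst nn_integral_cmult) (auto simp: nnJ power2_eq_square[of J] mult_ac simp flip: ennreal_mult)
    finally show ?thesis by (simp add: H_def)
  qed
  moreover have "0 < 1 / (4 * N)" "1 / (4 * N) < 1" using N pi_gt3 by auto
  moreover have "B\<^sup>2 * J\<^sup>2 \<ge> 0" by simp
  ultimately show ?thesis using that by blast
qed


subsection \<open>Test functions and mollifiers\<close>

text \<open>The products of \<open>exp (- 1 / t)\<close> with polynomials in \<open>1 / t\<close> are closed under differentiation.\<close>

definition flat_exp :: "real poly \<Rightarrow> real \<Rightarrow> real" where
  "flat_exp p t = (if t > 0 then poly p (1 / t) * exp (- 1 / t) else 0)"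

text \<open>From (p(1/t) exp(-1/t))' = (1/t)^2 (p(1/t) - p'(1/t)) exp(-1/t).\<close>

definition flat_exp_deriv :: "real poly \<Rightarrow> real poly" where
  "flat_exp_deriv p = [:0, 0, 1:] * (p - pderiv p)"

lemma flat_exp_tendsto_0: "(flat_exp p \<longlongrightarrow> 0) (at_right 0)"
proof -
  have "((\<lambda>x. \<Sum>i\<le>degree p. coeff p i * (x ^ i / exp x)) \<longlongrightarrow> (\<Sum>i\<le>degree p. coeff p i * 0)) at_top"
    by (intro tendsto_sum tendsto_mult tendsto_const tendsto_power_div_exp_0)
  then have "((\<lambda>x. poly p x * exp (- x)) \<longlongrightarrow> 0) at_top"
    by (simp add: poly_altdef sum_distrib_right exp_minus divide_inverse mult.assoc)
  then have "((\<lambda>t. poly p (inverse t) * exp (- inverse t)) \<longlongrightarrow> 0) (at_right 0)"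
    by (rule filterlim_compose[OF _ filterlim_inverse_at_top_right])
  moreover have "\<forall>\<^sub>F t in at_right 0. poly p (inverse t) * exp (- inverse t) = flat_exp p t"
    by (auto simp: eventually_at_right_less flat_exp_def field_simps intro!: eventually_mono[OF eventually_at_right_less])
  ultimately show ?thesis by (rule Lim_transform_eventually)
qed

lemma flat_exp_deriv: "(flat_exp p has_real_derivative flat_exp (flat_exp_deriv p) t) (at t)"
proof -
  consider "t > 0" | "t < 0" | "t = 0" by linarith
  then show ?thesis
  proof cases
    case 1
    have "((\<lambda>t. poly p (1 / t) * exp (- 1 / t)) has_real_derivative flat_exp (flat_exp_deriv p) t) (at t)"
      using 1 by (auto intro!: derivative_eq_intros DERIV_chain'[where g="poly p", OF _ poly_DERIV]
          simp: flat_exp_def flat_exp_deriv_def field_simps power2_eq_square)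
    moreover have "\<forall>\<^sub>F s in nhds t. poly p (1 / s) * exp (- 1 / s) = flat_exp p s"
      using eventually_nhds_in_open[of "{0<..}" t] 1 by (auto simp: flat_exp_def elim: eventually_mono)
    ultimately show ?thesis by (subst (asm) DERIV_cong_ev[OF refl _ refl]) auto
  next
    case 2
    have "\<forall>\<^sub>F s in nhds t. 0 = flat_exp p s"
      using eventually_nhds_in_open[of "{..<0}" t] 2 by (auto simp: flat_exp_def elim: eventually_mono)
    then have "((\<lambda>_. 0) has_real_derivative 0) (at t) \<longleftrightarrow> (flat_exp p has_real_derivative 0) (at t)"
      by (intro DERIV_cong_ev refl) 
    then show ?thesis using 2 by (simp add: flat_exp_def[of _ t])
  next
    case 3
    \<comment> \<open>For h > 0 the division by h is absorbed as one more factor 1 / h of the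
      polynomial.\<close>
    have "((\<lambda>h. flat_exp p h / h) \<longlongrightarrow> 0) (at_right 0)"
      using flat_exp_tendsto_0[of "[:0, 1:] * p"]
      by (rule Lim_transform_eventually)
        (auto simp: flat_exp_def intro!: eventually_mono[OF eventually_at_right_less])
    moreover have "((\<lambda>h. flat_exp p h / h) \<longlongrightarrow> 0) (at_left 0)"
      by (rule Lim_transform_eventually[OF tendsto_const])
        (auto simp: flat_exp_def eventually_at_filter)
    ultimately have "((\<lambda>h. flat_exp p h / h) \<longlongrightarrow> 0) (at 0)"
      by (simp add: filterlim_at_split)
    then show ?thesis using 3 by (simp add: DERIV_def flat_exp_def[of _ 0])
  qed
qed

lemma continuous_flat_exp: "continuous_on A (flat_exp p)"
  using flat_exp_deriv DERIV_isCont continuous_at_imp_continuous_on by blast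

lemma flat_exp_bounded:
  obtains B where "\<And>t. t \<le> T \<Longrightarrow> \<bar>flat_exp p t\<bar> \<le> B"
proof -
  have "compact (flat_exp p ` {0..max 0 T})"
    by (intro compact_continuous_image continuous_flat_exp) auto
  then have "bounded (flat_exp p ` {0..max 0 T})" by (rule compact_imp_bounded)
  then obtain B where B: "\<And>t. t \<in> {0..max 0 T} \<Longrightarrow> \<bar>flat_exp p t\<bar> \<le> B"
    unfolding bounded_iff real_norm_def by blast
  then have "0 \<le> B" using abs_ge_zero order_trans by (metis atLeastAtMost_iff max.cobounded1 order_refl)
  then have "\<bar>flat_exp p t\<bar> \<le> B" if "t \<le> T" for t
    using B[of t] that by (cases "t \<ge> 0") (auto simp: flat_exp_def)
  then show ?thesis using that by blast
qed

section \<open>Calculus of the classes \<open>C_k\<close>\<close>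

lemma partial_deriv_eq:
  assumes "(\<phi> has_derivative D) (at x)"
  shows "partial_deriv j \<phi> x = D (axis j 1)"
  using frechet_derivative_at[OF assms] by (simp add: partial_deriv_def)

text \<open>Lets any explicit family of derivatives stand in for the chosen
  \<open>frechet_derivative\<close> inside \<open>partial_deriv\<close>.\<close>

lemma C_k_SucI:
  assumes "\<And>x. (\<phi> has_derivative D x) (at x)" "\<And>j. C_k k (\<lambda>x. D x (axis j 1))"
  shows "C_k (Suc k) \<phi>"
proof -
  have "partial_deriv j \<phi> = (\<lambda>x. D x (axis j 1))" for j
    using partial_deriv_eq[OF assms(1)] by blast
  then show ?thesis
    using assms by (auto simp: differentiable_on_def differentiable_def intro: has_derivative_at_withinI)
qed

lemma C_k_SucD:
  assumes "C_k (Suc k) \<phi>"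
  shows "(\<phi> has_derivative frechet_derivative \<phi> (at x)) (at x)" "C_k k (partial_deriv j \<phi>)"
  using assms by (auto simp: differentiable_on_def frechet_derivative_works)

lemma C_k_Suc_imp: "C_k (Suc k) \<phi> \<Longrightarrow> C_k k \<phi>"
proof (induction k arbitrary: \<phi>)
  case 0
  then show ?case by (simp add: differentiable_imp_continuous_on)
next
  case (Suc k)
  then show ?case by (metis C_k.simps(2))
qed

lemma C_k_const: "C_k k (\<lambda>_. c)"
proof (induction k arbitrary: c)
  case (Suc k)
  show ?case by (rule C_k_SucI[where D="\<lambda>x v. 0"]) (auto intro: Suc)
qed auto

lemma C_k_add: "C_k k f \<Longrightarrow> C_k k g \<Longrightarrow> C_k k (\<lambda>x. f x + g x)"
proof (induction k arbitrary: f g)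
  case (Suc k)
  show ?case
  proof (rule C_k_SucI)
    fix x show "((\<lambda>x. f x + g x) has_derivative (\<lambda>v. frechet_derivative f (at x) v + frechet_derivative g (at x) v)) (at x)"
      using Suc.prems by (intro has_derivative_add C_k_SucD)
  qed (use Suc.IH[OF C_k_SucD(2)[OF Suc.prems(1)] C_k_SucD(2)[OF Suc.prems(2)]] in \<open>simp add: partial_deriv_def\<close>)
qed (auto intro: continuous_on_add)

lemma C_k_mult: "C_k k f \<Longrightarrow> C_k k g \<Longrightarrow> C_k k (\<lambda>x. f x * g x)"
proof (induction k arbitrary: f g)
  case (Suc k)
  show ?case
  proof (rule C_k_SucI)
    fix x show "((\<lambda>x. f x * g x) has_derivative (\<lambda>v. f x * frechet_derivative g (at x) v + frechet_derivative f (at x) v * g x)) (at x)"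
      using Suc.prems by (intro has_derivative_mult C_k_SucD)
  next
    fix j
    show "C_k k (\<lambda>x. f x * frechet_derivative g (at x) (axis j 1) + frechet_derivative f (at x) (axis j 1) * g x)"
      using Suc.IH[OF C_k_Suc_imp[OF Suc.prems(1)] C_k_SucD(2)[OF Suc.prems(2), of j]]
        Suc.IH[OF C_k_SucD(2)[OF Suc.prems(1), of j] C_k_Suc_imp[OF Suc.prems(2)]]
      by (intro C_k_add) (simp_all add: partial_deriv_def)
  qed
qed (auto intro: continuous_on_mult)

lemma C_k_inner: "C_k k (\<lambda>x. b \<bullet> x)"
proof (cases k)
  case (Suc m)
  show ?thesis unfolding Suc
    by (rule C_k_SucI[where D="\<lambda>x v. b \<bullet> v"]) (auto intro!: derivative_eq_intros C_k_const)
qed (auto intro: continuous_intros)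

text \<open>The induction must leave p arbitrary, since each derivative replaces it by
  \<open>flat_exp_deriv p\<close>, while the inner function q stays fixed and supplies its
  derivative as a factor.\<close>

lemma C_k_flat_exp_comp:
  assumes "\<And>k. C_k k q"
  shows "C_k k (\<lambda>x. flat_exp p (q x))"
proof (induction k arbitrary: p)
  case 0
  show ?case using assms[of 0] by (auto intro: continuous_on_compose2[OF continuous_flat_exp])
next
  case (Suc k)
  show ?case
  proof (rule C_k_SucI)
    fix x
    show "((\<lambda>x. flat_exp p (q x)) has_derivative (\<lambda>v. flat_exp (flat_exp_deriv p) (q x) * frechet_derivative q (at x) v)) (at x)"
      using has_derivative_compose[OF C_k_SucD(1)[OF assms] flat_exp_deriv[unfolded has_field_derivative_def]] .
  next
    fix j
    show "C_k k (\<lambda>x. flat_exp (flat_exp_deriv p) (q x) * frechet_derivative q (at x) (axis j 1))"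
      using C_k_mult[OF Suc.IH C_k_SucD(2)[OF assms, where j=j]] by (simp add: partial_deriv_def)
  qed
qed

lemma C_k_quadratic: "C_k k (\<lambda>x. r - (norm (y - x))\<^sup>2)" for y :: "real^'n"
proof (cases k)
  case 0
  then show ?thesis by (auto intro!: continuous_intros)
next
  case (Suc m)
  show ?thesis unfolding Suc
  proof (rule C_k_SucI)
    fix x
    show "((\<lambda>x. r - (norm (y - x))\<^sup>2) has_derivative (\<lambda>v. 2 * ((y - x) \<bullet> v))) (at x)"
      unfolding power2_norm_eq_inner
      by (auto intro!: derivative_eq_intros simp: inner_commute)
  next
    fix j
    have "C_k m (\<lambda>x. 2 * (y \<bullet> axis j 1) + (- 2 *\<^sub>R axis j 1) \<bullet> x)"
      by (intro C_k_add C_k_const C_k_inner)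
    then show "C_k m (\<lambda>x. 2 * ((y - x) \<bullet> axis j 1))"
      by (simp add: inner_diff_left inner_commute algebra_simps)
  qed
qed

lemma test_function_flat_exp:
  fixes y :: "real^'n"
  shows "test_function (\<lambda>x. c * flat_exp p (r - (norm (y - x))\<^sup>2))"
proof -
  have "{x. c * flat_exp p (r - (norm (y - x))\<^sup>2) \<noteq> 0} \<subseteq> cball y (sqrt r)"
  proof
    fix x assume "x \<in> {x. c * flat_exp p (r - (norm (y - x))\<^sup>2) \<noteq> 0}"
    then have "(norm (y - x))\<^sup>2 \<le> r" by (auto simp: flat_exp_def split: if_splits)
    then show "x \<in> cball y (sqrt r)" by (simp add: dist_norm real_le_rsqrt)
  qed
  then have "compact (closure {x. c * flat_exp p (r - (norm (y - x))\<^sup>2) \<noteq> 0})"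
    using bounded_subset bounded_cball by (metis compact_closure)
  then show ?thesis
    unfolding test_function_def by (intro conjI allI C_k_mult C_k_const C_k_flat_exp_comp C_k_quadratic)
qed

text \<open>The Lipschitz gradient gives a uniform second-order remainder, so convolutions are
  differentiated by direct estimate. The assumption \<open>test\<close> concerns reflected
  translates, since these are what the definition of the weak gradient is tested with. The maximum
  at 0 serves as the uniform bound and later normalizes a cutoff.\<close>

locale mollifier =
  fixes e :: real and \<eta> :: "real^'n \<Rightarrow> real" and D\<eta> :: "real^'n \<Rightarrow> real^'n" and C :: real
  assumes e_pos: "0 < e"
    and nonneg: "\<And>z. 0 \<le> \<eta> z" and le_0: "\<And>z. \<eta> z \<le> \<eta> 0"
    and support: "\<And>z. e \<le> norm z \<Longrightarrow> \<eta> z = 0" "\<And>z. e \<le> norm z \<Longrightarrow> D\<eta> z = 0"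
    and mass: "(\<integral>\<^sup>+z. ennreal (\<eta> z) \<partial>lborel) = 1"
    and deriv: "\<And>z. (\<eta> has_derivative (\<lambda>v. D\<eta> z \<bullet> v)) (at z)"
    and lipschitz: "\<And>x z. norm (D\<eta> x - D\<eta> z) \<le> C * norm (x - z)"
    and test: "\<And>y. test_function (\<lambda>x. \<eta> (y - x))"

text \<open>The bump exp (-1 / (e^2 - |z|^2)) inside the ball of radius e, divided by its
  mass.\<close>

lemma mollifier_exists:
  fixes e :: real
  assumes "e > 0"
  obtains \<eta> :: "real^'n \<Rightarrow> real" and D\<eta> C where "mollifier e \<eta> D\<eta> C"
proof -
  define q where "q z = e\<^sup>2 - (norm z)\<^sup>2" for z :: "real^'n"
  define \<theta> where "\<theta> z = flat_exp 1 (q z)" for z :: "real^'n"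
  define I where "I = (\<integral>\<^sup>+z. ennreal (\<theta> z) \<partial>lborel)"
  have q: "(q has_derivative (\<lambda>v. (- 2 *\<^sub>R z) \<bullet> v)) (at z)" for z
    unfolding q_def power2_norm_eq_inner by (auto intro!: derivative_eq_intros simp: inner_commute)
  have q_le: "q z \<le> e\<^sup>2" for z by (simp add: q_def)
  have q_neg: "q z \<le> 0" if "e \<le> norm z" for z
    using that assms power_mono[of e "norm z" 2] by (simp add: q_def)
  have q_pos: "q z > 0" if "norm z < e" for z
    using that power_strict_mono[of "norm z" e 2] by (simp add: q_def)
  have fq: "((\<lambda>z. flat_exp p (q z)) has_derivative (\<lambda>v. (- 2 * flat_exp (flat_exp_deriv p) (q z)) *\<^sub>R z \<bullet> v)) (at z)" for p z
    using has_derivative_compose[OF q flat_exp_deriv[unfolded has_field_derivative_def, of p]] by (simp add: mult_ac)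
  have \<theta>_nonneg: "\<theta> z \<ge> 0" for z by (simp add: \<theta>_def flat_exp_def)
  have cont: "continuous_on UNIV \<theta>"
    unfolding \<theta>_def using fq by (meson continuous_at_imp_continuous_on has_derivative_continuous)
  then have [measurable]: "\<theta> \<in> borel_measurable borel" by (rule borel_measurable_continuous_onI)
  have \<theta>_0: "\<theta> z \<le> \<theta> 0" for z
    using assms by (auto simp: \<theta>_def flat_exp_def q_def field_simps)
  have \<theta>_supp: "\<theta> z = 0" if "e \<le> norm z" for z using q_neg[OF that] by (simp add: \<theta>_def flat_exp_def)
  have \<theta>0: "\<theta> 0 > 0" using assms by (simp add: \<theta>_def flat_exp_def q_def)
  have "I \<le> (\<integral>\<^sup>+z. ennreal (\<theta> 0) * indicator (cball 0 e) (z::real^'n) \<partial>lborel)"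
    unfolding I_def using \<theta>_0 \<theta>_supp by (intro nn_integral_mono) (auto split: split_indicator intro!: ennreal_leI simp: not_le)
  also have "\<dots> < \<infinity>"
    using emeasure_bounded_finite[OF bounded_cball, of "0::real^'n" e] by (subst nn_integral_cmult_indicator) (simp_all add: ennreal_mult_less_top)
  finally have I_fin: "I < \<infinity>" .
  have "I \<noteq> 0"
  proof
    assume "I = 0"
    then have "AE z in lborel. \<theta> z = 0"
      unfolding I_def using \<theta>_nonneg by (subst (asm) nn_integral_0_iff_AE) (auto simp: ennreal_eq_0_iff order.antisym)
    then have "AE z in (lborel::(real^'n) measure). z \<notin> ball 0 e"
      by eventually_elim (use q_pos in \<open>auto simp: \<theta>_def flat_exp_def\<close>)
    then have "emeasure lborel (ball (0::real^'n) e) = 0"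
      by (subst (asm) AE_iff_measurable[of "ball 0 e"]) auto
    then have "ball (0::real^'n) e \<in> null_sets lebesgue" by (intro null_sets_completionI) auto
    then show False
      using assms open_not_negligible[of "ball (0::real^'n) e"] by (simp add: negligible_iff_null_sets)
  qed
  define N where "N = enn2real I"
  have N: "N > 0" "I = ennreal N" using \<open>I \<noteq> 0\<close> I_fin by (auto simp: N_def enn2real_positive_iff pos2 zero_less_iff_neq_zero less_top)
  define \<eta> where "\<eta> z = \<theta> z / N" for z
  define \<psi> where "\<psi> z = (- 2 / N) * flat_exp (flat_exp_deriv 1) (q z)" for z :: "real^'n"
  define D\<eta> where "D\<eta> z = \<psi> z *\<^sub>R z" for z
  obtain B1 where B1: "\<And>t. t \<le> e\<^sup>2 \<Longrightarrow> \<bar>flat_exp (flat_exp_deriv 1) t\<bar> \<le> B1" using flat_exp_bounded[of "e\<^sup>2"] by blast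
  obtain B2 where B2: "\<And>t. t \<le> e\<^sup>2 \<Longrightarrow> \<bar>flat_exp (flat_exp_deriv (flat_exp_deriv 1)) t\<bar> \<le> B2" using flat_exp_bounded[of "e\<^sup>2"] by blast
  \<comment> \<open>The gradient is \<psi>(z) z. Its derivative has a rank-one part with |z|^2 \<le>
    e^2, giving the first summand, and a multiple \<psi>(z) of the identity, giving the
    second.\<close>
  define C where "C = 4 / N * B2 * e * e + 2 / N * B1"
  have B1_0: "B1 \<ge> 0" and B2_0: "B2 \<ge> 0" using B1[of 0] B2[of 0] by (auto simp: flat_exp_def)
  have Dder: "(D\<eta> has_derivative (\<lambda>v. ((4 / N) * flat_exp (flat_exp_deriv (flat_exp_deriv 1)) (q z) * (z \<bullet> v)) *\<^sub>R z + \<psi> z *\<^sub>R v)) (at z)" for z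
    unfolding D\<eta>_def[abs_def] \<psi>_def
    by (rule derivative_eq_intros fq refl)+ (auto simp: algebra_simps)
  have Dbound: "norm (((4 / N) * flat_exp (flat_exp_deriv (flat_exp_deriv 1)) (q z) * (z \<bullet> v)) *\<^sub>R z + \<psi> z *\<^sub>R v) \<le> C * norm v" for z v
  proof (cases "norm z < e")
    case True
    have "norm (((4 / N) * flat_exp (flat_exp_deriv (flat_exp_deriv 1)) (q z) * (z \<bullet> v)) *\<^sub>R z)
        = (4 / N) * \<bar>flat_exp (flat_exp_deriv (flat_exp_deriv 1)) (q z)\<bar> * \<bar>z \<bullet> v\<bar> * norm z"
      using N by (simp add: abs_mult)
    also have "\<dots> \<le> (4 / N) * B2 * (e * norm v) * e"
    proof (intro mult_mono)
      have "\<bar>z \<bullet> v\<bar> \<le> norm z * norm v" by (rule Cauchy_Schwarz_ineq2)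
      also have "\<dots> \<le> e * norm v" using True by (intro mult_right_mono) auto
      finally show "\<bar>z \<bullet> v\<bar> \<le> e * norm v" .
    qed (use N B2 q_le True assms B2_0 in auto)
    finally have 1: "norm (((4 / N) * flat_exp (flat_exp_deriv (flat_exp_deriv 1)) (q z) * (z \<bullet> v)) *\<^sub>R z) \<le> (4 / N) * B2 * (e * norm v) * e" .
    have "norm (\<psi> z *\<^sub>R v) = (2 / N) * \<bar>flat_exp (flat_exp_deriv 1) (q z)\<bar> * norm v"
      using N by (simp add: \<psi>_def abs_mult)
    also have "\<dots> \<le> (2 / N) * B1 * norm v"
      using N B1[OF q_le] by (intro mult_right_mono mult_left_mono) auto
    finally show ?thesis using 1 norm_triangle_ineq[of "((4 / N) * flat_exp (flat_exp_deriv (flat_exp_deriv 1)) (q z) * (z \<bullet> v)) *\<^sub>R z" "\<psi> z *\<^sub>R v"]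
      by (simp add: C_def algebra_simps)
  next
    case False
    then have "q z \<le> 0" by (intro q_neg) auto
    then show ?thesis using N B1_0 B2_0 assms by (simp add: \<psi>_def flat_exp_def C_def)
  qed
  have "mollifier e \<eta> D\<eta> C"
  proof
    show "norm (D\<eta> x - D\<eta> z) \<le> C * norm (x - z)" for x z
      by (rule differentiable_bound[of UNIV D\<eta>, OF _ Dder onorm_le[OF Dbound]]) auto
    show "(\<eta> has_derivative (\<lambda>v. D\<eta> z \<bullet> v)) (at z)" for z
    proof -
      have "((\<lambda>z. \<theta> z / N) has_derivative (\<lambda>v. ((- 2 * flat_exp (flat_exp_deriv 1) (q z)) *\<^sub>R z \<bullet> v) / N)) (at z)"
        unfolding \<theta>_def using has_derivative_mult_right[OF fq[of 1 z], of "1 / N"] by simp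
      then show ?thesis by (simp add: \<eta>_def[abs_def] D\<eta>_def \<psi>_def)
    qed
    show "(\<integral>\<^sup>+z. ennreal (\<eta> z) \<partial>lborel) = 1"
    proof -
      have "(\<integral>\<^sup>+z. ennreal (\<eta> z) \<partial>lborel) = (\<integral>\<^sup>+z. ennreal (\<theta> z) / ennreal N \<partial>lborel)"
        using N \<theta>_nonneg by (intro nn_integral_cong) (simp add: \<eta>_def divide_ennreal)
      also have "\<dots> = 1" using N by (simp add: nn_integral_divide I_def[symmetric] divide_ennreal)
      finally show ?thesis .
    qed
    show "test_function (\<lambda>x. \<eta> (y - x))" for y
      using test_function_flat_exp[of "1 / N" 1 "e\<^sup>2" y] by (simp add: \<eta>_def \<theta>_def q_def)
    show "\<eta> z = 0" "D\<eta> z = 0" if "e \<le> norm z" for z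
      using q_neg[OF that] by (simp_all add: \<eta>_def \<theta>_def D\<eta>_def \<psi>_def flat_exp_def)
  qed (use assms N \<theta>_nonneg \<theta>_0 in \<open>auto simp: \<eta>_def divide_right_mono\<close>)
  then show ?thesis using that by blast
qed


section \<open>Convolution with a mollifier\<close>

lemma measurable_cball [measurable]: "cball (a :: 'a::euclidean_space) r \<in> sets borel"
  by simp

definition mollify :: "(real^'n \<Rightarrow> real) \<Rightarrow> (real^'n \<Rightarrow> complex) \<Rightarrow> real^'n \<Rightarrow> complex" where
  "mollify \<eta> V x = (LINT y|lborel. \<eta> (x - y) *\<^sub>R V y)"

text \<open>The common source of all later estimates: kernels, their differences, gradients and
  Taylor remainders are inserted for \<psi>, and each time the bound B carries the rate.\<close>

lemma integrable_cutoff: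
  fixes V :: "real^'n \<Rightarrow> complex" and \<psi> :: "real^'n \<Rightarrow> real"
  assumes V: "locally_integrable V" and K: "compact K" and [measurable]: "\<psi> \<in> borel_measurable borel"
    and B: "\<And>y. \<bar>\<psi> y\<bar> \<le> B" "\<And>y. y \<notin> K \<Longrightarrow> \<psi> y = 0"
  shows "integrable lborel (\<lambda>y. \<psi> y *\<^sub>R V y)"
    "norm (LINT y|lborel. \<psi> y *\<^sub>R V y) \<le> B * (LINT y|lborel. norm (indicator K y *\<^sub>R V y))"
proof -
  have i: "integrable lborel (\<lambda>y. indicator K y *\<^sub>R V y)"
    using V K by (auto simp: locally_integrable_def set_integrable_def)
  \<comment> \<open>Local integrability yields measurability of
    \<open>indicator K y *\<^sub>R V y\<close>, so the product is routed through it.\<close>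
  have eq: "(\<lambda>y. \<psi> y *\<^sub>R V y) = (\<lambda>y. \<psi> y *\<^sub>R (indicator K y *\<^sub>R V y))"
    using B(2) by (auto simp: fun_eq_iff indicator_def)
  have le: "norm (\<psi> y *\<^sub>R V y) \<le> B * norm (indicator K y *\<^sub>R V y)" for y
    using B(1)[of y] B(2)[of y] by (cases "y \<in> K") (auto intro: mult_right_mono)
  show I: "integrable lborel (\<lambda>y. \<psi> y *\<^sub>R V y)"
  proof (rule Bochner_Integration.integrable_bound)
    show "integrable lborel (\<lambda>y. B * norm (indicator K y *\<^sub>R V y))"
      using i by (intro integrable_mult_right integrable_norm)
    have "(\<lambda>y. indicator K y *\<^sub>R V y) \<in> borel_measurable lborel" using i by (rule borel_measurable_integrable)
    then show "(\<lambda>y. \<psi> y *\<^sub>R V y) \<in> borel_measurable lborel" unfolding eq by measurable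
    show "AE y in lborel. norm (\<psi> y *\<^sub>R V y) \<le> norm (B * norm (indicator K y *\<^sub>R V y))"
      using le by (intro AE_I2) (metis abs_ge_self order_trans real_norm_def)
  qed
  have "norm (LINT y|lborel. \<psi> y *\<^sub>R V y) \<le> (LINT y|lborel. norm (\<psi> y *\<^sub>R V y))"
    by (rule integral_norm_bound)
  also have "\<dots> \<le> (LINT y|lborel. B * norm (indicator K y *\<^sub>R V y))"
    using i I le by (intro integral_mono integrable_mult_right integrable_norm)
  finally show "norm (LINT y|lborel. \<psi> y *\<^sub>R V y) \<le> B * (LINT y|lborel. norm (indicator K y *\<^sub>R V y))" by simp
qed

context mollifier
begin

lemma C_nonneg: "C \<ge> 0"
proof -
  have "0 \<le> C * norm (axis undefined 1 - 0 :: real^'n)"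
    using lipschitz[of "axis undefined 1" 0] norm_ge_zero order_trans by blast
  then show ?thesis by simp
qed

text \<open>The gradient vanishes at a point of norm e, and every point of the ball is at distance
  at most 2 e from it.\<close>

lemma norm_D_le: "norm (D\<eta> z) \<le> 2 * e * C"
proof (cases "norm z < e")
  case True
  let ?a = "e *\<^sub>R axis undefined 1 :: real^'n"
  have "norm (D\<eta> z - D\<eta> ?a) \<le> C * norm (z - ?a)" by (rule lipschitz)
  also have "\<dots> \<le> C * (2 * e)"
    using True norm_triangle_ineq4[of z ?a] e_pos C_nonneg by (intro mult_left_mono) (auto simp: norm_axis_1)
  finally show ?thesis using support(2)[of ?a] e_pos by (simp add: norm_axis_1 mult_ac)
next
  case False
  then show ?thesis using support(2)[of z] e_pos C_nonneg by simp
qed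

lemma continuous_eta: "continuous_on A \<eta>"
  using deriv by (meson continuous_at_imp_continuous_on has_derivative_continuous)

lemma measurable_eta [measurable]: "\<eta> \<in> borel_measurable borel"
  by (intro borel_measurable_continuous_onI continuous_eta)

lemma continuous_Deta: "continuous_on A D\<eta>"
  by (rule continuous_on_norm_lipschitz[OF lipschitz C_nonneg])

lemma measurable_Deta [measurable]: "D\<eta> \<in> borel_measurable borel"
  by (intro borel_measurable_continuous_onI continuous_Deta)

lemma taylor: "\<bar>\<eta> (z + h) - \<eta> z - D\<eta> z \<bullet> h\<bar> \<le> C * (norm h)\<^sup>2"
  by (rule taylor_lipschitz_gradient[OF deriv lipschitz C_nonneg])

lemma eta_lipschitz: "\<bar>\<eta> x - \<eta> y\<bar> \<le> 2 * e * C * norm (x - y)"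
  by (rule abs_diff_le_of_gradient_le[OF deriv norm_D_le])

lemma eta_pos_0: "\<eta> 0 > 0"
proof (rule ccontr)
  assume "\<not> 0 < \<eta> 0"
  then have "\<eta> z = 0" for z using nonneg[of z] le_0[of z] by linarith
  then show False using mass by simp
qed

lemma mass_shift: "(\<integral>\<^sup>+y. ennreal (\<eta> (x - y)) \<partial>lborel) = 1" "(\<integral>\<^sup>+y. ennreal (\<eta> (y - x)) \<partial>lborel) = 1"
  using nn_integral_lborel_affine[of "\<lambda>z. ennreal (\<eta> z)" "- 1" x] mass
    nn_integral_lborel_affine[of "\<lambda>z. ennreal (\<eta> z)" 1 "- x"]
  by simp_all

context
  fixes V :: "real^'n \<Rightarrow> complex"
  assumes V: "locally_integrable V"
begin

lemma integrable_mollify: "integrable lborel (\<lambda>y. \<eta> (x - y) *\<^sub>R V y)"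
  by (rule integrable_cutoff[OF V compact_cball[of x e], where B="\<eta> 0"])
    (use nonneg le_0 support(1) in \<open>auto simp: dist_norm\<close>)

text \<open>Local integrability of V gives bounds on balls; multiplication by a cutoff later makes
  them global.\<close>

lemma mollify_bounded:
  assumes "norm x \<le> R"
  shows "norm (mollify \<eta> V x) \<le> \<eta> 0 * (LINT y|lborel. norm (indicator (cball 0 (R + e)) y *\<^sub>R V y))"
  unfolding mollify_def
proof (rule integrable_cutoff[OF V compact_cball])
  fix y :: "real^'n" assume "y \<notin> cball 0 (R + e)"
  then show "\<eta> (x - y) = 0"
    using assms norm_triangle_ineq2[of y x] by (intro support) (simp add: norm_minus_commute)
qed (use nonneg le_0 in auto)

lemma mollify_lipschitz:
  assumes "norm x \<le> R" "norm x' \<le> R"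
  shows "norm (mollify \<eta> V x - mollify \<eta> V x')
    \<le> (2 * e * C * (LINT y|lborel. norm (indicator (cball 0 (R + e)) y *\<^sub>R V y))) * norm (x - x')"
proof -
  have "norm (LINT y|lborel. (\<eta> (x - y) - \<eta> (x' - y)) *\<^sub>R V y)
    \<le> (2 * e * C * norm (x - x')) * (LINT y|lborel. norm (indicator (cball 0 (R + e)) y *\<^sub>R V y))"
  proof (rule integrable_cutoff[OF V compact_cball])
    fix y :: "real^'n"
    show "\<bar>\<eta> (x - y) - \<eta> (x' - y)\<bar> \<le> 2 * e * C * norm (x - x')"
      using eta_lipschitz[of "x - y" "x' - y"] by simp
    assume "y \<notin> cball 0 (R + e)"
    then show "\<eta> (x - y) - \<eta> (x' - y) = 0"
      using assms norm_triangle_ineq2[of y x] norm_triangle_ineq2[of y x']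
      by (subst (1 2) support) (simp_all add: norm_minus_commute)
  qed measurable
  then show ?thesis
    unfolding mollify_def by (simp add: scaleR_diff_left integrable_mollify mult_ac)
qed

text \<open>The Taylor remainder of \<eta> is at most C |h|^2 everywhere and, for |h| < 1, supported
  in the ball of radius e + 1 around x. Its integral against V is therefore O(|h|^2).\<close>

lemma has_derivative_mollify:
  "(mollify \<eta> V has_derivative (\<lambda>v. LINT y|lborel. (D\<eta> (x - y) \<bullet> v) *\<^sub>R V y)) (at x)"
proof -
  have i: "integrable lborel (\<lambda>y. (D\<eta> (x - y) \<bullet> v) *\<^sub>R V y)"
    and b: "norm (LINT y|lborel. (D\<eta> (x - y) \<bullet> v) *\<^sub>R V y) \<le> (2 * e * C * norm v) * (LINT y|lborel. norm (indicator (cball x e) y *\<^sub>R V y))" for v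
  proof -
    have "\<bar>D\<eta> (x - y) \<bullet> v\<bar> \<le> 2 * e * C * norm v" for y
      using Cauchy_Schwarz_ineq2[of "D\<eta> (x - y)" v] mult_right_mono[OF norm_D_le[of "x - y"], of "norm v"] by simp
    moreover have "D\<eta> (x - y) \<bullet> v = 0" if "y \<notin> cball x e" for y
      using that by (subst support) (auto simp: dist_norm)
    moreover have "(\<lambda>y. D\<eta> (x - y) \<bullet> v) \<in> borel_measurable borel" by measurable
    ultimately show "integrable lborel (\<lambda>y. (D\<eta> (x - y) \<bullet> v) *\<^sub>R V y)"
      "norm (LINT y|lborel. (D\<eta> (x - y) \<bullet> v) *\<^sub>R V y) \<le> (2 * e * C * norm v) * (LINT y|lborel. norm (indicator (cball x e) y *\<^sub>R V y))"
      using integrable_cutoff[OF V compact_cball[of x e], of "\<lambda>y. D\<eta> (x - y) \<bullet> v" "2 * e * C * norm v"] by blast+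
  qed
  define J where "J = (LINT y|lborel. norm (indicator (cball x (e + 1)) y *\<^sub>R V y))"
  show ?thesis
  proof (rule has_derivativeI_sandwich[where e=1 and H="\<lambda>y. C * J * norm (y - x)"])
    show "bounded_linear (\<lambda>v. LINT y|lborel. (D\<eta> (x - y) \<bullet> v) *\<^sub>R V y)"
    proof (rule bounded_linear_intro)
      show "(LINT y|lborel. (D\<eta> (x - y) \<bullet> (v + w)) *\<^sub>R V y)
         = (LINT y|lborel. (D\<eta> (x - y) \<bullet> v) *\<^sub>R V y) + (LINT y|lborel. (D\<eta> (x - y) \<bullet> w) *\<^sub>R V y)" for v w
        by (simp add: inner_add_right scaleR_add_left i)
      show "(LINT y|lborel. (D\<eta> (x - y) \<bullet> (r *\<^sub>R v)) *\<^sub>R V y) = r *\<^sub>R (LINT y|lborel. (D\<eta> (x - y) \<bullet> v) *\<^sub>R V y)" for r v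
        by (simp flip: scaleR_scaleR)
      show "norm (LINT y|lborel. (D\<eta> (x - y) \<bullet> v) *\<^sub>R V y) \<le> norm v * ((2 * e * C) * (LINT y|lborel. norm (indicator (cball x e) y *\<^sub>R V y)))" for v
        using b[of v] by (simp add: mult_ac)
    qed
  next
    fix x' assume x': "x' \<noteq> x" "dist x' x < 1"
    define h where "h = x' - x"
    have "norm (LINT y|lborel. (\<eta> (x' - y) - \<eta> (x - y) - D\<eta> (x - y) \<bullet> h) *\<^sub>R V y) \<le> (C * (norm h)\<^sup>2) * J"
      unfolding J_def
    proof (rule integrable_cutoff[OF V compact_cball])
      fix y
      show "\<bar>\<eta> (x' - y) - \<eta> (x - y) - D\<eta> (x - y) \<bullet> h\<bar> \<le> C * (norm h)\<^sup>2"
        using taylor[of "x - y" h] by (simp add: h_def algebra_simps)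
      assume y: "y \<notin> cball x (e + 1)"
      have "norm (x - y) \<le> norm (x' - y) + norm (x' - x)"
        using norm_triangle_ineq4[of "x' - y" "x' - x"] by simp
      then have "e \<le> norm (x' - y)" "e \<le> norm (x - y)" using y x' by (auto simp: dist_norm)
      then show "\<eta> (x' - y) - \<eta> (x - y) - D\<eta> (x - y) \<bullet> h = 0" by (simp add: support)
    qed measurable
    also have "(LINT y|lborel. (\<eta> (x' - y) - \<eta> (x - y) - D\<eta> (x - y) \<bullet> h) *\<^sub>R V y)
       = mollify \<eta> V x' - mollify \<eta> V x - (LINT y|lborel. (D\<eta> (x - y) \<bullet> h) *\<^sub>R V y)"
      by (simp add: scaleR_diff_left integrable_mollify i mollify_def)
    finally show "norm (mollify \<eta> V x' - mollify \<eta> V x - (LINT y|lborel. (D\<eta> (x - y) \<bullet> (x' - x)) *\<^sub>R V y)) / norm (x' - x) \<le> C * J * norm (x' - x)"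
      using x' by (simp add: h_def field_simps power2_eq_square)
  next
    have "((\<lambda>y. C * J * norm (y - x)) \<longlongrightarrow> C * J * norm (x - x)) (at x)"
      by (intro tendsto_intros)
    then show "((\<lambda>y. C * J * norm (y - x)) \<longlongrightarrow> 0) (at x)" by simp
  qed simp
qed

lemma continuous_mollify: "continuous_on A (mollify \<eta> V)"
  using has_derivative_mollify by (meson continuous_at_imp_continuous_on has_derivative_continuous)

lemma measurable_mollify [measurable]: "mollify \<eta> V \<in> borel_measurable borel"
  by (intro borel_measurable_continuous_onI continuous_mollify)

end

text \<open>Cauchy-Schwarz with the kernel split into two square roots, one of which integrates to
  the mass 1.\<close>

lemma jensen_square:
  assumes [measurable]: "\<phi> \<in> borel_measurable borel"
  shows "(\<integral>\<^sup>+y. ennreal (\<eta> (x - y)) * \<phi> y \<partial>lborel)\<^sup>2 \<le> (\<integral>\<^sup>+y. ennreal (\<eta> (x - y)) * (\<phi> y)\<^sup>2 \<partial>lborel)"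
proof -
  have sq: "ennreal (sqrt (\<eta> z)) ^ 2 = ennreal (\<eta> z)" for z using nonneg[of z] by (simp add: ennreal_power)
  have "(\<integral>\<^sup>+y. ennreal (sqrt (\<eta> (x - y))) * (ennreal (sqrt (\<eta> (x - y))) * \<phi> y) \<partial>lborel)\<^sup>2
     \<le> (\<integral>\<^sup>+y. ennreal (sqrt (\<eta> (x - y))) ^ 2 \<partial>lborel) * (\<integral>\<^sup>+y. (ennreal (sqrt (\<eta> (x - y))) * \<phi> y) ^ 2 \<partial>lborel)"
    by (rule Cauchy_Schwarz_nn_integral) measurable
  then show ?thesis
    by (simp add: sq mass_shift power_mult_distrib flip: mult.assoc power2_eq_square)
qed

lemma norm_mollify_le:
  assumes "locally_integrable V"
  shows "ennreal (norm (mollify \<eta> V x)) \<le> (\<integral>\<^sup>+y. ennreal (\<eta> (x - y)) * ennreal (norm (V y)) \<partial>lborel)"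
  using integral_norm_bound_ennreal[OF integrable_mollify[OF assms], of x] nonneg
  by (simp add: mollify_def ennreal_mult abs_of_nonneg)

text \<open>The fourth power follows by applying \<open>jensen_square\<close> to the bound for the
  square. Exponent 4 is for f, exponent 2 for gradients and for f next to a gradient of the
  cutoff.\<close>

lemma mollify_power_le:
  assumes V: "locally_integrable V" and [measurable]: "V \<in> borel_measurable borel" and p: "p = 2 \<or> p = 4"
  shows "ennreal (norm (mollify \<eta> V x) ^ p) \<le> (\<integral>\<^sup>+y. ennreal (\<eta> (x - y)) * ennreal (norm (V y) ^ p) \<partial>lborel)"
proof -
  have 2: "ennreal (norm (mollify \<eta> V x) ^ 2) \<le> (\<integral>\<^sup>+y. ennreal (\<eta> (x - y)) * ennreal (norm (V y) ^ 2) \<partial>lborel)"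
  proof -
    have "ennreal (norm (mollify \<eta> V x) ^ 2) \<le> (\<integral>\<^sup>+y. ennreal (\<eta> (x - y)) * ennreal (norm (V y)) \<partial>lborel)\<^sup>2"
      using power_mono[OF norm_mollify_le[OF V, of x], of 2] by (simp add: ennreal_power)
    also have "\<dots> \<le> (\<integral>\<^sup>+y. ennreal (\<eta> (x - y)) * (ennreal (norm (V y)))\<^sup>2 \<partial>lborel)"
      by (rule jensen_square) measurable
    finally show ?thesis by (simp add: ennreal_power)
  qed
  have 4: "ennreal (norm (mollify \<eta> V x) ^ 4) \<le> (\<integral>\<^sup>+y. ennreal (\<eta> (x - y)) * ennreal (norm (V y) ^ 4) \<partial>lborel)"
  proof -
    have "(ennreal (norm (mollify \<eta> V x) ^ 2))\<^sup>2 \<le> (\<integral>\<^sup>+y. ennreal (\<eta> (x - y)) * ennreal (norm (V y) ^ 2) \<partial>lborel)\<^sup>2"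
      using power_mono[OF 2, of 2] by simp
    also have "\<dots> \<le> (\<integral>\<^sup>+y. ennreal (\<eta> (x - y)) * (ennreal (norm (V y) ^ 2))\<^sup>2 \<partial>lborel)"
      by (rule jensen_square) measurable
    finally show ?thesis by (simp add: ennreal_power flip: power_mult)
  qed
  show ?thesis using p 2 4 by auto
qed

end

text \<open>Behaves like a filter of mollifiers of radius tending to 0, so finitely many estimates
  can be met by a single mollifier.\<close>

definition eventually_mollifier :: "((real^'n \<Rightarrow> real) \<Rightarrow> bool) \<Rightarrow> bool" where
  "eventually_mollifier P \<longleftrightarrow> (\<exists>d>0. \<forall>e \<eta> D\<eta> C. mollifier e \<eta> D\<eta> C \<longrightarrow> e < d \<longrightarrow> P \<eta>)"

lemma eventually_mollifier_conj:
  assumes "eventually_mollifier P" "eventually_mollifier Q"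
  shows "eventually_mollifier (\<lambda>\<eta>. P \<eta> \<and> Q \<eta>)"
proof -
  obtain d1 where d1: "d1 > 0" "\<forall>e \<eta> D\<eta> C. mollifier e \<eta> D\<eta> C \<longrightarrow> e < d1 \<longrightarrow> P \<eta>"
    using assms(1) unfolding eventually_mollifier_def by blast
  obtain d2 where d2: "d2 > 0" "\<forall>e \<eta> D\<eta> C. mollifier e \<eta> D\<eta> C \<longrightarrow> e < d2 \<longrightarrow> Q \<eta>"
    using assms(2) unfolding eventually_mollifier_def by blast
  show ?thesis
    unfolding eventually_mollifier_def using d1 d2 by (intro exI[of _ "min d1 d2"]) auto
qed

lemma eventually_mollifier_all:
  assumes "finite J" "\<And>j. j \<in> J \<Longrightarrow> eventually_mollifier (P j)"
  shows "eventually_mollifier (\<lambda>\<eta>. \<forall>j\<in>J. P j \<eta>)"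
  using assms
proof (induction J rule: finite_induct)
  case empty
  show ?case by (auto simp: eventually_mollifier_def intro: exI[of _ 1])
next
  case (insert i J)
  then show ?case using eventually_mollifier_conj[of "P i"] by simp
qed

lemma eventually_mollifierE:
  assumes "eventually_mollifier P"
  obtains e \<eta> D\<eta> C where "mollifier e \<eta> D\<eta> C" "P \<eta>"
proof -
  obtain d where d: "d > 0" "\<forall>e \<eta> D\<eta> C. mollifier e \<eta> D\<eta> C \<longrightarrow> e < d \<longrightarrow> P \<eta>"
    using assms unfolding eventually_mollifier_def by blast
  obtain \<eta> :: "real^'a \<Rightarrow> real" and D\<eta> C where M: "mollifier (d / 2) \<eta> D\<eta> C"
    using mollifier_exists[of "d / 2"] d by auto
  moreover have "d / 2 < d" using d(1) by simp
  ultimately have "P \<eta>" using d(2) by blast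
  with M show ?thesis by (rule that)
qed

text \<open>Jensen and Fubini move the mollification from V onto the weight, and \<kappa> is
  uniformly continuous. Only an upper estimate results, but it holds without any approximation of
  V.\<close>

lemma mollify_weighted_le:
  fixes V :: "real^'n \<Rightarrow> complex" and \<kappa> :: "real^'n \<Rightarrow> real"
  assumes V: "locally_integrable V" and Vm [measurable]: "V \<in> borel_measurable borel" and p: "p = 2 \<or> p = 4"
    and \<kappa>: "continuous_on UNIV \<kappa>" "\<And>x. \<kappa> x \<ge> 0" "\<And>x. norm x \<ge> R \<Longrightarrow> \<kappa> x = 0"
    and fin: "(\<integral>\<^sup>+y. indicator (cball 0 (R + 1)) y * ennreal (norm (V y) ^ p) \<partial>lborel) < \<infinity>"
    and \<epsilon>: "\<epsilon> > 0"
  shows "eventually_mollifier (\<lambda>\<eta>.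
      (\<integral>\<^sup>+x. ennreal (\<kappa> x) * ennreal (norm (mollify \<eta> V x) ^ p) \<partial>lborel)
        \<le> (\<integral>\<^sup>+x. ennreal (\<kappa> x) * ennreal (norm (V x) ^ p) \<partial>lborel) + ennreal \<epsilon>)"
proof -
  have [measurable]: "\<kappa> \<in> borel_measurable borel" using \<kappa>(1) by (rule borel_measurable_continuous_onI)
  let ?B = "cball (0::real^'n) (R + 1)"
  have Bm [measurable]: "?B \<in> sets borel" by simp
  have \<phi>m [measurable]: "(\<lambda>y. ennreal (norm (V y) ^ p)) \<in> borel_measurable borel" by measurable
  define I where "I = enn2real (\<integral>\<^sup>+y. indicator ?B y * ennreal (norm (V y) ^ p) \<partial>lborel)"
  have I: "(\<integral>\<^sup>+y. indicator ?B y * ennreal (norm (V y) ^ p) \<partial>lborel) = ennreal I" "I \<ge> 0"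
    using fin by (auto simp: I_def less_top)
  define \<omega> where "\<omega> = \<epsilon> / (I + 1)"
  have \<omega>: "\<omega> > 0" "\<omega> * I \<le> \<epsilon>" using \<epsilon> I by (auto simp: \<omega>_def field_simps)
  have "uniformly_continuous_on (cball 0 (R + 2)) \<kappa>"
    by (rule compact_uniformly_continuous[OF continuous_on_subset[OF \<kappa>(1)]]) auto
  then obtain d where d: "d > 0" "\<And>x y. x \<in> cball 0 (R + 2) \<Longrightarrow> y \<in> cball 0 (R + 2) \<Longrightarrow> dist y x < d \<Longrightarrow> dist (\<kappa> y) (\<kappa> x) < \<omega>"
    using \<omega>(1) unfolding uniformly_continuous_on_def by metis
  \<comment> \<open>The additive error is confined to the ball of radius R + 1, because \<kappa> x =
    0 for |x| \<ge> R and the points are less than 1 apart.\<close>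
  have near: "\<kappa> x \<le> \<kappa> y + \<omega> * indicator ?B y" if "norm (x - y) < min d 1" for x y
  proof (cases "norm x \<ge> R")
    case True
    then show ?thesis using \<kappa>(2)[of y] \<kappa>(3)[of x] \<omega> by (simp add: zero_le_mult_iff)
  next
    case False
    then have "norm y \<le> R + 1" using that norm_triangle_ineq2[of y x] by (simp add: norm_minus_commute)
    moreover have "\<bar>\<kappa> x - \<kappa> y\<bar> < \<omega>"
      using d(2)[of y x] that False \<open>norm y \<le> R + 1\<close> by (auto simp: dist_norm)
    ultimately show ?thesis by simp
  qed
  show ?thesis
    unfolding eventually_mollifier_def
  proof (intro exI[of _ "min d 1"] conjI allI impI)
    fix e C :: real and \<eta> :: "real^'n \<Rightarrow> real" and D\<eta>
    assume "mollifier e \<eta> D\<eta> C" and e: "e < min d 1"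
    then interpret mollifier e \<eta> D\<eta> C by simp
    have "(\<integral>\<^sup>+x. ennreal (\<kappa> x) * ennreal (norm (mollify \<eta> V x) ^ p) \<partial>lborel)
      \<le> (\<integral>\<^sup>+x. ennreal (\<kappa> x) * (\<integral>\<^sup>+y. ennreal (\<eta> (x - y)) * ennreal (norm (V y) ^ p) \<partial>lborel) \<partial>lborel)"
      by (intro nn_integral_mono mult_left_mono mollify_power_le V Vm p) auto
    also have "\<dots> = (\<integral>\<^sup>+x. \<integral>\<^sup>+y. ennreal (\<kappa> x) * (ennreal (\<eta> (x - y)) * ennreal (norm (V y) ^ p)) \<partial>lborel \<partial>lborel)"
      by (intro nn_integral_cong nn_integral_cmult[symmetric]) measurable
    also have "\<dots> \<le> (\<integral>\<^sup>+x. \<integral>\<^sup>+y. ennreal (\<eta> (x - y)) * (ennreal (\<kappa> y + \<omega> * indicator ?B y) * ennreal (norm (V y) ^ p)) \<partial>lborel \<partial>lborel)"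
    proof (intro nn_integral_mono)
      fix x y
      have "ennreal (\<kappa> x) * ennreal (\<eta> (x - y)) \<le> ennreal (\<kappa> y + \<omega> * indicator ?B y) * ennreal (\<eta> (x - y))"
      proof (cases "norm (x - y) < e")
        case True
        then show ?thesis using near[of x y] e by (intro mult_right_mono ennreal_leI) auto
      qed (simp add: support)
      then have "ennreal (\<kappa> x) * ennreal (\<eta> (x - y)) * ennreal (norm (V y) ^ p)
        \<le> ennreal (\<kappa> y + \<omega> * indicator ?B y) * ennreal (\<eta> (x - y)) * ennreal (norm (V y) ^ p)"
        by (rule mult_right_mono) auto
      then show "ennreal (\<kappa> x) * (ennreal (\<eta> (x - y)) * ennreal (norm (V y) ^ p))
         \<le> ennreal (\<eta> (x - y)) * (ennreal (\<kappa> y + \<omega> * indicator ?B y) * ennreal (norm (V y) ^ p))"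
        by (simp only: mult_ac)
    qed
    also have "\<dots> = (\<integral>\<^sup>+y. \<integral>\<^sup>+x. ennreal (\<eta> (x - y)) * (ennreal (\<kappa> y + \<omega> * indicator ?B y) * ennreal (norm (V y) ^ p)) \<partial>lborel \<partial>lborel)"
      by (rule lborel_pair.Fubini') measurable
    also have "\<dots> = (\<integral>\<^sup>+y. ennreal (\<kappa> y + \<omega> * indicator ?B y) * ennreal (norm (V y) ^ p) \<partial>lborel)"
      by (simp add: nn_integral_multc mass_shift)
    also have "\<dots> = (\<integral>\<^sup>+y. ennreal (\<kappa> y) * ennreal (norm (V y) ^ p) + ennreal \<omega> * (indicator ?B y * ennreal (norm (V y) ^ p)) \<partial>lborel)"
      using \<kappa>(2) \<omega> by (intro nn_integral_cong) (auto simp: ennreal_plus distrib_right split: split_indicator)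
    also have "\<dots> = (\<integral>\<^sup>+x. ennreal (\<kappa> x) * ennreal (norm (V x) ^ p) \<partial>lborel) + ennreal (\<omega> * I)"
    proof (subst nn_integral_add)
      show "(\<lambda>y. ennreal (\<kappa> y) * ennreal (norm (V y) ^ p)) \<in> borel_measurable lborel" by measurable
      show m: "(\<lambda>y. ennreal \<omega> * (indicator ?B y * ennreal (norm (V y) ^ p))) \<in> borel_measurable lborel" by measurable
      have "(\<integral>\<^sup>+y. ennreal \<omega> * (indicator ?B y * ennreal (norm (V y) ^ p)) \<partial>lborel) = ennreal (\<omega> * I)"
        using \<omega> I by (subst nn_integral_cmult) (simp_all add: ennreal_mult)
      then show "(\<integral>\<^sup>+y. ennreal (\<kappa> y) * ennreal (norm (V y) ^ p) \<partial>lborel)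
          + (\<integral>\<^sup>+y. ennreal \<omega> * (indicator ?B y * ennreal (norm (V y) ^ p)) \<partial>lborel)
        = (\<integral>\<^sup>+x. ennreal (\<kappa> x) * ennreal (norm (V x) ^ p) \<partial>lborel) + ennreal (\<omega> * I)"
        by simp
    qed
    also have "\<dots> \<le> (\<integral>\<^sup>+x. ennreal (\<kappa> x) * ennreal (norm (V x) ^ p) \<partial>lborel) + ennreal \<epsilon>"
      using \<omega> by (intro add_left_mono ennreal_leI) auto
    finally show "(\<integral>\<^sup>+x. ennreal (\<kappa> x) * ennreal (norm (mollify \<eta> V x) ^ p) \<partial>lborel)
        \<le> (\<integral>\<^sup>+x. ennreal (\<kappa> x) * ennreal (norm (V x) ^ p) \<partial>lborel) + ennreal \<epsilon>" .
  qed (use d in auto)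
qed


subsection \<open>Approximation of weakly differentiable functions\<close>

text \<open>The inequality (a + b)^2 \<le> 2 (a^2 + b^2) applied twice.\<close>

lemma four_power_add_le: "(a + b) ^ 4 \<le> 8 * (a ^ 4 + b ^ 4)" for a b :: real
proof -
  have le: "(a + b)\<^sup>2 \<le> 2 * (a\<^sup>2 + b\<^sup>2)"
    using sum_squares_bound[of a b] by (simp add: power2_sum)
  have "((a + b)\<^sup>2)\<^sup>2 \<le> (2 * (a\<^sup>2 + b\<^sup>2))\<^sup>2"
    by (rule power_mono[OF le]) simp
  also have "\<dots> \<le> 8 * ((a\<^sup>2)\<^sup>2 + (b\<^sup>2)\<^sup>2)"
    using sum_squares_bound[of "a\<^sup>2" "b\<^sup>2"] by (simp add: power2_sum power_mult_distrib)
  finally show ?thesis by (simp flip: power_mult)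
qed

text \<open>A measurable function is an almost everywhere limit of continuous ones. Projecting these
  onto the ball of radius N keeps them continuous and bounded without spoiling the limit, so
  dominated convergence applies. Assumption \<open>ac\<close> carries the exceptional Lebesgue null
  set to \<nu>.\<close>

lemma continuous_L4_approximation_bounded:
  fixes f :: "real^'n \<Rightarrow> complex" and \<nu> :: "(real^'n) measure"
  assumes fin: "finite_measure \<nu>" and sets [measurable_cong]: "sets \<nu> = sets borel"
    and ac: "\<And>P. (AE x in lborel. P x) \<Longrightarrow> (AE x in \<nu>. P x)"
    and f [measurable]: "f \<in> borel_measurable borel" and N: "N \<ge> 0" "\<And>x. norm (f x) \<le> N" and \<tau>: "\<tau> > 0"
  obtains g where "continuous_on UNIV g" "(\<integral>\<^sup>+x. ennreal (norm (f x - g x) ^ 4) \<partial>\<nu>) < ennreal \<tau>"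
proof -
  interpret finite_measure \<nu> by fact
  have "f measurable_on UNIV"
    by (rule lebesgue_measurable_imp_measurable_on) (auto intro!: measurable_completion)
  then obtain S g where S: "negligible S" and g: "\<And>n. continuous_on UNIV (g n)"
    and lim: "\<And>x. x \<notin> S \<Longrightarrow> (\<lambda>n. g n x) \<longlonglongrightarrow> f x"
    unfolding measurable_on_def by auto
  define c where "c = closest_point (cball (0::complex) N)"
  have c: "continuous_on UNIV c" "norm (c z) \<le> N" "norm z \<le> N \<Longrightarrow> c z = z" for z
  proof -
    show "continuous_on UNIV c" unfolding c_def using N by (intro continuous_on_closest_point) auto
    show "norm (c z) \<le> N" unfolding c_def using closest_point_in_set[of "cball (0::complex) N" z] N by auto
    show "norm z \<le> N \<Longrightarrow> c z = z" unfolding c_def by (intro closest_point_self) auto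
  qed
  have cg: "continuous_on UNIV (\<lambda>x. c (g n x))" for n
    using g by (intro continuous_on_compose2[OF c(1)]) auto
  then have [measurable]: "(\<lambda>x. c (g n x)) \<in> borel_measurable borel" for n by (rule borel_measurable_continuous_onI)
  have "(\<lambda>n. \<integral>\<^sup>+x. ennreal (norm (f x - c (g n x)) ^ 4) \<partial>\<nu>) \<longlonglongrightarrow> (\<integral>\<^sup>+x. 0 \<partial>\<nu>)"
  proof (rule nn_integral_dominated_convergence[where w="\<lambda>_. ennreal ((2 * N) ^ 4)"])
    have "norm (f x - c (g n x)) ^ 4 \<le> (2 * N) ^ 4" for x n
      using norm_triangle_ineq4[of "f x" "c (g n x)"] N(2)[of x] c(2)[of "g n x"] by (intro power_mono) auto
    then show "\<And>n. AE x in \<nu>. ennreal (norm (f x - c (g n x)) ^ 4) \<le> ennreal ((2 * N) ^ 4)"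
      by (auto intro!: ennreal_leI)
    show "(\<integral>\<^sup>+x. ennreal ((2 * N) ^ 4) \<partial>\<nu>) < \<infinity>"
      by (simp add: ennreal_mult_eq_top_iff less_top[symmetric])
    have "AE x in lebesgue. x \<notin> S" using S by (intro AE_not_in) (simp add: negligible_iff_null_sets)
    then have "AE x in lborel. x \<notin> S" by (simp add: AE_completion_iff)
    then have "AE x in \<nu>. x \<notin> S" by (rule ac)
    then show "AE x in \<nu>. (\<lambda>n. ennreal (norm (f x - c (g n x)) ^ 4)) \<longlonglongrightarrow> 0"
    proof eventually_elim
      case (elim x)
      have "isCont c (f x)" using c(1) by (simp add: continuous_on_eq_continuous_at)
      then have "(\<lambda>n. c (g n x)) \<longlonglongrightarrow> c (f x)" using lim[OF elim] by (rule isCont_tendsto_compose)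
      then have "(\<lambda>n. norm (f x - c (g n x)) ^ 4) \<longlonglongrightarrow> norm (f x - f x) ^ 4"
        using c(3)[OF N(2)] by (intro tendsto_intros) auto
      then show ?case using tendsto_ennrealI by fastforce
    qed
  qed measurable
  then have "\<forall>\<^sub>F n in sequentially. (\<integral>\<^sup>+x. ennreal (norm (f x - c (g n x)) ^ 4) \<partial>\<nu>) < ennreal \<tau>"
    using \<tau> by (intro order_tendstoD) auto
  then obtain n where "(\<integral>\<^sup>+x. ennreal (norm (f x - c (g n x)) ^ 4) \<partial>\<nu>) < ennreal \<tau>"
    using eventually_happens'[OF sequentially_bot] by blast
  then show ?thesis by (rule that[OF cg])
qed

text \<open>Truncation where |f| is large reduces to the bounded case; the two errors \<tau> / 16
  are recombined with the factor 8 of \<open>four_power_add_le\<close>.\<close>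

lemma continuous_L4_approximation:
  fixes f :: "real^'n \<Rightarrow> complex" and \<nu> :: "(real^'n) measure"
  assumes fin: "finite_measure \<nu>" and sets [measurable_cong]: "sets \<nu> = sets borel"
    and ac: "\<And>P. (AE x in lborel. P x) \<Longrightarrow> (AE x in \<nu>. P x)"
    and f [measurable]: "f \<in> borel_measurable borel" and f4: "(\<integral>\<^sup>+x. ennreal (norm (f x) ^ 4) \<partial>\<nu>) < \<infinity>" and \<tau>: "\<tau> > 0"
  obtains g where "continuous_on UNIV g" "(\<integral>\<^sup>+x. ennreal (norm (f x - g x) ^ 4) \<partial>\<nu>) < ennreal \<tau>"
proof -
  define t where "t n x = (if norm (f x) \<le> real n then f x else 0)" for n :: nat and x
  have [measurable]: "t n \<in> borel_measurable borel" for n unfolding t_def by measurable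
  have "(\<lambda>n. \<integral>\<^sup>+x. ennreal (norm (f x - t n x) ^ 4) \<partial>\<nu>) \<longlonglongrightarrow> (\<integral>\<^sup>+x. 0 \<partial>\<nu>)"
  proof (rule nn_integral_dominated_convergence[where w="\<lambda>x. ennreal (norm (f x) ^ 4)"])
    show "AE x in \<nu>. (\<lambda>n. ennreal (norm (f x - t n x) ^ 4)) \<longlonglongrightarrow> 0"
    proof (intro AE_I2 tendsto_eventually)
      fix x
      obtain m where "norm (f x) \<le> real m" using real_arch_simple by blast
      then show "\<forall>\<^sub>F n in sequentially. ennreal (norm (f x - t n x) ^ 4) = 0"
        by (auto simp: t_def eventually_sequentially intro!: exI[of _ m])
    qed
  qed (use f4 in \<open>auto simp: t_def\<close>)
  then have "\<forall>\<^sub>F n in sequentially. (\<integral>\<^sup>+x. ennreal (norm (f x - t n x) ^ 4) \<partial>\<nu>) < ennreal (\<tau> / 16)"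
    using \<tau> by (intro order_tendstoD) auto
  then obtain n where n: "(\<integral>\<^sup>+x. ennreal (norm (f x - t n x) ^ 4) \<partial>\<nu>) < ennreal (\<tau> / 16)"
    using eventually_happens'[OF sequentially_bot] by blast
  have tb: "norm (t n x) \<le> real n" for x by (simp add: t_def)
  obtain g where g: "continuous_on UNIV g" "(\<integral>\<^sup>+x. ennreal (norm (t n x - g x) ^ 4) \<partial>\<nu>) < ennreal (\<tau> / 16)"
    by (rule continuous_L4_approximation_bounded[OF fin sets ac, of "t n" "real n" "\<tau> / 16"]) (use \<tau> tb in auto)
  have [measurable]: "g \<in> borel_measurable borel" using g(1) by (rule borel_measurable_continuous_onI)
  have "(\<integral>\<^sup>+x. ennreal (norm (f x - g x) ^ 4) \<partial>\<nu>)
    \<le> (\<integral>\<^sup>+x. ennreal 8 * (ennreal (norm (f x - t n x) ^ 4) + ennreal (norm (t n x - g x) ^ 4)) \<partial>\<nu>)"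
  proof (intro nn_integral_mono)
    fix x
    have "norm (f x - g x) \<le> norm (f x - t n x) + norm (t n x - g x)"
      using norm_triangle_ineq[of "f x - t n x" "t n x - g x"] by simp
    then have "norm (f x - g x) ^ 4 \<le> (norm (f x - t n x) + norm (t n x - g x)) ^ 4" by (intro power_mono) auto
    also have "\<dots> \<le> 8 * (norm (f x - t n x) ^ 4 + norm (t n x - g x) ^ 4)" by (rule four_power_add_le)
    finally have "ennreal (norm (f x - g x) ^ 4) \<le> ennreal (8 * (norm (f x - t n x) ^ 4 + norm (t n x - g x) ^ 4))"
      by (rule ennreal_leI)
    then show "ennreal (norm (f x - g x) ^ 4) \<le> ennreal 8 * (ennreal (norm (f x - t n x) ^ 4) + ennreal (norm (t n x - g x) ^ 4))"
      by (simp only: ennreal_mult ennreal_plus zero_le_power norm_ge_zero zero_le_numeral add_nonneg_nonneg)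
  qed
  also have "\<dots> = ennreal 8 * ((\<integral>\<^sup>+x. ennreal (norm (f x - t n x) ^ 4) \<partial>\<nu>) + (\<integral>\<^sup>+x. ennreal (norm (t n x - g x) ^ 4) \<partial>\<nu>))"
    by (simp add: nn_integral_cmult nn_integral_add)
  also have "\<dots> < ennreal 8 * (ennreal (\<tau> / 16) + ennreal (\<tau> / 16))"
    using n g(2) by (intro ennreal_mult_strict_left_mono add_strict_mono) auto
  also have "\<dots> = ennreal (8 * (\<tau> / 16 + \<tau> / 16))"
    using \<tau> by (simp only: ennreal_mult ennreal_plus add_nonneg_nonneg zero_le_numeral divide_nonneg_nonneg less_imp_le)
  also have "\<dots> = ennreal \<tau>" by simp
  finally show ?thesis using that g(1) by blast
qed

lemma locally_integrable_continuous:
  assumes "continuous_on UNIV g"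
  shows "locally_integrable g"
  unfolding locally_integrable_def
  using borel_integrable_compact[OF _ continuous_on_subset[OF assms]] by (auto simp: set_integrable_def)

lemma locally_integrable_diff:
  "locally_integrable f \<Longrightarrow> locally_integrable g \<Longrightarrow> locally_integrable (\<lambda>x. f x - g x)"
  unfolding locally_integrable_def by auto

text \<open>Three-term comparison through a continuous g: f - g is small in the weighted fourth
  power, its mollification is so by \<open>mollify_weighted_le\<close>, and the mollification of g
  is uniformly close to g on the ball of radius R.\<close>

lemma mollify_converges:
  fixes f :: "real^'n \<Rightarrow> complex" and \<kappa> :: "real^'n \<Rightarrow> real"
  assumes f: "locally_integrable f" and fm [measurable]: "f \<in> borel_measurable borel"
    and \<kappa>: "continuous_on UNIV \<kappa>" "\<And>x. \<kappa> x \<ge> 0" "\<And>x. norm x \<ge> R \<Longrightarrow> \<kappa> x = 0"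
    and fin: "(\<integral>\<^sup>+y. indicator (cball 0 (R + 1)) y * ennreal (norm (f y) ^ 4) \<partial>lborel) < \<infinity>"
    and \<epsilon>: "\<epsilon> > 0"
  shows "eventually_mollifier (\<lambda>\<eta>.
      (\<integral>\<^sup>+x. ennreal (\<kappa> x) * ennreal (norm (mollify \<eta> f x - f x) ^ 4) \<partial>lborel) \<le> ennreal \<epsilon>)"
proof -
  have \<kappa>m [measurable]: "\<kappa> \<in> borel_measurable borel" using \<kappa>(1) by (rule borel_measurable_continuous_onI)
  define \<nu> where "\<nu> = density lborel \<kappa>"
  have "bounded (\<kappa> ` cball 0 R)"
    by (intro compact_imp_bounded compact_continuous_image continuous_on_subset[OF \<kappa>(1)]) auto
  then obtain B where "\<forall>y\<in>\<kappa> ` cball 0 R. norm y \<le> B"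
    unfolding bounded_iff by blast
  then have B: "\<bar>\<kappa> x\<bar> \<le> B" if "norm x \<le> R" for x using that by auto
  have \<kappa>B: "ennreal (\<kappa> x) \<le> ennreal \<bar>B\<bar> * indicator (cball 0 (R + 1)) x" for x
    using B[of x] \<kappa>(3)[of x] by (cases "norm x \<le> R") (auto split: split_indicator intro: ennreal_leI)
  have mass_fin: "(\<integral>\<^sup>+x. ennreal (\<kappa> x) \<partial>lborel) < \<infinity>"
  proof -
    have "(\<integral>\<^sup>+x. ennreal (\<kappa> x) \<partial>lborel) \<le> (\<integral>\<^sup>+x. ennreal \<bar>B\<bar> * indicator (cball (0::real^'n) (R + 1)) x \<partial>lborel)"
      by (intro nn_integral_mono \<kappa>B)
    also have "\<dots> < \<infinity>"
      using emeasure_bounded_finite[OF bounded_cball, of "0::real^'n" "R + 1"]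
      by (subst nn_integral_cmult_indicator) (simp_all add: ennreal_mult_less_top)
    finally show ?thesis .
  qed
  define K where "K = enn2real (\<integral>\<^sup>+x. ennreal (\<kappa> x) \<partial>lborel)"
  have K: "(\<integral>\<^sup>+x. ennreal (\<kappa> x) \<partial>lborel) = ennreal K" "K \<ge> 0"
    using mass_fin by (auto simp: K_def less_top)
  have fin\<nu>: "finite_measure \<nu>"
    using mass_fin by (intro finite_measureI) (auto simp: \<nu>_def emeasure_density)
  have ac: "(AE x in lborel. P x) \<Longrightarrow> (AE x in \<nu>. P x)" for P
    unfolding \<nu>_def by (subst AE_density) auto
  have nn\<nu>: "(\<integral>\<^sup>+x. \<phi> x \<partial>\<nu>) = (\<integral>\<^sup>+x. ennreal (\<kappa> x) * \<phi> x \<partial>lborel)" if "\<phi> \<in> borel_measurable borel" for \<phi>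
    unfolding \<nu>_def using that by (subst nn_integral_density) auto
  have f4: "(\<integral>\<^sup>+x. ennreal (norm (f x) ^ 4) \<partial>\<nu>) < \<infinity>"
  proof -
    have "(\<integral>\<^sup>+x. ennreal (norm (f x) ^ 4) \<partial>\<nu>) \<le> (\<integral>\<^sup>+y. ennreal \<bar>B\<bar> * (indicator (cball 0 (R + 1)) y * ennreal (norm (f y) ^ 4)) \<partial>lborel)"
      unfolding nn\<nu>[OF measurable_compose[OF fm, of "\<lambda>z. ennreal (norm z ^ 4)"], simplified]
    proof (intro nn_integral_mono)
      fix x
      show "ennreal (\<kappa> x) * ennreal (norm (f x) ^ 4) \<le> ennreal \<bar>B\<bar> * (indicator (cball 0 (R + 1)) x * ennreal (norm (f x) ^ 4))"
        unfolding mult.assoc[symmetric] by (intro mult_right_mono \<kappa>B) auto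
    qed
    also have "\<dots> < \<infinity>" using fin by (subst nn_integral_cmult) (auto simp: ennreal_mult_less_top)
    finally show ?thesis .
  qed
  \<comment> \<open>Two uses of \<open>four_power_add_le\<close> give the factor 64, and four
    contributions \<tau> then add up to 256 \<tau> = \<epsilon> / 2.\<close>
  define \<tau> where "\<tau> = \<epsilon> / 512"
  have \<tau>: "\<tau> > 0" using \<epsilon> by (simp add: \<tau>_def)
  obtain g where g: "continuous_on UNIV g" "(\<integral>\<^sup>+x. ennreal (norm (f x - g x) ^ 4) \<partial>\<nu>) < ennreal \<tau>"
    using continuous_L4_approximation[OF fin\<nu> _ ac fm f4 \<tau>] by (auto simp: \<nu>_def)
  have gm [measurable]: "g \<in> borel_measurable borel" using g(1) by (rule borel_measurable_continuous_onI)
  have gl: "locally_integrable g" using g(1) by (rule locally_integrable_continuous)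
  have A: "(\<integral>\<^sup>+x. ennreal (\<kappa> x) * ennreal (norm (f x - g x) ^ 4) \<partial>lborel) \<le> ennreal \<tau>"
    using g(2) by (subst (asm) nn\<nu>) auto
  have "bounded (g ` cball 0 (R + 1))"
    by (intro compact_imp_bounded compact_continuous_image continuous_on_subset[OF g(1)]) auto
  then obtain G where "\<forall>y\<in>g ` cball 0 (R + 1). norm y \<le> G" unfolding bounded_iff by blast
  then have G: "norm (g x) \<le> G" if "norm x \<le> R + 1" for x using that by auto
  have fin': "(\<integral>\<^sup>+y. indicator (cball 0 (R + 1)) y * ennreal (norm (f y - g y) ^ 4) \<partial>lborel) < \<infinity>"
  proof -
    have "(\<integral>\<^sup>+y. indicator (cball 0 (R + 1)) y * ennreal (norm (f y - g y) ^ 4) \<partial>lborel)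
      \<le> (\<integral>\<^sup>+y. ennreal 8 * (indicator (cball 0 (R + 1)) y * ennreal (norm (f y) ^ 4)) + ennreal (8 * G ^ 4) * indicator (cball 0 (R + 1)) y \<partial>lborel)"
    proof (intro nn_integral_mono)
      fix y
      have "norm (f y - g y) ^ 4 \<le> 8 * norm (f y) ^ 4 + 8 * G ^ 4" if "norm y \<le> R + 1"
      proof -
        have "norm (f y - g y) ^ 4 \<le> (norm (f y) + G) ^ 4"
          using norm_triangle_ineq4[of "f y" "g y"] G[OF that] by (intro power_mono) auto
        also have "\<dots> \<le> 8 * (norm (f y) ^ 4 + G ^ 4)" by (rule four_power_add_le)
        finally show ?thesis by simp
      qed
      then have "ennreal (norm (f y - g y) ^ 4) \<le> ennreal 8 * ennreal (norm (f y) ^ 4) + ennreal (8 * G ^ 4)" if "norm y \<le> R + 1"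
        using that ennreal_leI[of "norm (f y - g y) ^ 4" "8 * norm (f y) ^ 4 + 8 * G ^ 4"] by (simp add: ennreal_mult)
      then show "indicator (cball 0 (R + 1)) y * ennreal (norm (f y - g y) ^ 4)
         \<le> ennreal 8 * (indicator (cball 0 (R + 1)) y * ennreal (norm (f y) ^ 4)) + ennreal (8 * G ^ 4) * indicator (cball 0 (R + 1)) y"
        by (simp split: split_indicator)
    qed
    also have "\<dots> = ennreal 8 * (\<integral>\<^sup>+y. indicator (cball 0 (R + 1)) y * ennreal (norm (f y) ^ 4) \<partial>lborel)
        + ennreal (8 * G ^ 4) * emeasure lborel (cball (0::real^'n) (R + 1))"
      by (simp add: nn_integral_add nn_integral_cmult nn_integral_cmult_indicator)
    also have "\<dots> < \<infinity>"
      using fin emeasure_bounded_finite[OF bounded_cball, of "0::real^'n" "R + 1"]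
      by (auto simp: ennreal_mult_less_top)
    finally show ?thesis .
  qed
  have fgm: "(\<lambda>x. f x - g x) \<in> borel_measurable borel" by measurable
  have "eventually_mollifier (\<lambda>\<eta>.
      (\<integral>\<^sup>+x. ennreal (\<kappa> x) * ennreal (norm (mollify \<eta> (\<lambda>x. f x - g x) x) ^ 4) \<partial>lborel)
        \<le> (\<integral>\<^sup>+x. ennreal (\<kappa> x) * ennreal (norm (f x - g x) ^ 4) \<partial>lborel) + ennreal \<tau>)"
    by (rule mollify_weighted_le[OF locally_integrable_diff[OF f gl] fgm disjI2[OF refl] \<kappa> fin' \<tau>])
  then obtain d1 where d1: "d1 > 0" and est: "\<forall>e (\<eta> :: real^'n \<Rightarrow> real) D\<eta> C. mollifier e \<eta> D\<eta> C \<longrightarrow> e < d1 \<longrightarrow>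
      (\<integral>\<^sup>+x. ennreal (\<kappa> x) * ennreal (norm (mollify \<eta> (\<lambda>x. f x - g x) x) ^ 4) \<partial>lborel)
        \<le> (\<integral>\<^sup>+x. ennreal (\<kappa> x) * ennreal (norm (f x - g x) ^ 4) \<partial>lborel) + ennreal \<tau>"
    unfolding eventually_mollifier_def by (elim exE conjE) (rule that)
  define s where "s = min 1 (\<tau> / (K + 1))"
  have s: "s > 0" "s ^ 4 * K \<le> \<tau>"
  proof -
    show "s > 0" using \<tau> K by (simp add: s_def)
    have "s ^ 4 \<le> s" using \<open>s > 0\<close> power_decreasing[of 1 4 s] by (simp add: s_def)
    also have "s \<le> \<tau> / (K + 1)" by (simp add: s_def)
    finally have "s ^ 4 * K \<le> \<tau> / (K + 1) * K" using K by (intro mult_right_mono) auto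
    also have "\<dots> \<le> \<tau>" using K \<tau> by (simp add: field_simps)
    finally show "s ^ 4 * K \<le> \<tau>" .
  qed
  have "uniformly_continuous_on (cball 0 (R + 1)) g"
    by (rule compact_uniformly_continuous[OF continuous_on_subset[OF g(1)]]) auto
  then obtain d2 where d2: "d2 > 0" "\<And>x y. x \<in> cball 0 (R + 1) \<Longrightarrow> y \<in> cball 0 (R + 1) \<Longrightarrow> dist y x < d2 \<Longrightarrow> dist (g y) (g x) < s"
    using s(1) unfolding uniformly_continuous_on_def by metis
  show ?thesis
    unfolding eventually_mollifier_def
  proof (intro exI[of _ "min d1 (min d2 1)"] conjI allI impI)
    fix e C :: real and \<eta> :: "real^'n \<Rightarrow> real" and D\<eta>
    assume M: "mollifier e \<eta> D\<eta> C" and e: "e < min d1 (min d2 1)"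
    interpret mollifier e \<eta> D\<eta> C by fact
    note [measurable] = measurable_mollify[OF f] measurable_mollify[OF gl]
    have diff: "mollify \<eta> (\<lambda>x. f x - g x) x = mollify \<eta> f x - mollify \<eta> g x" for x
      unfolding mollify_def by (simp add: scaleR_diff_right integrable_mollify f gl)
    have near: "norm (mollify \<eta> g x - g x) \<le> s" if "norm x \<le> R" for x
    proof -
      have ie: "integrable lborel (\<lambda>y. \<eta> (x - y))" "(LINT y|lborel. \<eta> (x - y)) = 1"
      proof -
        have "has_bochner_integral lborel (\<lambda>y. \<eta> (x - y)) 1"
          using mass_shift(1)[of x] nonneg by (intro has_bochner_integral_nn_integral) auto
        then show "integrable lborel (\<lambda>y. \<eta> (x - y))" "(LINT y|lborel. \<eta> (x - y)) = 1"
          by (auto simp: has_bochner_integral_iff)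
      qed
      have "mollify \<eta> g x - g x = (LINT y|lborel. \<eta> (x - y) *\<^sub>R g y) - (LINT y|lborel. \<eta> (x - y) *\<^sub>R g x)"
        using ie by (simp add: mollify_def)
      also have "\<dots> = (LINT y|lborel. \<eta> (x - y) *\<^sub>R (g y - g x))"
        using ie by (simp add: scaleR_diff_right integrable_mollify gl)
      also have "norm \<dots> \<le> (LINT y|lborel. norm (\<eta> (x - y) *\<^sub>R (g y - g x)))" by (rule integral_norm_bound)
      also have "\<dots> \<le> (LINT y|lborel. \<eta> (x - y) * s)"
      proof (rule integral_mono)
        show "integrable lborel (\<lambda>y. norm (\<eta> (x - y) *\<^sub>R (g y - g x)))"
          unfolding scaleR_diff_right using ie
          by (intro integrable_norm Bochner_Integration.integrable_diff integrable_mollify gl integrable_scaleR_left) auto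
        fix y
        show "norm (\<eta> (x - y) *\<^sub>R (g y - g x)) \<le> \<eta> (x - y) * s"
        proof (cases "norm (x - y) < e")
          case True
          then have "norm y \<le> R + 1" using that e norm_triangle_ineq2[of y x] by (simp add: norm_minus_commute)
          then have "dist (g y) (g x) < s" using True e that by (intro d2(2)) (auto simp: dist_norm norm_minus_commute)
          then show ?thesis using nonneg by (auto simp: dist_norm intro!: mult_left_mono)
        qed (simp add: support)
      qed (use ie in auto)
      also have "\<dots> = s" using ie by simp
      finally show ?thesis .
    qed
    have pt: "ennreal (\<kappa> x) * ennreal (norm (mollify \<eta> f x - f x) ^ 4)
      \<le> ennreal 64 * (ennreal (\<kappa> x) * ennreal (norm (mollify \<eta> (\<lambda>x. f x - g x) x) ^ 4))
       + (ennreal (64 * s ^ 4) * ennreal (\<kappa> x) + ennreal 64 * (ennreal (\<kappa> x) * ennreal (norm (f x - g x) ^ 4)))" for x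
    proof (cases "norm x \<le> R")
      case True
      define p q where "p = norm (mollify \<eta> (\<lambda>x. f x - g x) x)" and "q = norm (f x - g x)"
      have p0: "p \<ge> 0" "q \<ge> 0" by (auto simp: p_def q_def)
      have "norm (mollify \<eta> f x - f x) \<le> p + (s + q)"
        using near[OF True] norm_triangle_ineq[of "mollify \<eta> f x - mollify \<eta> g x" "(mollify \<eta> g x - g x) + (g x - f x)"]
          norm_triangle_ineq[of "mollify \<eta> g x - g x" "g x - f x"]
        by (simp add: p_def q_def diff norm_minus_commute)
      then have "norm (mollify \<eta> f x - f x) ^ 4 \<le> (p + (s + q)) ^ 4" by (intro power_mono) auto
      also have "\<dots> \<le> 8 * (p ^ 4 + (s + q) ^ 4)" by (rule four_power_add_le)
      finally have "norm (mollify \<eta> f x - f x) ^ 4 \<le> 8 * (p ^ 4 + (s + q) ^ 4)" .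
      moreover have "8 * (s + q) ^ 4 \<le> 64 * s ^ 4 + 64 * q ^ 4" using four_power_add_le[of s q] by simp
      ultimately have "norm (mollify \<eta> f x - f x) ^ 4 \<le> 64 * p ^ 4 + 64 * s ^ 4 + 64 * q ^ 4"
        using zero_le_power[OF p0(1), of 4] unfolding distrib_left by linarith
      then have "\<kappa> x * norm (mollify \<eta> f x - f x) ^ 4 \<le> \<kappa> x * (64 * p ^ 4 + 64 * s ^ 4 + 64 * q ^ 4)"
        using \<kappa>(2) by (rule mult_left_mono)
      also have "\<dots> = 64 * (\<kappa> x * p ^ 4) + (64 * s ^ 4 * \<kappa> x + 64 * (\<kappa> x * q ^ 4))" by (simp add: algebra_simps)
      finally have "ennreal (\<kappa> x * norm (mollify \<eta> f x - f x) ^ 4) \<le> ennreal (64 * (\<kappa> x * p ^ 4) + (64 * s ^ 4 * \<kappa> x + 64 * (\<kappa> x * q ^ 4)))"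
        by (rule ennreal_leI)
      also have "\<dots> = ennreal 64 * (ennreal (\<kappa> x) * ennreal (p ^ 4)) + (ennreal (64 * s ^ 4) * ennreal (\<kappa> x) + ennreal 64 * (ennreal (\<kappa> x) * ennreal (q ^ 4)))"
        using \<kappa>(2)[of x] p0 s by (simp only: ennreal_plus ennreal_mult mult_nonneg_nonneg zero_le_power add_nonneg_nonneg zero_le_numeral less_imp_le)
      finally show ?thesis using \<kappa>(2)[of x] by (simp only: ennreal_mult zero_le_power norm_ge_zero p_def q_def)
    next
      case False
      then show ?thesis by (simp add: \<kappa>(3))
    qed
    have [measurable]: "mollify \<eta> (\<lambda>x. f x - g x) \<in> borel_measurable borel"
      by (rule measurable_mollify[OF locally_integrable_diff[OF f gl]])
    have "(\<integral>\<^sup>+x. ennreal (\<kappa> x) * ennreal (norm (mollify \<eta> f x - f x) ^ 4) \<partial>lborel)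
      \<le> (\<integral>\<^sup>+x. ennreal 64 * (ennreal (\<kappa> x) * ennreal (norm (mollify \<eta> (\<lambda>x. f x - g x) x) ^ 4))
       + (ennreal (64 * s ^ 4) * ennreal (\<kappa> x) + ennreal 64 * (ennreal (\<kappa> x) * ennreal (norm (f x - g x) ^ 4))) \<partial>lborel)"
      by (intro nn_integral_mono pt)
    also have "\<dots> = ennreal 64 * (\<integral>\<^sup>+x. ennreal (\<kappa> x) * ennreal (norm (mollify \<eta> (\<lambda>x. f x - g x) x) ^ 4) \<partial>lborel)
       + (ennreal (64 * s ^ 4) * ennreal K + ennreal 64 * (\<integral>\<^sup>+x. ennreal (\<kappa> x) * ennreal (norm (f x - g x) ^ 4) \<partial>lborel))"
      by (simp add: nn_integral_add nn_integral_cmult K(1))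
    also have "\<dots> \<le> ennreal 64 * (ennreal \<tau> + ennreal \<tau>) + (ennreal (64 * s ^ 4) * ennreal K + ennreal 64 * ennreal \<tau>)"
    proof (intro add_mono mult_left_mono A order_refl)
      have "(\<integral>\<^sup>+x. ennreal (\<kappa> x) * ennreal (norm (mollify \<eta> (\<lambda>x. f x - g x) x) ^ 4) \<partial>lborel)
        \<le> (\<integral>\<^sup>+x. ennreal (\<kappa> x) * ennreal (norm (f x - g x) ^ 4) \<partial>lborel) + ennreal \<tau>"
        using e by (intro est[rule_format, OF M]) auto
      also have "\<dots> \<le> ennreal \<tau> + ennreal \<tau>" by (intro add_mono A order_refl)
      finally show "(\<integral>\<^sup>+x. ennreal (\<kappa> x) * ennreal (norm (mollify \<eta> (\<lambda>x. f x - g x) x) ^ 4) \<partial>lborel) \<le> \<dots>" .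
    qed auto
    also have "\<dots> = ennreal (64 * (\<tau> + \<tau>) + (64 * (s ^ 4 * K) + 64 * \<tau>))"
      by (simp only: ennreal_plus ennreal_mult mult_nonneg_nonneg zero_le_power add_nonneg_nonneg zero_le_numeral
          less_imp_le[OF \<tau>] less_imp_le[OF s(1)] K(2) mult.assoc)
    also have "\<dots> \<le> ennreal \<epsilon>" using s \<tau> by (intro ennreal_leI) (simp add: \<tau>_def)
    finally show "(\<integral>\<^sup>+x. ennreal (\<kappa> x) * ennreal (norm (mollify \<eta> f x - f x) ^ 4) \<partial>lborel) \<le> ennreal \<epsilon>" .
  qed (use d1 d2 in auto)
qed


section \<open>Bounded Lipschitz functions and derivatives of mollifications\<close>

text \<open>Closed under sums, bilinear products and cutoffs, so that the gradient assumptions of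
  \<open>log_sobolev_class\<close> follow from closure properties instead of second
  derivatives.\<close>

definition bounded_lipschitz :: "(real^'n \<Rightarrow> 'b::real_normed_vector) \<Rightarrow> bool" where
  "bounded_lipschitz \<phi> \<longleftrightarrow> (\<exists>B. \<forall>x y. norm (\<phi> x) \<le> B \<and> norm (\<phi> x - \<phi> y) \<le> B * norm (x - y))"

lemma bounded_lipschitzE:
  assumes "bounded_lipschitz \<phi>"
  obtains B where "B \<ge> 0" "\<And>x. norm (\<phi> x) \<le> B" "\<And>x y. norm (\<phi> x - \<phi> y) \<le> B * norm (x - y)"
  using assms unfolding bounded_lipschitz_def by (meson norm_ge_zero order_trans)

lemma bounded_lipschitzI:
  assumes "\<And>x. norm (\<phi> x) \<le> A" "\<And>x y. norm (\<phi> x - \<phi> y) \<le> B * norm (x - y)"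
  shows "bounded_lipschitz \<phi>"
  unfolding bounded_lipschitz_def
proof (intro exI[of _ "max A B"] allI conjI)
  fix x y
  show "norm (\<phi> x) \<le> max A B" using assms(1)[of x] by simp
  have "B * norm (x - y) \<le> max A B * norm (x - y)" by (intro mult_right_mono) auto
  then show "norm (\<phi> x - \<phi> y) \<le> max A B * norm (x - y)" using assms(2)[of x y] by linarith
qed

lemma bounded_lipschitz_continuous: "bounded_lipschitz \<phi> \<Longrightarrow> continuous_on A \<phi>"
  by (erule bounded_lipschitzE) (rule continuous_on_norm_lipschitz)

lemma bounded_lipschitz_add:
  assumes "bounded_lipschitz \<phi>" "bounded_lipschitz \<psi>"
  shows "bounded_lipschitz (\<lambda>x. \<phi> x + \<psi> x)"
proof -
  obtain A where A: "A \<ge> 0" "\<And>x. norm (\<phi> x) \<le> A" "\<And>x y. norm (\<phi> x - \<phi> y) \<le> A * norm (x - y)"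
    using bounded_lipschitzE[OF assms(1)] by blast
  obtain B where B: "B \<ge> 0" "\<And>x. norm (\<psi> x) \<le> B" "\<And>x y. norm (\<psi> x - \<psi> y) \<le> B * norm (x - y)"
    using bounded_lipschitzE[OF assms(2)] by blast
  show ?thesis
  proof (rule bounded_lipschitzI)
    fix x y
    show "norm (\<phi> x + \<psi> x) \<le> A + B" using norm_triangle_mono A(2) B(2) by blast
    have "norm ((\<phi> x - \<phi> y) + (\<psi> x - \<psi> y)) \<le> A * norm (x - y) + B * norm (x - y)"
      using norm_triangle_mono A(3) B(3) by blast
    then show "norm (\<phi> x + \<psi> x - (\<phi> y + \<psi> y)) \<le> (A + B) * norm (x - y)" by (simp add: algebra_simps)
  qed
qed

lemma bounded_lipschitz_bilinear:
  assumes "bounded_bilinear pr" "bounded_lipschitz \<phi>" "bounded_lipschitz \<psi>"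
  shows "bounded_lipschitz (\<lambda>x. pr (\<phi> x) (\<psi> x))"
proof -
  interpret bounded_bilinear pr by fact
  obtain K where K: "K > 0" "\<And>a b. norm (pr a b) \<le> norm a * norm b * K"
    using pos_bounded by blast
  obtain A where A: "A \<ge> 0" "\<And>x. norm (\<phi> x) \<le> A" "\<And>x y. norm (\<phi> x - \<phi> y) \<le> A * norm (x - y)"
    using bounded_lipschitzE[OF assms(2)] by blast
  obtain B where B: "B \<ge> 0" "\<And>x. norm (\<psi> x) \<le> B" "\<And>x y. norm (\<psi> x - \<psi> y) \<le> B * norm (x - y)"
    using bounded_lipschitzE[OF assms(3)] by blast
  show ?thesis
  proof (rule bounded_lipschitzI)
    fix x y
    have "norm (\<phi> x) * norm (\<psi> x) * K \<le> A * B * K"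
      using A B K by (intro mult_mono) auto
    then show "norm (pr (\<phi> x) (\<psi> x)) \<le> A * B * K" using K(2) order_trans by blast
    have "pr (\<phi> x) (\<psi> x) - pr (\<phi> y) (\<psi> y) = pr (\<phi> x - \<phi> y) (\<psi> x) + pr (\<phi> y) (\<psi> x - \<psi> y)"
      by (simp add: diff_left diff_right)
    also have "norm \<dots> \<le> norm (\<phi> x - \<phi> y) * norm (\<psi> x) * K + norm (\<phi> y) * norm (\<psi> x - \<psi> y) * K"
      using norm_triangle_mono K(2) by blast
    also have "\<dots> \<le> (A * norm (x - y)) * B * K + A * (B * norm (x - y)) * K"
      using A B K by (intro add_mono mult_mono) auto
    finally show "norm (pr (\<phi> x) (\<psi> x) - pr (\<phi> y) (\<psi> y)) \<le> (2 * A * B * K) * norm (x - y)"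
      by (simp add: algebra_simps)
  qed
qed

text \<open>If both points lie in the ball, the product rule estimate applies. If one lies outside,
  c vanishes there and the Lipschitz bound of c alone controls the difference.\<close>

lemma bounded_lipschitz_cutoff:
  fixes c :: "real^'n \<Rightarrow> real" and V :: "real^'n \<Rightarrow> 'b::real_normed_vector"
  assumes c: "bounded_lipschitz c" "\<And>x. norm x \<ge> R \<Longrightarrow> c x = 0"
    and V: "\<And>x. norm x \<le> R \<Longrightarrow> norm (V x) \<le> A" "\<And>x y. norm x \<le> R \<Longrightarrow> norm y \<le> R \<Longrightarrow> norm (V x - V y) \<le> B * norm (x - y)"
  shows "bounded_lipschitz (\<lambda>x. c x *\<^sub>R V x)"
proof -
  obtain L where L: "L \<ge> 0" "\<And>x. norm (c x) \<le> L" "\<And>x y. norm (c x - c y) \<le> L * norm (x - y)"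
    using bounded_lipschitzE[OF c(1)] by blast
  define A' where "A' = \<bar>A\<bar>"
  have A': "A' \<ge> 0" "\<And>x. norm x \<le> R \<Longrightarrow> norm (V x) \<le> A'" using V(1) by (fastforce simp: A'_def)+
  define B' where "B' = \<bar>B\<bar>"
  have B': "B' \<ge> 0" by (simp add: B'_def)
  have VB: "norm (V x - V y) \<le> B' * norm (x - y)" if "norm x \<le> R" "norm y \<le> R" for x y
    by (rule order_trans[OF V(2)[OF that]]) (auto simp: B'_def intro: mult_right_mono)
  have one: "norm (c x *\<^sub>R V x - c y *\<^sub>R V y) \<le> (L * A' + L * B') * norm (x - y)" if "norm x \<le> R" for x y
  proof (cases "norm y \<le> R")
    case True
    have "c x *\<^sub>R V x - c y *\<^sub>R V y = (c x - c y) *\<^sub>R V x + c y *\<^sub>R (V x - V y)" by (simp add: algebra_simps)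
    also have "norm \<dots> \<le> (L * norm (x - y)) * A' + L * (B' * norm (x - y))"
      using L A' B' VB[OF that True] A'(2)[OF that] L(3)[of x y] L(2)[of y]
      by (intro norm_triangle_mono) (auto intro!: mult_mono)
    finally show ?thesis by (simp add: algebra_simps)
  next
    case False
    then have y: "c y = 0" using c(2)[of y] by simp
    have "norm (c x *\<^sub>R V x) \<le> (L * norm (x - y)) * A'"
      using L(3)[of x y] A'(2)[OF that] L(1) A'(1) by (auto simp: y intro!: mult_mono)
    also have "\<dots> \<le> (L * A' + L * B') * norm (x - y)" using L B' by (simp add: algebra_simps)
    finally show ?thesis by (simp add: y)
  qed
  show ?thesis
  proof (rule bounded_lipschitzI)
    fix x y
    show "norm (c x *\<^sub>R V x) \<le> L * A'"
      using L A' c(2)[of x] by (cases "norm x \<le> R") (auto intro!: mult_mono)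
    show "norm (c x *\<^sub>R V x - c y *\<^sub>R V y) \<le> (L * A' + L * B') * norm (x - y)"
    proof (cases "norm x \<le> R")
      case False
      show ?thesis
      proof (cases "norm y \<le> R")
        case True
        then show ?thesis using one[of y x] by (simp add: norm_minus_commute)
      next
        case 2: False
        then show ?thesis using False c(2)[of x] c(2)[of y] L A' B' by simp
      qed
    qed (rule one)
  qed
qed

text \<open>Differentiating \<eta>(x - y) in y instead of x changes the sign, and this cancels the
  sign in the definition of the weak gradient.\<close>

lemma (in mollifier) mollify_partial_deriv:
  assumes G: "has_weak_gradient f G"
  shows "(LINT y|lborel. (D\<eta> (x - y) \<bullet> axis j 1) *\<^sub>R f y) = mollify \<eta> (\<lambda>y. G y $ j) x"
proof -
  have pd: "partial_deriv j (\<lambda>y. \<eta> (x - y)) y = - (D\<eta> (x - y) \<bullet> axis j 1)" for y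
  proof -
    have "((\<lambda>y. \<eta> (x - y)) has_derivative (\<lambda>v. D\<eta> (x - y) \<bullet> (- v))) (at y)"
      by (rule has_derivative_compose[OF _ deriv]) (auto intro!: derivative_eq_intros)
    then show ?thesis by (subst partial_deriv_eq) auto
  qed
  have "(LINT y|lborel. partial_deriv j (\<lambda>y. \<eta> (x - y)) y *\<^sub>R f y) = - (LINT y|lborel. \<eta> (x - y) *\<^sub>R (G y $ j))"
    using G test unfolding has_weak_gradient_def by blast
  then show ?thesis by (simp add: pd mollify_def)
qed

lemma (in mollifier) has_derivative_mollify_weak:
  assumes G: "has_weak_gradient f G"
  shows "(mollify \<eta> f has_derivative (\<lambda>v. \<Sum>j\<in>UNIV. (v $ j) *\<^sub>R mollify \<eta> (\<lambda>y. G y $ j) x)) (at x)"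
proof -
  have f: "locally_integrable f" using G by (simp add: has_weak_gradient_def)
  define D where "D v = (LINT y|lborel. (D\<eta> (x - y) \<bullet> v) *\<^sub>R f y)" for v
  have D: "(mollify \<eta> f has_derivative D) (at x)"
    unfolding D_def by (rule has_derivative_mollify[OF f])
  then have "linear D" by (intro bounded_linear.linear has_derivative_bounded_linear)
  then have "D v = (\<Sum>j\<in>UNIV. (v $ j) *\<^sub>R mollify \<eta> (\<lambda>y. G y $ j) x)" for v
  proof -
    have "D v = D (\<Sum>j\<in>UNIV. (v $ j) *\<^sub>R axis j 1)"
      by (simp add: basis_expansion flip: scalar_mult_eq_scaleR)
    also have "\<dots> = (\<Sum>j\<in>UNIV. (v $ j) *\<^sub>R D (axis j 1))"
      using \<open>linear D\<close> by (simp only: linear_sum linear_cmul)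
    finally show ?thesis by (simp only: D_def mollify_partial_deriv[OF G])
  qed
  then show ?thesis using D by presburger
qed

section \<open>Cutoff and smooth approximation in the Gaussian norms\<close>

lemma nn_integral_cball_gauss_finite:
  fixes \<phi> :: "real^'n \<Rightarrow> ennreal"
  assumes [measurable]: "\<phi> \<in> borel_measurable borel" and fin: "(\<integral>\<^sup>+x. \<phi> x \<partial>gauss_measure) < \<infinity>"
  shows "(\<integral>\<^sup>+x. indicator (cball 0 r) x * \<phi> x \<partial>lborel) < \<infinity>"
proof -
  define m where "m = 2 powr (real CARD('n) / 2) * exp (- 2 * pi * r\<^sup>2)"
  have m: "m > 0" by (simp add: m_def)
  have "gauss_weight x \<ge> m" if "norm x \<le> r" for x :: "real^'n"
    using power_mono[OF that, of 2] by (simp add: m_def gauss_weight_def)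
  then have le1: "1 \<le> ennreal (1 / m * gauss_weight x)" if "norm x \<le> r" for x :: "real^'n"
    using m that by simp
  have le: "indicator (cball 0 r) x * \<phi> x \<le> ennreal (1 / m) * (ennreal (gauss_weight x) * \<phi> x)" for x
  proof (cases "norm x \<le> r")
    case True
    have "1 * \<phi> x \<le> ennreal (1 / m * gauss_weight x) * \<phi> x" by (rule mult_right_mono[OF le1[OF True]]) simp
    also have "\<dots> = ennreal (1 / m) * (ennreal (gauss_weight x) * \<phi> x)"
      using m by (subst ennreal_mult) (simp_all add: mult.assoc)
    finally show ?thesis using True by simp
  qed simp
  have "(\<integral>\<^sup>+x. indicator (cball 0 r) x * \<phi> x \<partial>lborel) \<le> (\<integral>\<^sup>+x. ennreal (1 / m) * (ennreal (gauss_weight x) * \<phi> x) \<partial>lborel)"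
    by (intro nn_integral_mono le)
  also have "\<dots> = ennreal (1 / m) * (\<integral>\<^sup>+x. \<phi> x \<partial>gauss_measure)"
    by (subst nn_integral_cmult) (auto simp: nn_integral_gauss_measure)
  also have "\<dots> < \<infinity>" using fin by (simp add: ennreal_mult_less_top)
  finally show ?thesis .
qed

text \<open>A mollifier of radius 1 divided by its maximum. It equals 1 at the origin, not
  necessarily on a ball, but by continuity \<zeta>(x / R) still tends to 1 for each x as R
  grows.\<close>

lemma cutoff_exists:
  obtains \<zeta> :: "real^'n \<Rightarrow> real" and D\<zeta> K
  where "\<And>z. 0 \<le> \<zeta> z" "\<And>z. \<zeta> z \<le> 1" "\<zeta> 0 = 1" "\<And>z. 1 \<le> norm z \<Longrightarrow> \<zeta> z = 0" "\<And>z. 1 \<le> norm z \<Longrightarrow> D\<zeta> z = 0"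
    "\<And>z. (\<zeta> has_derivative (\<lambda>v. D\<zeta> z \<bullet> v)) (at z)" "K \<ge> 0" "\<And>z. norm (D\<zeta> z) \<le> K"
    "\<And>x y. norm (D\<zeta> x - D\<zeta> y) \<le> K * norm (x - y)" "\<And>x y. \<bar>\<zeta> x - \<zeta> y\<bar> \<le> K * norm (x - y)"
proof -
  obtain \<eta> :: "real^'n \<Rightarrow> real" and D\<eta> C where "mollifier 1 \<eta> D\<eta> C" using mollifier_exists[of 1] by auto
  then interpret mollifier 1 \<eta> D\<eta> C .
  define K where "K = 2 * C / \<eta> 0"
  show ?thesis
  proof (rule that[of "\<lambda>z. \<eta> z / \<eta> 0" "\<lambda>z. D\<eta> z /\<^sub>R \<eta> 0" K])
    show "((\<lambda>z. \<eta> z / \<eta> 0) has_derivative (\<lambda>v. (D\<eta> z /\<^sub>R \<eta> 0) \<bullet> v)) (at z)" for z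
      using has_derivative_mult_right[OF deriv[of z], of "inverse (\<eta> 0)"] by (simp add: divide_inverse mult_ac)
    show "norm (D\<eta> z /\<^sub>R \<eta> 0) \<le> K" for z
      using norm_D_le[of z] eta_pos_0 by (simp add: K_def field_simps)
    show "norm (D\<eta> x /\<^sub>R \<eta> 0 - D\<eta> y /\<^sub>R \<eta> 0) \<le> K * norm (x - y)" for x y
    proof -
      have "norm (D\<eta> x /\<^sub>R \<eta> 0 - D\<eta> y /\<^sub>R \<eta> 0) = norm (D\<eta> x - D\<eta> y) / \<eta> 0"
        using eta_pos_0 by (simp add: divide_inverse flip: scaleR_diff_right)
      also have "\<dots> \<le> (2 * C * norm (x - y)) / \<eta> 0"
        using lipschitz[of x y] eta_pos_0 mult_nonneg_nonneg[OF C_nonneg norm_ge_zero[of "x - y"]]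
        by (intro divide_right_mono) auto
      finally show ?thesis by (simp add: K_def)
    qed
    show "\<bar>\<eta> x / \<eta> 0 - \<eta> y / \<eta> 0\<bar> \<le> K * norm (x - y)" for x y
      using divide_right_mono[OF eta_lipschitz[of x y], of "\<eta> 0"] eta_pos_0
      by (simp add: K_def flip: diff_divide_distrib)
  qed (use nonneg le_0 eta_pos_0 support C_nonneg in \<open>auto simp: K_def\<close>)
qed

lemma norm_vec_square: "(norm (v :: 'a::real_normed_vector^'n))\<^sup>2 = (\<Sum>j\<in>UNIV. (norm (v $ j))\<^sup>2)"
  by (simp add: norm_vec_def L2_set_def sum_nonneg)

lemma measurable_vec_nth_compose:
  fixes G :: "'x \<Rightarrow> complex^'n"
  assumes "G \<in> borel_measurable M"
  shows "(\<lambda>x. G x $ j) \<in> borel_measurable M"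
  by (rule measurable_compose[OF assms])
     (intro borel_measurable_continuous_onI continuous_on_component continuous_on_id)

text \<open>Weighted form of the square of a sum: the factor 1 + \<theta> stays close to 1, so that
  the energy is not inflated, and the loss falls on the small term.\<close>

lemma square_norm_add_le:
  fixes a b :: "'a::real_normed_vector"
  assumes "\<theta> > 0"
  shows "(norm (a + b))\<^sup>2 \<le> (1 + \<theta>) * (norm a)\<^sup>2 + (1 + 1 / \<theta>) * (norm b)\<^sup>2"
proof -
  have "(norm (a + b))\<^sup>2 \<le> (norm a + norm b)\<^sup>2" by (intro power_mono norm_triangle_ineq) auto
  moreover have "0 \<le> (sqrt \<theta> * norm a - norm b / sqrt \<theta>)\<^sup>2" by simp
  ultimately show ?thesis using assms
    by (simp add: power2_sum power2_diff power_mult_distrib power_divide algebra_simps)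
qed


text \<open>The approximant u is a cutoff c times a mollification U of f; its gradient is c V plus U
  times the gradient of c, where V mollifies G. The energy is bounded from above only, so Jensen
  suffices and convergence of V is never at stake. Choices are made in the order \<theta>, R,
  mollifier.\<close>

lemma smooth_approximation:
  fixes f :: "real^'n \<Rightarrow> complex" and G :: "real^'n \<Rightarrow> complex^'n"
  assumes fm [measurable]: "f \<in> borel_measurable borel" and G: "has_weak_gradient f G"
    and f4: "(\<integral>\<^sup>+x. ennreal (norm (f x) ^ 4) \<partial>gauss_measure) < \<infinity>"
    and G2: "(\<integral>\<^sup>+x. ennreal ((norm (G x))\<^sup>2) \<partial>gauss_measure) < \<infinity>"
    and \<epsilon>: "\<epsilon> > 0"
  obtains u Du where "bounded_lipschitz u" "\<And>j. bounded_lipschitz (\<lambda>x. Du x $ j)"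
    "\<And>x. (u has_derivative (\<lambda>v. \<Sum>j\<in>UNIV. (v $ j) *\<^sub>R (Du x $ j))) (at x)"
    "(\<integral>\<^sup>+x. ennreal (norm (u x - f x) ^ 4) \<partial>gauss_measure) \<le> ennreal \<epsilon>"
    "(\<integral>\<^sup>+x. ennreal ((norm (Du x :: complex^'n))\<^sup>2) \<partial>gauss_measure)
       \<le> (\<integral>\<^sup>+x. ennreal ((norm (G x))\<^sup>2) \<partial>gauss_measure) + ennreal \<epsilon>"
proof -
  let ?\<gamma> = "gauss_measure :: (real^'n) measure"
  have fl: "locally_integrable f" and Gm [measurable]: "G \<in> borel_measurable borel"
    and Gl: "locally_integrable (\<lambda>x. G x $ j)" for j
    using G by (auto simp: has_weak_gradient_def)
  have Gjm [measurable]: "(\<lambda>x. G x $ j) \<in> borel_measurable borel" for j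
    by (rule measurable_vec_nth_compose[OF Gm])
  have f2: "(\<integral>\<^sup>+x. ennreal (norm (f x) ^ 2) \<partial>?\<gamma>) < \<infinity>"
  proof -
    have "norm (f x) ^ 2 \<le> 1 + norm (f x) ^ 4" for x
    proof -
      have "2 * norm (f x) ^ 2 \<le> 1 + norm (f x) ^ 4"
        using zero_le_power2[of "(norm (f x))\<^sup>2 - 1"] by (simp add: power2_diff flip: power_mult)
      moreover have "0 \<le> norm (f x) ^ 4" by simp
      ultimately show ?thesis by linarith
    qed
    then have "(\<integral>\<^sup>+x. ennreal (norm (f x) ^ 2) \<partial>?\<gamma>) \<le> (\<integral>\<^sup>+x. 1 + ennreal (norm (f x) ^ 4) \<partial>?\<gamma>)"
      by (intro nn_integral_mono) (simp flip: ennreal_1 ennreal_plus add: ennreal_leI)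
    also have "\<dots> < \<infinity>" using f4 by (simp add: nn_integral_add)
    finally show ?thesis .
  qed
  define F2 where "F2 = enn2real (\<integral>\<^sup>+x. ennreal (norm (f x) ^ 2) \<partial>?\<gamma>)"
  have F2: "(\<integral>\<^sup>+x. ennreal (norm (f x) ^ 2) \<partial>?\<gamma>) = ennreal F2" "F2 \<ge> 0" using f2 by (auto simp: F2_def less_top)
  define A where "A = enn2real (\<integral>\<^sup>+x. ennreal ((norm (G x))\<^sup>2) \<partial>?\<gamma>)"
  have A: "(\<integral>\<^sup>+x. ennreal ((norm (G x))\<^sup>2) \<partial>?\<gamma>) = ennreal A" "A \<ge> 0" using G2 by (auto simp: A_def less_top)
  have Gj: "(\<integral>\<^sup>+x. ennreal ((norm (G x $ j))\<^sup>2) \<partial>?\<gamma>) < \<infinity>" for j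
  proof -
    have "(\<integral>\<^sup>+x. ennreal ((norm (G x $ j))\<^sup>2) \<partial>?\<gamma>) \<le> (\<integral>\<^sup>+x. ennreal ((norm (G x))\<^sup>2) \<partial>?\<gamma>)"
      by (intro nn_integral_mono ennreal_leI power_mono Finite_Cartesian_Product.norm_nth_le) auto
    then show ?thesis using G2 by simp
  qed
  have sumG: "(\<Sum>j\<in>UNIV. \<integral>\<^sup>+x. ennreal ((norm (G x $ j))\<^sup>2) \<partial>?\<gamma>) = ennreal A"
    by (simp add: nn_integral_sum[symmetric] norm_vec_square A(1)[symmetric] sum_nonneg)
  obtain \<zeta> :: "real^'n \<Rightarrow> real" and D\<zeta> K where \<zeta>: "\<And>z. 0 \<le> \<zeta> z" "\<And>z. \<zeta> z \<le> 1" "\<zeta> 0 = 1"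
    and \<zeta>_supp: "\<And>z. 1 \<le> norm z \<Longrightarrow> \<zeta> z = 0" "\<And>z. 1 \<le> norm z \<Longrightarrow> D\<zeta> z = 0"
    and \<zeta>_deriv: "\<And>z. (\<zeta> has_derivative (\<lambda>v. D\<zeta> z \<bullet> v)) (at z)"
    and K: "K \<ge> 0" "\<And>z. norm (D\<zeta> z) \<le> K" "\<And>x y. norm (D\<zeta> x - D\<zeta> y) \<le> K * norm (x - y)" "\<And>x y. \<bar>\<zeta> x - \<zeta> y\<bar> \<le> K * norm (x - y)"
    by (rule cutoff_exists) (rule that)
  have \<zeta>_cont: "continuous_on UNIV \<zeta>" using \<zeta>_deriv by (meson continuous_at_imp_continuous_on has_derivative_continuous)
  then have \<zeta>m [measurable]: "\<zeta> \<in> borel_measurable borel" by (rule borel_measurable_continuous_onI)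
  have "(\<lambda>n. \<integral>\<^sup>+x. ennreal ((1 - \<zeta> (x /\<^sub>R real (Suc n))) ^ 4 * norm (f x) ^ 4) \<partial>?\<gamma>) \<longlonglongrightarrow> (\<integral>\<^sup>+x. 0 \<partial>?\<gamma>)"
  proof (rule nn_integral_dominated_convergence[where w="\<lambda>x. ennreal (norm (f x) ^ 4)"])
    have "(1 - \<zeta> z) ^ 4 * norm (f x) ^ 4 \<le> norm (f x) ^ 4" for x z
      using \<zeta>(1,2)[of z] by (intro mult_left_le_one_le power_le_one) auto
    then show "\<And>n. AE x in ?\<gamma>. ennreal ((1 - \<zeta> (x /\<^sub>R real (Suc n))) ^ 4 * norm (f x) ^ 4) \<le> ennreal (norm (f x) ^ 4)"
      by (auto intro: ennreal_leI)
    show "AE x in ?\<gamma>. (\<lambda>n. ennreal ((1 - \<zeta> (x /\<^sub>R real (Suc n))) ^ 4 * norm (f x) ^ 4)) \<longlonglongrightarrow> 0"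
    proof (rule AE_I2)
      fix x :: "real^'n"
      have "(\<lambda>n. inverse (real (Suc n)) *\<^sub>R x) \<longlonglongrightarrow> 0 *\<^sub>R x"
        by (rule tendsto_scaleR[OF LIMSEQ_inverse_real_of_nat tendsto_const])
      moreover have "isCont \<zeta> 0" using \<zeta>_cont by (simp add: continuous_on_eq_continuous_at)
      ultimately have "(\<lambda>n. \<zeta> (x /\<^sub>R real (Suc n))) \<longlonglongrightarrow> \<zeta> 0"
        using isCont_tendsto_compose[of 0 \<zeta> "\<lambda>n. x /\<^sub>R real (Suc n)" sequentially] by simp
      then have "(\<lambda>n. (1 - \<zeta> (x /\<^sub>R real (Suc n))) ^ 4 * norm (f x) ^ 4) \<longlonglongrightarrow> (1 - \<zeta> 0) ^ 4 * norm (f x) ^ 4"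
        by (intro tendsto_intros)
      then have "(\<lambda>n. ennreal ((1 - \<zeta> (x /\<^sub>R real (Suc n))) ^ 4 * norm (f x) ^ 4)) \<longlonglongrightarrow> ennreal ((1 - \<zeta> 0) ^ 4 * norm (f x) ^ 4)"
        by (rule tendsto_ennrealI)
      then show "(\<lambda>n. ennreal ((1 - \<zeta> (x /\<^sub>R real (Suc n))) ^ 4 * norm (f x) ^ 4)) \<longlonglongrightarrow> 0" by (simp add: \<zeta>(3))
    qed
  qed (use f4 in measurable)
  then have ev1: "\<forall>\<^sub>F n in sequentially. (\<integral>\<^sup>+x. ennreal ((1 - \<zeta> (x /\<^sub>R real (Suc n))) ^ 4 * norm (f x) ^ 4) \<partial>?\<gamma>) < ennreal (\<epsilon> / 16)"
    using \<epsilon> by (intro order_tendstoD) auto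
  have cancel: "x / y * y = x" if "y > 0" for x y :: real using that by simp
  define N where "N = real CARD('n)"
  define \<theta> where "\<theta> = \<epsilon> / 4 / (A + 1)"
  have \<theta>: "\<theta> > 0" using \<epsilon> A by (simp add: \<theta>_def)
  have \<theta>A: "\<theta> * A \<le> \<epsilon> / 4"
  proof -
    have "\<theta> * A \<le> \<theta> * (A + 1)" using \<theta> by (intro mult_left_mono) auto
    also have "\<dots> = \<epsilon> / 4" unfolding \<theta>_def using A by (intro cancel) simp
    finally show ?thesis .
  qed
  \<comment> \<open>With \<theta> fixed, the large factor 1 + 1 / \<theta> in front of the cutoff
    gradient is beaten by its size 1 / R^2.\<close>
  have "(\<lambda>n. (1 + 1 / \<theta>) * N * K\<^sup>2 * F2 * (inverse (real (Suc n)))\<^sup>2) \<longlonglongrightarrow> (1 + 1 / \<theta>) * N * K\<^sup>2 * F2 * 0\<^sup>2"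
    by (intro tendsto_intros LIMSEQ_inverse_real_of_nat)
  then have ev2: "\<forall>\<^sub>F n in sequentially. (1 + 1 / \<theta>) * N * K\<^sup>2 * F2 * (inverse (real (Suc n)))\<^sup>2 < \<epsilon> / 4"
    using \<epsilon> by (intro order_tendstoD) auto
  obtain n where n: "(\<integral>\<^sup>+x. ennreal ((1 - \<zeta> (x /\<^sub>R real (Suc n))) ^ 4 * norm (f x) ^ 4) \<partial>?\<gamma>) < ennreal (\<epsilon> / 16)"
    "(1 + 1 / \<theta>) * N * K\<^sup>2 * F2 * (inverse (real (Suc n)))\<^sup>2 < \<epsilon> / 4"
    using eventually_happens'[OF sequentially_bot eventually_conj[OF ev1 ev2]] by blast
  define R where "R = real (Suc n)"
  have R: "R > 0" by (simp add: R_def)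
  define c where "c x = \<zeta> (x /\<^sub>R R)" for x
  define Dc where "Dc x = D\<zeta> (x /\<^sub>R R) /\<^sub>R R" for x
  have c01: "0 \<le> c x" "c x \<le> 1" for x using \<zeta> by (auto simp: c_def)
  have normR: "norm (x /\<^sub>R R) = norm x / R" for x :: "real^'n" using R by (simp add: divide_inverse)
  have c_supp: "c x = 0" "Dc x = 0" if "norm x \<ge> R" for x
  proof -
    have "1 \<le> norm (x /\<^sub>R R)" unfolding normR using that R by simp
    then show "c x = 0" "Dc x = 0" unfolding c_def Dc_def using \<zeta>_supp by simp_all
  qed
  have Dcj_supp: "Dc x $ j = 0" if "norm x \<ge> R" for x j using c_supp(2)[OF that] by simp
  have c_deriv: "(c has_derivative (\<lambda>v. Dc x \<bullet> v)) (at x)" for x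
  proof -
    have "((\<lambda>x. \<zeta> (x /\<^sub>R R)) has_derivative (\<lambda>v. D\<zeta> (x /\<^sub>R R) \<bullet> (v /\<^sub>R R))) (at x)"
      by (rule has_derivative_compose[OF _ \<zeta>_deriv]) (auto intro!: derivative_eq_intros)
    then show ?thesis by (simp add: c_def[abs_def] Dc_def)
  qed
  have diffR: "norm (x /\<^sub>R R - y /\<^sub>R R) = norm (x - y) / R" for x y :: "real^'n"
    unfolding scaleR_diff_right[symmetric] by (rule normR)
  have Dc_le: "norm (Dc x) \<le> K / R" for x
    using K(2)[of "x /\<^sub>R R"] R unfolding Dc_def normR by (simp add: divide_right_mono)
  have bl_c: "bounded_lipschitz c"
  proof (rule bounded_lipschitzI)
    show "norm (c x) \<le> 1" for x using c01[of x] by simp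
    show "norm (c x - c y) \<le> K / R * norm (x - y)" for x y
      using K(4)[of "x /\<^sub>R R" "y /\<^sub>R R"] unfolding diffR c_def by simp
  qed
  have bl_Dc: "bounded_lipschitz (\<lambda>x. Dc x $ j)" for j
  proof (rule bounded_lipschitzI)
    show "norm (Dc x $ j) \<le> K / R" for x using Dc_le[of x] Finite_Cartesian_Product.norm_nth_le[of "Dc x" j] by linarith
    show "norm (Dc x $ j - Dc y $ j) \<le> K / R / R * norm (x - y)" for x y
    proof -
      have "norm (Dc x $ j - Dc y $ j) \<le> norm (Dc x - Dc y)"
        using Finite_Cartesian_Product.norm_nth_le[of "Dc x - Dc y" j] by simp
      also have "\<dots> = norm (D\<zeta> (x /\<^sub>R R) - D\<zeta> (y /\<^sub>R R)) / R"
        unfolding Dc_def scaleR_diff_right[symmetric] by (rule normR)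
      also have "\<dots> \<le> (K * (norm (x - y) / R)) / R"
        using K(3)[of "x /\<^sub>R R" "y /\<^sub>R R"] R unfolding diffR by (intro divide_right_mono) auto
      finally show ?thesis by simp
    qed
  qed
  have cc: "continuous_on UNIV c" and Dcc: "continuous_on UNIV (\<lambda>x. Dc x $ j)" for j
    by (rule bounded_lipschitz_continuous[OF bl_c], rule bounded_lipschitz_continuous[OF bl_Dc])
  have [measurable]: "c \<in> borel_measurable borel" "(\<lambda>x. Dc x $ j) \<in> borel_measurable borel" for j
    by (rule borel_measurable_continuous_onI[OF cc], rule borel_measurable_continuous_onI[OF Dcc])
  \<comment> \<open>The mollification error allowed per component and term, scaled so that all of
    them together, with their factors 1 + \<theta> and 1 + 1 / \<theta>, cost \<epsilon> /
    4.\<close>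
  define \<delta> where "\<delta> = \<epsilon> / 4 / (2 + \<theta> + 1 / \<theta>) / N"
  have N1: "N > 0" by (simp add: N_def)
  have \<delta>: "\<delta> > 0" using \<epsilon> \<theta> N1 by (simp add: \<delta>_def add_pos_pos)
  have \<delta>_eq: "(1 + \<theta>) * (N * \<delta>) + (1 + 1 / \<theta>) * (N * \<delta>) = \<epsilon> / 4"
  proof -
    have "2 + \<theta> + 1 / \<theta> > 0" using \<theta> by (simp add: add_pos_pos)
    then have "\<delta> * N * (2 + \<theta> + 1 / \<theta>) = \<epsilon> / 4"
      unfolding \<delta>_def cancel[OF N1] by (rule cancel)
    then show ?thesis by (simp add: algebra_simps)
  qed
  have fin_f4: "(\<integral>\<^sup>+y. indicator (cball 0 (R + 1)) y * ennreal (norm (f y) ^ 4) \<partial>lborel) < \<infinity>"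
    by (rule nn_integral_cball_gauss_finite[OF _ f4]) measurable
  have fin_f2: "(\<integral>\<^sup>+y. indicator (cball 0 (R + 1)) y * ennreal (norm (f y) ^ 2) \<partial>lborel) < \<infinity>"
    by (rule nn_integral_cball_gauss_finite[OF _ f2]) measurable
  have fin_G: "(\<integral>\<^sup>+y. indicator (cball 0 (R + 1)) y * ennreal (norm (G y $ j) ^ 2) \<partial>lborel) < \<infinity>" for j
    by (rule nn_integral_cball_gauss_finite[OF _ Gj]) measurable
  have w: "continuous_on UNIV (gauss_weight :: real^'n \<Rightarrow> real)" by (rule continuous_gauss_weight)
  \<comment> \<open>The Gaussian density is absorbed into the weight, and the cutoff factor makes
    this weight vanish outside a ball, as the mollification lemmas require. The same is done for the
    components of the gradient and for the cutoff term.\<close>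
  have e0: "eventually_mollifier (\<lambda>\<eta>.
      (\<integral>\<^sup>+x. ennreal (c x ^ 4 * gauss_weight x) * ennreal (norm (mollify \<eta> f x - f x) ^ 4) \<partial>lborel) \<le> ennreal (\<epsilon> / 16))"
  proof (rule mollify_converges[OF fl fm _ _ _ fin_f4])
    show "continuous_on UNIV (\<lambda>x. c x ^ 4 * gauss_weight x)" by (intro continuous_intros cc w)
  qed (use \<epsilon> c_supp in simp_all)
  have e1: "eventually_mollifier (\<lambda>\<eta>. \<forall>j\<in>UNIV.
      (\<integral>\<^sup>+x. ennreal ((c x)\<^sup>2 * gauss_weight x) * ennreal (norm (mollify \<eta> (\<lambda>y. G y $ j) x) ^ 2) \<partial>lborel)
        \<le> (\<integral>\<^sup>+x. ennreal ((c x)\<^sup>2 * gauss_weight x) * ennreal (norm (G x $ j) ^ 2) \<partial>lborel) + ennreal \<delta>)"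
  proof (rule eventually_mollifier_all[OF finite], rule mollify_weighted_le[OF Gl Gjm disjI1[OF refl] _ _ _ fin_G])
    show "continuous_on UNIV (\<lambda>x. (c x)\<^sup>2 * gauss_weight x)" by (intro continuous_intros cc w)
  qed (use \<delta> c_supp in simp_all)
  have e2: "eventually_mollifier (\<lambda>\<eta>. \<forall>j\<in>UNIV.
      (\<integral>\<^sup>+x. ennreal ((Dc x $ j)\<^sup>2 * gauss_weight x) * ennreal (norm (mollify \<eta> f x) ^ 2) \<partial>lborel)
        \<le> (\<integral>\<^sup>+x. ennreal ((Dc x $ j)\<^sup>2 * gauss_weight x) * ennreal (norm (f x) ^ 2) \<partial>lborel) + ennreal \<delta>)"
  proof (rule eventually_mollifier_all[OF finite], rule mollify_weighted_le[OF fl fm disjI1[OF refl] _ _ _ fin_f2])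
    show "continuous_on UNIV (\<lambda>x. (Dc x $ j)\<^sup>2 * gauss_weight x)" for j by (intro continuous_intros Dcc w)
  qed (use \<delta> c_supp in simp_all)
  obtain e \<eta> D\<eta> C where M: "mollifier e \<eta> D\<eta> C" and
    est0: "(\<integral>\<^sup>+x. ennreal (c x ^ 4 * gauss_weight x) * ennreal (norm (mollify \<eta> f x - f x) ^ 4) \<partial>lborel) \<le> ennreal (\<epsilon> / 16)" and
    est1: "\<forall>j\<in>UNIV. (\<integral>\<^sup>+x. ennreal ((c x)\<^sup>2 * gauss_weight x) * ennreal (norm (mollify \<eta> (\<lambda>y. G y $ j) x) ^ 2) \<partial>lborel)
        \<le> (\<integral>\<^sup>+x. ennreal ((c x)\<^sup>2 * gauss_weight x) * ennreal (norm (G x $ j) ^ 2) \<partial>lborel) + ennreal \<delta>" and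
    est2: "\<forall>j\<in>UNIV. (\<integral>\<^sup>+x. ennreal ((Dc x $ j)\<^sup>2 * gauss_weight x) * ennreal (norm (mollify \<eta> f x) ^ 2) \<partial>lborel)
        \<le> (\<integral>\<^sup>+x. ennreal ((Dc x $ j)\<^sup>2 * gauss_weight x) * ennreal (norm (f x) ^ 2) \<partial>lborel) + ennreal \<delta>"
    by (rule eventually_mollifierE[OF eventually_mollifier_conj[OF e0 eventually_mollifier_conj[OF e1 e2]]], elim conjE, rule that)
  interpret mollifier e \<eta> D\<eta> C by (rule M)
  note [measurable] = measurable_mollify[OF fl] measurable_mollify[OF Gl]
  define U where "U = mollify \<eta> f"
  define V where "V j = mollify \<eta> (\<lambda>y. G y $ j)" for j
  have [measurable]: "U \<in> borel_measurable borel" "V j \<in> borel_measurable borel" for j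
    unfolding U_def V_def by (rule measurable_mollify[OF fl] measurable_mollify[OF Gl])+
  define u where "u x = c x *\<^sub>R U x" for x
  define Du where "Du x = (vec_lambda (\<lambda>j. c x *\<^sub>R V j x + (Dc x $ j) *\<^sub>R U x))" for x
  have bl_u: "bounded_lipschitz u"
    unfolding u_def U_def by (rule bounded_lipschitz_cutoff[OF bl_c c_supp(1) mollify_bounded[OF fl] mollify_lipschitz[OF fl]])
  have bl_Du: "bounded_lipschitz (\<lambda>x. Du x $ j)" for j
  proof -
    have "bounded_lipschitz (\<lambda>x. c x *\<^sub>R V j x)"
      unfolding V_def by (rule bounded_lipschitz_cutoff[OF bl_c c_supp(1) mollify_bounded[OF Gl] mollify_lipschitz[OF Gl]])
    moreover have "bounded_lipschitz (\<lambda>x. (Dc x $ j) *\<^sub>R U x)"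
      unfolding U_def by (rule bounded_lipschitz_cutoff[OF bl_Dc Dcj_supp mollify_bounded[OF fl] mollify_lipschitz[OF fl]])
    ultimately show ?thesis unfolding Du_def by (simp add: bounded_lipschitz_add)
  qed
  have u_deriv: "(u has_derivative (\<lambda>v. \<Sum>j\<in>UNIV. (v $ j) *\<^sub>R (Du x $ j))) (at x)" for x
  proof -
    have "(u has_derivative (\<lambda>v. c x *\<^sub>R (\<Sum>j\<in>UNIV. (v $ j) *\<^sub>R V j x) + (Dc x \<bullet> v) *\<^sub>R U x)) (at x)"
      unfolding u_def U_def V_def by (rule has_derivative_scaleR[OF c_deriv has_derivative_mollify_weak[OF G]])
    moreover have "c x *\<^sub>R (\<Sum>j\<in>UNIV. (v $ j) *\<^sub>R V j x) + (Dc x \<bullet> v) *\<^sub>R U x = (\<Sum>j\<in>UNIV. (v $ j) *\<^sub>R (Du x $ j))" for v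
      by (simp add: Du_def inner_vec_def scaleR_sum_right scaleR_sum_left sum.distrib[symmetric] algebra_simps)
    ultimately show ?thesis by simp
  qed
  have Dum [measurable]: "(\<lambda>x. Du x $ j) \<in> borel_measurable borel" for j
    by (intro borel_measurable_continuous_onI bounded_lipschitz_continuous bl_Du)
  have um [measurable]: "u \<in> borel_measurable borel"
    by (intro borel_measurable_continuous_onI bounded_lipschitz_continuous bl_u)
  show ?thesis
  proof (rule that[OF bl_u bl_Du u_deriv])
    have "(\<integral>\<^sup>+x. ennreal (norm (u x - f x) ^ 4) \<partial>?\<gamma>)
      \<le> (\<integral>\<^sup>+x. ennreal 8 * (ennreal (c x ^ 4 * norm (U x - f x) ^ 4) + ennreal ((1 - c x) ^ 4 * norm (f x) ^ 4)) \<partial>?\<gamma>)"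
    proof (intro nn_integral_mono)
      fix x
      have "u x - f x = c x *\<^sub>R (U x - f x) + (- (1 - c x)) *\<^sub>R f x" by (simp add: u_def algebra_simps)
      then have "norm (u x - f x) \<le> c x * norm (U x - f x) + (1 - c x) * norm (f x)"
        using norm_triangle_ineq[of "c x *\<^sub>R (U x - f x)" "(- (1 - c x)) *\<^sub>R f x"] c01[of x] by simp
      then have "norm (u x - f x) ^ 4 \<le> (c x * norm (U x - f x) + (1 - c x) * norm (f x)) ^ 4"
        by (intro power_mono) auto
      also have "\<dots> \<le> 8 * ((c x * norm (U x - f x)) ^ 4 + ((1 - c x) * norm (f x)) ^ 4)" by (rule four_power_add_le)
      finally have "norm (u x - f x) ^ 4 \<le> 8 * (c x ^ 4 * norm (U x - f x) ^ 4 + (1 - c x) ^ 4 * norm (f x) ^ 4)"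
        by (simp only: power_mult_distrib)
      then have "ennreal (norm (u x - f x) ^ 4) \<le> ennreal (8 * (c x ^ 4 * norm (U x - f x) ^ 4 + (1 - c x) ^ 4 * norm (f x) ^ 4))"
        by (rule ennreal_leI)
      also have "\<dots> = ennreal 8 * (ennreal (c x ^ 4 * norm (U x - f x) ^ 4) + ennreal ((1 - c x) ^ 4 * norm (f x) ^ 4))"
        using c01[of x] by (subst ennreal_mult, simp, simp, subst ennreal_plus) simp_all
      finally show "ennreal (norm (u x - f x) ^ 4) \<le> \<dots>" .
    qed
    also have "\<dots> = ennreal 8 * ((\<integral>\<^sup>+x. ennreal (c x ^ 4 * norm (U x - f x) ^ 4) \<partial>?\<gamma>) + (\<integral>\<^sup>+x. ennreal ((1 - c x) ^ 4 * norm (f x) ^ 4) \<partial>?\<gamma>))"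
      by (subst nn_integral_cmult, measurable, subst nn_integral_add) simp_all
    also have "\<dots> \<le> ennreal 8 * (ennreal (\<epsilon> / 16) + ennreal (\<epsilon> / 16))"
    proof (intro mult_left_mono add_mono)
      have "(\<integral>\<^sup>+x. ennreal (c x ^ 4 * norm (U x - f x) ^ 4) \<partial>?\<gamma>)
        = (\<integral>\<^sup>+x. ennreal (c x ^ 4 * gauss_weight x) * ennreal (norm (mollify \<eta> f x - f x) ^ 4) \<partial>lborel)"
        using c01 by (subst nn_integral_gauss_measure) (auto simp: U_def ennreal_mult mult_ac intro!: nn_integral_cong)
      also have "\<dots> \<le> ennreal (\<epsilon> / 16)" by (rule est0)
      finally show "(\<integral>\<^sup>+x. ennreal (c x ^ 4 * norm (U x - f x) ^ 4) \<partial>?\<gamma>) \<le> ennreal (\<epsilon> / 16)" .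
      show "(\<integral>\<^sup>+x. ennreal ((1 - c x) ^ 4 * norm (f x) ^ 4) \<partial>?\<gamma>) \<le> ennreal (\<epsilon> / 16)"
        using n(1) by (simp only: c_def R_def less_imp_le)
    qed auto
    also have "\<dots> = ennreal (8 * (\<epsilon> / 16 + \<epsilon> / 16))"
      using \<epsilon> by (subst ennreal_mult, simp, simp, subst ennreal_plus) simp_all
    finally show "(\<integral>\<^sup>+x. ennreal (norm (u x - f x) ^ 4) \<partial>?\<gamma>) \<le> ennreal \<epsilon>" by simp
  next
    define a1 where "a1 j = (\<integral>\<^sup>+x. ennreal ((c x)\<^sup>2 * gauss_weight x) * ennreal (norm (V j x) ^ 2) \<partial>lborel)" for j
    define a2 where "a2 j = (\<integral>\<^sup>+x. ennreal ((Dc x $ j)\<^sup>2 * gauss_weight x) * ennreal (norm (U x) ^ 2) \<partial>lborel)" for j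
    have a1: "a1 j \<le> (\<integral>\<^sup>+x. ennreal ((norm (G x $ j))\<^sup>2) \<partial>?\<gamma>) + ennreal \<delta>" for j
    proof -
      have "a1 j \<le> (\<integral>\<^sup>+x. ennreal ((c x)\<^sup>2 * gauss_weight x) * ennreal (norm (G x $ j) ^ 2) \<partial>lborel) + ennreal \<delta>"
        unfolding a1_def V_def by (rule bspec[OF est1 UNIV_I])
      also have "(\<integral>\<^sup>+x. ennreal ((c x)\<^sup>2 * gauss_weight x) * ennreal (norm (G x $ j) ^ 2) \<partial>lborel) \<le> (\<integral>\<^sup>+x. ennreal ((norm (G x $ j))\<^sup>2) \<partial>?\<gamma>)"
      proof (subst nn_integral_gauss_measure, measurable, intro nn_integral_mono mult_right_mono ennreal_leI)
        fix x show "(c x)\<^sup>2 * gauss_weight x \<le> gauss_weight x"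
          using c01[of x] by (intro mult_left_le_one_le power_le_one) auto
      qed simp
      finally show ?thesis by (simp add: add_right_mono)
    qed
    have a2: "a2 j \<le> ennreal (K\<^sup>2 * F2 * (inverse R)\<^sup>2 + \<delta>)" for j
    proof -
      have "a2 j \<le> (\<integral>\<^sup>+x. ennreal ((Dc x $ j)\<^sup>2 * gauss_weight x) * ennreal (norm (f x) ^ 2) \<partial>lborel) + ennreal \<delta>"
        unfolding a2_def U_def by (rule bspec[OF est2 UNIV_I])
      also have "(\<integral>\<^sup>+x. ennreal ((Dc x $ j)\<^sup>2 * gauss_weight x) * ennreal (norm (f x) ^ 2) \<partial>lborel)
         \<le> (\<integral>\<^sup>+x. ennreal ((K / R)\<^sup>2) * (ennreal (gauss_weight x) * ennreal (norm (f x) ^ 2)) \<partial>lborel)"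
      proof (intro nn_integral_mono)
        fix x
        have "\<bar>Dc x $ j\<bar> \<le> K / R" using Dc_le[of x] Finite_Cartesian_Product.norm_nth_le[of "Dc x" j] by simp
        then have "(Dc x $ j)\<^sup>2 \<le> (K / R)\<^sup>2" using power_mono[of "\<bar>Dc x $ j\<bar>" "K / R" 2] by simp
        then have "(Dc x $ j)\<^sup>2 * gauss_weight x \<le> (K / R)\<^sup>2 * gauss_weight x" by (intro mult_right_mono) auto
        then have "ennreal ((Dc x $ j)\<^sup>2 * gauss_weight x) \<le> ennreal ((K / R)\<^sup>2) * ennreal (gauss_weight x)"
          by (simp add: ennreal_leI flip: ennreal_mult)
        then show "ennreal ((Dc x $ j)\<^sup>2 * gauss_weight x) * ennreal (norm (f x) ^ 2) \<le> ennreal ((K / R)\<^sup>2) * (ennreal (gauss_weight x) * ennreal (norm (f x) ^ 2))"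
          unfolding mult.assoc[symmetric] by (rule mult_right_mono) simp
      qed
      also have "\<dots> = ennreal ((K / R)\<^sup>2) * ennreal F2"
        by (subst nn_integral_cmult) (auto simp: F2(1)[symmetric] nn_integral_gauss_measure)
      also have "\<dots> = ennreal (K\<^sup>2 * F2 * (inverse R)\<^sup>2)"
        using F2 by (simp add: power_mult_distrib divide_inverse mult_ac flip: ennreal_mult)
      finally show ?thesis using \<delta> F2 by (simp add: add_right_mono)
    qed
    have pt: "ennreal ((norm (Du x $ j))\<^sup>2) \<le> ennreal (1 + \<theta>) * ennreal ((c x)\<^sup>2 * (norm (V j x))\<^sup>2) + ennreal (1 + 1 / \<theta>) * ennreal ((Dc x $ j)\<^sup>2 * (norm (U x))\<^sup>2)" for x j
    proof -
      have "(norm (Du x $ j))\<^sup>2 \<le> (1 + \<theta>) * (norm (c x *\<^sub>R V j x))\<^sup>2 + (1 + 1 / \<theta>) * (norm ((Dc x $ j) *\<^sub>R U x))\<^sup>2"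
        unfolding Du_def vec_lambda_beta by (rule square_norm_add_le[OF \<theta>])
      then have "ennreal ((norm (Du x $ j))\<^sup>2) \<le> ennreal ((1 + \<theta>) * ((c x)\<^sup>2 * (norm (V j x))\<^sup>2) + (1 + 1 / \<theta>) * ((Dc x $ j)\<^sup>2 * (norm (U x))\<^sup>2))"
        by (intro ennreal_leI) (simp add: power_mult_distrib)
      also have "\<dots> = ennreal (1 + \<theta>) * ennreal ((c x)\<^sup>2 * (norm (V j x))\<^sup>2) + ennreal (1 + 1 / \<theta>) * ennreal ((Dc x $ j)\<^sup>2 * (norm (U x))\<^sup>2)"
        using \<theta> by (subst ennreal_plus) (simp_all add: ennreal_mult del: ennreal_plus)
      finally show ?thesis .
    qed
    have "(\<integral>\<^sup>+x. ennreal ((norm (Du x))\<^sup>2) \<partial>?\<gamma>) = (\<Sum>j\<in>UNIV. \<integral>\<^sup>+x. ennreal ((norm (Du x $ j))\<^sup>2) \<partial>?\<gamma>)"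
      by (simp add: nn_integral_sum[symmetric] norm_vec_square sum_nonneg)
    also have "\<dots> \<le> (\<Sum>j\<in>UNIV. ennreal (1 + \<theta>) * a1 j + ennreal (1 + 1 / \<theta>) * a2 j)"
    proof (rule sum_mono)
      fix j
      have "(\<integral>\<^sup>+x. ennreal ((norm (Du x $ j))\<^sup>2) \<partial>?\<gamma>) \<le> (\<integral>\<^sup>+x. ennreal (1 + \<theta>) * ennreal ((c x)\<^sup>2 * (norm (V j x))\<^sup>2) + ennreal (1 + 1 / \<theta>) * ennreal ((Dc x $ j)\<^sup>2 * (norm (U x))\<^sup>2) \<partial>?\<gamma>)"
        by (intro nn_integral_mono pt)
      also have "\<dots> = ennreal (1 + \<theta>) * (\<integral>\<^sup>+x. ennreal ((c x)\<^sup>2 * (norm (V j x))\<^sup>2) \<partial>?\<gamma>) + ennreal (1 + 1 / \<theta>) * (\<integral>\<^sup>+x. ennreal ((Dc x $ j)\<^sup>2 * (norm (U x))\<^sup>2) \<partial>?\<gamma>)"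
        by (subst nn_integral_add) (simp_all add: nn_integral_cmult del: ennreal_plus)
      also have "(\<integral>\<^sup>+x. ennreal ((c x)\<^sup>2 * (norm (V j x))\<^sup>2) \<partial>?\<gamma>) = a1 j"
        unfolding a1_def by (subst nn_integral_gauss_measure) (auto simp: ennreal_mult mult_ac intro!: nn_integral_cong)
      also have "(\<integral>\<^sup>+x. ennreal ((Dc x $ j)\<^sup>2 * (norm (U x))\<^sup>2) \<partial>?\<gamma>) = a2 j"
        unfolding a2_def by (subst nn_integral_gauss_measure) (auto simp: ennreal_mult mult_ac intro!: nn_integral_cong)
      finally show "(\<integral>\<^sup>+x. ennreal ((norm (Du x $ j))\<^sup>2) \<partial>?\<gamma>) \<le> ennreal (1 + \<theta>) * a1 j + ennreal (1 + 1 / \<theta>) * a2 j" .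
    qed
    also have "\<dots> \<le> (\<Sum>j\<in>(UNIV::'n set). ennreal (1 + \<theta>) * ((\<integral>\<^sup>+x. ennreal ((norm (G x $ j))\<^sup>2) \<partial>?\<gamma>) + ennreal \<delta>) + ennreal (1 + 1 / \<theta>) * ennreal (K\<^sup>2 * F2 * (inverse R)\<^sup>2 + \<delta>))"
      by (intro sum_mono add_mono mult_left_mono a1 a2) auto
    also have "\<dots> = ennreal (1 + \<theta>) * (ennreal A + ennreal (N * \<delta>)) + ennreal N * (ennreal (1 + 1 / \<theta>) * ennreal (K\<^sup>2 * F2 * (inverse R)\<^sup>2 + \<delta>))"
      using \<delta> by (simp only: sum.distrib sum_distrib_left[symmetric] sumG sum_constant)
        (simp add: N_def ennreal_mult ennreal_of_nat_eq_real_of_nat mult.left_commute del: ennreal_plus)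
    also have "\<dots> = ennreal ((1 + \<theta>) * (A + N * \<delta>) + N * ((1 + 1 / \<theta>) * (K\<^sup>2 * F2 * (inverse R)\<^sup>2 + \<delta>)))"
      using \<theta> A \<delta> F2 N1
      by (simp only: ennreal_plus ennreal_mult add_nonneg_nonneg mult_nonneg_nonneg zero_le_power2 less_imp_le zero_le_one divide_nonneg_nonneg)
    also have "\<dots> \<le> ennreal (A + \<epsilon>)"
    proof (rule ennreal_leI)
      have "(1 + \<theta>) * (A + N * \<delta>) + N * ((1 + 1 / \<theta>) * (K\<^sup>2 * F2 * (inverse R)\<^sup>2 + \<delta>))
        = A + \<theta> * A + (1 + 1 / \<theta>) * N * K\<^sup>2 * F2 * (inverse R)\<^sup>2 + ((1 + \<theta>) * (N * \<delta>) + (1 + 1 / \<theta>) * (N * \<delta>))"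
        by (simp add: algebra_simps)
      also have "\<dots> \<le> A + \<epsilon> / 4 + \<epsilon> / 4 + \<epsilon> / 4"
        using \<theta>A n(2) unfolding \<delta>_eq R_def by linarith
      finally show "(1 + \<theta>) * (A + N * \<delta>) + N * ((1 + 1 / \<theta>) * (K\<^sup>2 * F2 * (inverse R)\<^sup>2 + \<delta>)) \<le> A + \<epsilon>"
        using \<epsilon> by linarith
    qed
    also have "ennreal (A + \<epsilon>) = ennreal A + ennreal \<epsilon>"
      using A(2) \<epsilon> by (intro ennreal_plus) auto
    finally show "(\<integral>\<^sup>+x. ennreal ((norm (Du x))\<^sup>2) \<partial>?\<gamma>) \<le> (\<integral>\<^sup>+x. ennreal ((norm (G x))\<^sup>2) \<partial>?\<gamma>) + ennreal \<epsilon>"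
      unfolding A(1) .
  qed
qed


text \<open>\<open>norm (u x, a)\<close> is \<open>sqrt (|u x|\<^sup>2 + a\<^sup>2)\<close>, a smooth substitute for \<open>|u|\<close> that is bounded away from zero.\<close>

lemma log_sobolev_class_sqrt:
  fixes u :: "real^'n \<Rightarrow> complex" and Du :: "real^'n \<Rightarrow> complex^'n"
  assumes u: "bounded_lipschitz u" and Du: "\<And>j. bounded_lipschitz (\<lambda>x. Du x $ j)"
    and deriv: "\<And>x. (u has_derivative (\<lambda>v. \<Sum>j\<in>UNIV. (v $ j) *\<^sub>R (Du x $ j))) (at x)" and a: "a > 0"
  obtains D b L where "log_sobolev_class (\<lambda>x. norm (u x, a)) D a b L" "\<And>x. norm (D x) \<le> norm (Du x)"
proof -
  define g where "g x = norm (u x, a)" for x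
  define D where "D x = (vec_lambda (\<lambda>j. (u x \<bullet> (Du x $ j)) * inverse (g x)) :: real^'n)" for x
  obtain B where B: "B \<ge> 0" "\<And>x. norm (u x) \<le> B" "\<And>x y. norm (u x - u y) \<le> B * norm (x - y)"
    using bounded_lipschitzE[OF u] by blast
  have g_ge: "a \<le> g x" "norm (u x) \<le> g x" for x
    using a real_sqrt_le_mono[of "a\<^sup>2" "(norm (u x))\<^sup>2 + a\<^sup>2"] real_sqrt_le_mono[of "(norm (u x))\<^sup>2" "(norm (u x))\<^sup>2 + a\<^sup>2"]
    by (simp_all add: g_def norm_Pair)
  have g_pos: "g x > 0" for x using g_ge(1)[of x] a by linarith
  have g_le: "g x \<le> B + a" for x
    using sqrt_sum_squares_le_sum[of "norm (u x)" a] B(2)[of x] a by (simp add: g_def norm_Pair)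
  have g_lip: "\<bar>g x - g y\<bar> \<le> B * norm (x - y)" for x y
  proof -
    have "\<bar>g x - g y\<bar> \<le> norm ((u x, a) - (u y, a))" unfolding g_def by (rule norm_triangle_ineq3)
    also have "\<dots> = norm (u x - u y)" by (simp add: norm_Pair)
    finally show ?thesis using B(3)[of x y] by linarith
  qed
  have bl_inv: "bounded_lipschitz (\<lambda>x. inverse (g x))"
  proof (rule bounded_lipschitzI)
    show "norm (inverse (g x)) \<le> inverse a" for x using g_ge(1)[of x] g_pos[of x] a by simp
    show "norm (inverse (g x) - inverse (g y)) \<le> B / (a * a) * norm (x - y)" for x y
    proof -
      have "norm (inverse (g x) - inverse (g y)) = \<bar>g x - g y\<bar> / (g x * g y)"
        using g_pos[of x] g_pos[of y] by (simp add: inverse_eq_divide diff_frac_eq abs_div abs_minus_commute)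
      also have "\<dots> \<le> (B * norm (x - y)) / (a * a)"
        using g_lip[of x y] g_ge(1)[of x] g_ge(1)[of y] a by (intro frac_le mult_mono) auto
      finally show ?thesis by simp
    qed
  qed
  have Dj: "bounded_lipschitz (\<lambda>x. D x $ j)" for j
    unfolding D_def vec_lambda_beta
    by (intro bounded_lipschitz_bilinear[OF bounded_bilinear_mult] bounded_lipschitz_bilinear[OF bounded_bilinear_inner] u Du bl_inv)
  then have "\<exists>B\<ge>0. (\<forall>x. norm (D x $ j) \<le> B) \<and> (\<forall>x y. norm (D x $ j - D y $ j) \<le> B * norm (x - y))" for j
    by (metis bounded_lipschitzE)
  then obtain \<beta> where \<beta>: "\<And>j. \<beta> j \<ge> 0" "\<And>j x. norm (D x $ j) \<le> \<beta> j" "\<And>j x y. norm (D x $ j - D y $ j) \<le> \<beta> j * norm (x - y)"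
    by metis
  \<comment> \<open>The diamagnetic inequality: passing to the modulus does not increase the
    gradient, since |u| \<le> g.\<close>
  have D_le: "norm (D x) \<le> norm (Du x)" for x
  proof -
    have "\<bar>D x $ j\<bar> \<le> norm (Du x $ j)" for j
    proof -
      have "\<bar>D x $ j\<bar> = \<bar>u x \<bullet> (Du x $ j)\<bar> / g x" using g_pos[of x] by (simp add: D_def abs_mult divide_inverse)
      also have "\<dots> \<le> (norm (u x) * norm (Du x $ j)) / g x"
        using g_pos[of x] by (intro divide_right_mono Cauchy_Schwarz_ineq2) auto
      also have "\<dots> \<le> (g x * norm (Du x $ j)) / g x"
        using g_pos[of x] g_ge(2)[of x] by (intro divide_right_mono mult_right_mono) auto
      finally show ?thesis using g_pos[of x] by simp
    qed
    then have "(norm (D x))\<^sup>2 \<le> (norm (Du x))\<^sup>2"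
      unfolding norm_vec_square by (intro sum_mono power_mono) auto
    then show ?thesis by (rule power2_le_imp_le) simp
  qed
  have "log_sobolev_class g D a (B + a) (\<Sum>j\<in>UNIV. \<beta> j)"
  proof
    show "0 < a" "\<And>x. a \<le> g x" "\<And>x. g x \<le> B + a" using a g_ge g_le by auto
    show "norm (D x) \<le> (\<Sum>j\<in>UNIV. \<beta> j)" for x
      using norm_le_l1_cart[of "D x"] sum_mono[of UNIV "\<lambda>j. \<bar>D x $ j\<bar>" \<beta>] \<beta>(2) by auto
    show "norm (D x - D y) \<le> (\<Sum>j\<in>UNIV. \<beta> j) * norm (x - y)" for x y
    proof -
      have "norm (D x - D y) \<le> (\<Sum>j\<in>UNIV. \<bar>D x $ j - D y $ j\<bar>)" using norm_le_l1_cart[of "D x - D y"] by simp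
      also have "\<dots> \<le> (\<Sum>j\<in>UNIV. \<beta> j * norm (x - y))" using \<beta>(3) by (intro sum_mono) auto
      finally show ?thesis by (simp add: sum_distrib_right)
    qed
    show "(g has_derivative (\<lambda>v. D x \<bullet> v)) (at x)" for x
    proof -
      let ?u' = "\<lambda>v. \<Sum>j\<in>UNIV. (v $ j) *\<^sub>R (Du x $ j)"
      have pos: "u x \<bullet> u x + a\<^sup>2 > 0" using a by (simp add: add_nonneg_pos)
      have "((\<lambda>x. sqrt (u x \<bullet> u x + a\<^sup>2)) has_derivative
          (\<lambda>v. (u x \<bullet> ?u' v + ?u' v \<bullet> u x) * (inverse (sqrt (u x \<bullet> u x + a\<^sup>2)) / 2))) (at x)"
        by (rule derivative_eq_intros deriv pos refl)+ simp
      moreover have g_eq: "g = (\<lambda>x. sqrt (u x \<bullet> u x + a\<^sup>2))"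
        by (simp add: g_def norm_Pair power2_norm_eq_inner fun_eq_iff)
      moreover have "(u x \<bullet> ?u' v + ?u' v \<bullet> u x) * (inverse (g x) / 2) = D x \<bullet> v" for v
      proof -
        have "(u x \<bullet> ?u' v + ?u' v \<bullet> u x) * (inverse (g x) / 2) = (u x \<bullet> ?u' v) * inverse (g x)"
          by (simp add: inner_commute)
        also have "\<dots> = (\<Sum>j\<in>UNIV. (v $ j) * (u x \<bullet> (Du x $ j)) * inverse (g x))"
          by (simp add: inner_sum_right sum_distrib_right)
        also have "\<dots> = D x \<bullet> v" by (simp add: D_def inner_vec_def mult_ac)
        finally show ?thesis .
      qed
      ultimately show ?thesis by simp
    qed
  qed
  then show ?thesis using that D_le unfolding g_def by blast
qed

text \<open>Closeness is measured between the squares in L^2, which is the form the entropy argument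
  consumes; the fourth-power estimate for u - f provides it because | |u|^2 - |f|^2 | is at most d
  (d + 2 |f|) with d = |u - f|.\<close>

lemma log_sobolev_class_approximation:
  fixes f :: "real^'n \<Rightarrow> complex" and G :: "real^'n \<Rightarrow> complex^'n"
  assumes fm [measurable]: "f \<in> borel_measurable borel" and G: "has_weak_gradient f G"
    and f4: "(\<integral>\<^sup>+x. ennreal (norm (f x) ^ 4) \<partial>gauss_measure) < \<infinity>"
    and G2: "(\<integral>\<^sup>+x. ennreal ((norm (G x))\<^sup>2) \<partial>gauss_measure) < \<infinity>"
    and \<epsilon>: "\<epsilon> > 0"
  obtains g D a b L where "log_sobolev_class g D a b L"
    "(\<integral>\<^sup>+x. ennreal (((g x)\<^sup>2 - (norm (f x))\<^sup>2)\<^sup>2) \<partial>gauss_measure) \<le> ennreal \<epsilon>"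
    "(\<integral>\<^sup>+x. ennreal ((norm (D x))\<^sup>2) \<partial>gauss_measure)
       \<le> (\<integral>\<^sup>+x. ennreal ((norm (G x))\<^sup>2) \<partial>gauss_measure) + ennreal \<epsilon>"
proof -
  let ?\<gamma> = "gauss_measure :: (real^'n) measure"
  define F where "F = enn2real (\<integral>\<^sup>+x. ennreal (norm (f x) ^ 4) \<partial>?\<gamma>)"
  have F: "(\<integral>\<^sup>+x. ennreal (norm (f x) ^ 4) \<partial>?\<gamma>) = ennreal F" "F \<ge> 0" using f4 by (auto simp: F_def less_top)
  have cancel: "x / y * y = x" if "y > 0" for x y :: real using that by simp
  \<comment> \<open>t weighs the mixed term d^2 |f|^2 \<le> d^4 / t + t |f|^4, up to a factor. It is
    fixed first, so that the part with |f|^4 costs at most \<epsilon> / 4; then \<delta> beats the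
    resulting coefficient k of d^4.\<close>
  define t where "t = \<epsilon> / 32 / (F + 1)"
  have t: "t > 0" using \<epsilon> F by (simp add: t_def)
  define k where "k = 4 + 8 / t"
  have k: "k > 0" using t by (simp add: k_def add_pos_pos)
  define \<delta> where "\<delta> = min \<epsilon> (\<epsilon> / 4 / k)"
  have \<delta>: "\<delta> > 0" "\<delta> \<le> \<epsilon>" using \<epsilon> k by (auto simp: \<delta>_def)
  have k\<delta>: "k * \<delta> \<le> \<epsilon> / 4"
  proof -
    have "k * \<delta> \<le> k * (\<epsilon> / 4 / k)" using k by (intro mult_left_mono) (auto simp: \<delta>_def)
    also have "\<dots> = \<epsilon> / 4" using cancel[OF k] by (simp only: mult.commute)
    finally show ?thesis .
  qed
  have tF: "8 * t * F \<le> \<epsilon> / 4"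
  proof -
    have "8 * t * F \<le> 8 * (t * (F + 1))" using t by simp
    also have "t * (F + 1) = \<epsilon> / 32" unfolding t_def using F by (intro cancel) simp
    finally show ?thesis by simp
  qed
  define a where "a = min 1 (\<epsilon> / 8)"
  have a: "a > 0" "2 * a ^ 4 \<le> \<epsilon> / 4"
  proof -
    show "a > 0" using \<epsilon> by (simp add: a_def)
    have "a ^ 4 \<le> a ^ 1" using \<open>a > 0\<close> by (intro power_decreasing) (auto simp: a_def)
    then show "2 * a ^ 4 \<le> \<epsilon> / 4" by (simp add: a_def min_def split: if_splits)
  qed
  obtain u and Du :: "real^'n \<Rightarrow> complex^'n" where u: "bounded_lipschitz u" and Du: "\<And>j. bounded_lipschitz (\<lambda>x. Du x $ j)"
    and deriv: "\<And>x. (u has_derivative (\<lambda>v. \<Sum>j\<in>UNIV. (v $ j) *\<^sub>R (Du x $ j))) (at x)"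
    and est1: "(\<integral>\<^sup>+x. ennreal (norm (u x - f x) ^ 4) \<partial>?\<gamma>) \<le> ennreal \<delta>"
    and est2: "(\<integral>\<^sup>+x. ennreal ((norm (Du x))\<^sup>2) \<partial>?\<gamma>) \<le> (\<integral>\<^sup>+x. ennreal ((norm (G x))\<^sup>2) \<partial>?\<gamma>) + ennreal \<delta>"
    by (rule smooth_approximation[OF fm G f4 G2 \<delta>(1)]) (rule that)
  obtain D b L where cls: "log_sobolev_class (\<lambda>x. norm (u x, a)) D a b L" and D: "\<And>x. norm (D x) \<le> norm (Du x)"
    by (rule log_sobolev_class_sqrt[OF u Du deriv a(1)]) (rule that)
  have [measurable]: "u \<in> borel_measurable borel"
    by (intro borel_measurable_continuous_onI bounded_lipschitz_continuous u)
  have pt: "((norm (u x, a))\<^sup>2 - (norm (f x))\<^sup>2)\<^sup>2 \<le> k * norm (u x - f x) ^ 4 + 8 * t * norm (f x) ^ 4 + 2 * a ^ 4" for x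
  proof -
    define d where "d = norm (u x - f x)"
    define n where "n = norm (f x)"
    have dn: "d \<ge> 0" "n \<ge> 0" by (auto simp: d_def n_def)
    have b1: "\<bar>norm (u x) - n\<bar> \<le> d" unfolding d_def n_def by (rule norm_triangle_ineq3)
    have "\<bar>(norm (u x))\<^sup>2 - n\<^sup>2\<bar> = \<bar>norm (u x) - n\<bar> * (norm (u x) + n)"
      using dn by (simp add: power2_eq_square square_diff_square_factored abs_mult mult.commute)
    also have "\<dots> \<le> d * (d + 2 * n)" using b1 dn by (intro mult_mono) auto
    finally have "((norm (u x))\<^sup>2 - n\<^sup>2)\<^sup>2 \<le> (d * (d + 2 * n))\<^sup>2"
      using power_mono[of "\<bar>(norm (u x))\<^sup>2 - n\<^sup>2\<bar>" _ 2] by simp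
    also have "\<dots> \<le> d\<^sup>2 * (2 * d\<^sup>2 + 8 * n\<^sup>2)"
      using sum_squares_bound[of d "2 * n"] by (simp add: power_mult_distrib power2_sum mult_left_mono)
    also have "\<dots> \<le> 2 * d ^ 4 + 4 * (d ^ 4 / t + t * n ^ 4)"
    proof -
      have "0 \<le> (d\<^sup>2 / sqrt t - sqrt t * n\<^sup>2)\<^sup>2" by simp
      also have "\<dots> = d ^ 4 / t + t * n ^ 4 - 2 * (d\<^sup>2 * n\<^sup>2)"
        using t by (simp add: power2_diff power_divide power_mult_distrib flip: power_mult)
      finally show ?thesis by (simp add: algebra_simps flip: power_add)
    qed
    finally have b2: "((norm (u x))\<^sup>2 - n\<^sup>2)\<^sup>2 \<le> 2 * d ^ 4 + 4 * (d ^ 4 / t + t * n ^ 4)" .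
    define y where "y = (norm (u x))\<^sup>2 - n\<^sup>2"
    have eq: "(norm (u x, a))\<^sup>2 - n\<^sup>2 = y + a\<^sup>2" by (simp add: norm_Pair y_def)
    have "(y + a\<^sup>2)\<^sup>2 \<le> 2 * y\<^sup>2 + 2 * a ^ 4"
      using sum_squares_bound[of y "a\<^sup>2"] by (simp add: power2_sum flip: power_mult)
    then have "((norm (u x, a))\<^sup>2 - n\<^sup>2)\<^sup>2 \<le> 2 * (2 * d ^ 4 + 4 * (d ^ 4 / t + t * n ^ 4)) + 2 * a ^ 4"
      unfolding eq using b2[folded y_def]
      by (meson add_right_mono mult_left_mono order_trans zero_le_numeral)
    also have "\<dots> = k * d ^ 4 + 8 * t * n ^ 4 + 2 * a ^ 4" by (simp add: k_def algebra_simps)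
    finally show ?thesis by (simp add: d_def n_def)
  qed
  show ?thesis
  proof (rule that[OF cls])
    have "(\<integral>\<^sup>+x. ennreal (((norm (u x, a))\<^sup>2 - (norm (f x))\<^sup>2)\<^sup>2) \<partial>?\<gamma>)
      \<le> (\<integral>\<^sup>+x. ennreal k * ennreal (norm (u x - f x) ^ 4) + ennreal (8 * t) * ennreal (norm (f x) ^ 4) + ennreal (2 * a ^ 4) \<partial>?\<gamma>)"
    proof (intro nn_integral_mono)
      fix x
      have "ennreal (((norm (u x, a))\<^sup>2 - (norm (f x))\<^sup>2)\<^sup>2) \<le> ennreal (k * norm (u x - f x) ^ 4 + 8 * t * norm (f x) ^ 4 + 2 * a ^ 4)"
        by (rule ennreal_leI[OF pt])
      also have "\<dots> = ennreal k * ennreal (norm (u x - f x) ^ 4) + ennreal (8 * t) * ennreal (norm (f x) ^ 4) + ennreal (2 * a ^ 4)"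
        using k t a by (simp add: ennreal_mult)
      finally show "ennreal (((norm (u x, a))\<^sup>2 - (norm (f x))\<^sup>2)\<^sup>2) \<le> \<dots>" .
    qed
    also have "\<dots> = ennreal k * (\<integral>\<^sup>+x. ennreal (norm (u x - f x) ^ 4) \<partial>?\<gamma>) + ennreal (8 * t) * ennreal F + ennreal (2 * a ^ 4)"
      by (simp add: nn_integral_add nn_integral_cmult F(1) del: ennreal_plus)
    also have "\<dots> \<le> ennreal k * ennreal \<delta> + ennreal (8 * t) * ennreal F + ennreal (2 * a ^ 4)"
      by (intro add_right_mono mult_left_mono est1) simp
    also have "\<dots> = ennreal (k * \<delta> + 8 * t * F + 2 * a ^ 4)"
      using k t a F \<delta> by (simp add: ennreal_mult)
    also have "\<dots> \<le> ennreal \<epsilon>" using k\<delta> tF a(2) \<epsilon> by (intro ennreal_leI) linarith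
    finally show "(\<integral>\<^sup>+x. ennreal (((norm (u x, a))\<^sup>2 - (norm (f x))\<^sup>2)\<^sup>2) \<partial>?\<gamma>) \<le> ennreal \<epsilon>" .
    have "(\<integral>\<^sup>+x. ennreal ((norm (D x))\<^sup>2) \<partial>?\<gamma>) \<le> (\<integral>\<^sup>+x. ennreal ((norm (Du x))\<^sup>2) \<partial>?\<gamma>)"
      using D by (intro nn_integral_mono ennreal_leI power_mono) auto
    also note est2
    also have "(\<integral>\<^sup>+x. ennreal ((norm (G x))\<^sup>2) \<partial>?\<gamma>) + ennreal \<delta> \<le> (\<integral>\<^sup>+x. ennreal ((norm (G x))\<^sup>2) \<partial>?\<gamma>) + ennreal \<epsilon>"
      using \<delta> by (intro add_left_mono ennreal_leI) auto
    finally show "(\<integral>\<^sup>+x. ennreal ((norm (D x))\<^sup>2) \<partial>?\<gamma>) \<le> (\<integral>\<^sup>+x. ennreal ((norm (G x))\<^sup>2) \<partial>?\<gamma>) + ennreal \<epsilon>" .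
  qed
qed

lemma integrable_mult_square:
  fixes u v :: "'a \<Rightarrow> real"
  assumes [measurable]: "u \<in> borel_measurable M" "v \<in> borel_measurable M"
    and "integrable M (\<lambda>x. (u x)\<^sup>2)" "integrable M (\<lambda>x. (v x)\<^sup>2)"
  shows "integrable M (\<lambda>x. u x * v x)"
proof (rule Bochner_Integration.integrable_bound)
  show "integrable M (\<lambda>x. (u x)\<^sup>2 + (v x)\<^sup>2)" using assms(3,4) by (rule Bochner_Integration.integrable_add)
  have "\<bar>p * q\<bar> \<le> p\<^sup>2 + q\<^sup>2" for p q :: real
    using sum_squares_bound[of p q] sum_squares_bound[of p "- q"] by (auto simp: abs_le_iff)
  then show "AE x in M. norm (u x * v x) \<le> norm ((u x)\<^sup>2 + (v x)\<^sup>2)" by auto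
qed measurable


subsection \<open>Stability\<close>

lemma mult_ln_bounds:
  fixes t :: real
  assumes "t \<ge> 0"
  shows "- 1 \<le> t * ln t" "t * ln t \<le> t\<^sup>2"
proof -
  show "- 1 \<le> t * ln t"
    using gibbs_pointwise[of t 1] assms by (cases "t = 0") auto
  have "t * ln t \<le> t * t"
    using assms ln_le_minus_one[of t] by (cases "t = 0") (auto intro!: mult_left_mono)
  then show "t * ln t \<le> t\<^sup>2" by (simp add: power2_eq_square)
qed

lemma (in finite_measure) integrable_mult_ln:
  fixes h :: "'a \<Rightarrow> real"
  assumes [measurable]: "h \<in> borel_measurable M" and h2: "integrable M (\<lambda>x. (h x)\<^sup>2)" and h0: "\<And>x. 0 \<le> h x"
  shows "integrable M (\<lambda>x. h x * ln (h x))"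
proof (rule Bochner_Integration.integrable_bound)
  show "integrable M (\<lambda>x. 1 + (h x)\<^sup>2)" using h2 by auto
  show "AE x in M. norm (h x * ln (h x)) \<le> norm (1 + (h x)\<^sup>2)"
  proof (intro AE_I2)
    fix x
    have "\<bar>h x * ln (h x)\<bar> \<le> 1 + (h x)\<^sup>2"
      using mult_ln_bounds[OF h0[of x]] zero_le_power2[of "h x"] by linarith
    then show "norm (h x * ln (h x)) \<le> norm (1 + (h x)\<^sup>2)" by simp
  qed
qed measurable

lemma square_ln_add_le:
  fixes t \<delta> :: real
  assumes "t \<ge> 0" "0 < \<delta>" "\<delta> \<le> 1"
  shows "(ln (t + \<delta>))\<^sup>2 \<le> 2 * (ln \<delta>)\<^sup>2 + 2 * t\<^sup>2"
proof -
  have "ln \<delta> \<le> ln (t + \<delta>)" using assms by simp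
  moreover have "ln (t + \<delta>) \<le> t" using assms ln_le_minus_one[of "t + \<delta>"] by simp
  ultimately have "\<bar>ln (t + \<delta>)\<bar> \<le> \<bar>ln \<delta>\<bar> + t" using assms by linarith
  then have "(ln (t + \<delta>))\<^sup>2 \<le> (\<bar>ln \<delta>\<bar> + t)\<^sup>2" using power_mono[of "\<bar>ln (t + \<delta>)\<bar>" _ 2] by simp
  also have "\<dots> \<le> 2 * (ln \<delta>)\<^sup>2 + 2 * t\<^sup>2"
    using sum_squares_bound[of "\<bar>ln \<delta>\<bar>" t] by (simp add: power2_sum)
  finally show ?thesis .
qed

lemma integral_le_of_nn_integral_le:
  fixes f :: "'a \<Rightarrow> real"
  assumes "f \<in> borel_measurable M" "\<And>x. 0 \<le> f x" "(\<integral>\<^sup>+x. ennreal (f x) \<partial>M) \<le> ennreal c" "0 \<le> c"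
  shows "integrable M f" "(LINT x|M. f x) \<le> c"
proof -
  have "(\<integral>\<^sup>+x. ennreal (f x) \<partial>M) < \<infinity>" using assms(3) by (rule le_less_trans) simp
  then show i: "integrable M f" using assms(1,2) by (intro integrableI_nonneg) auto
  have "ennreal (LINT x|M. f x) \<le> ennreal c" using assms(3) nn_integral_eq_integral[OF i] assms(2) by simp
  then show "(LINT x|M. f x) \<le> c" using assms(4) by simp
qed

text \<open>An approximant \<open>q\<close> of \<open>h\<close> is compared with \<open>h\<close> through the weight \<open>l = ln (h + \<delta>)\<close>, which is square
  integrable: Gibbs' inequality bounds \<open>\<integral> q l\<close> by the entropy of \<open>q\<close>, so the entropies of the approximants
  need not converge.\<close>

lemma entropy_le_weak:
  fixes f :: "real^'n \<Rightarrow> complex" and G :: "real^'n \<Rightarrow> complex^'n"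
  defines "h \<equiv> \<lambda>x. (norm (f x))\<^sup>2"
  assumes fm [measurable]: "f \<in> borel_measurable borel" and G: "has_weak_gradient f G"
    and hI: "(LINT x|gauss_measure. h x) = 1" and h2: "integrable gauss_measure (\<lambda>x. (h x)\<^sup>2)"
    and G2: "(\<integral>\<^sup>+x. ennreal ((norm (G x))\<^sup>2) \<partial>gauss_measure) = ennreal A" "A \<ge> 0"
    and \<sigma>: "\<sigma> > 0" "\<rho>\<^sup>2 + \<sigma>\<^sup>2 = 1"
    and B: "(\<integral>\<^sup>+y. ennreal ((noise \<rho> \<sigma> h y - 1)\<^sup>2) \<partial>gauss_measure) \<le> ennreal B" "B \<ge> 0"
  shows "(LINT x|gauss_measure. h x * ln (h x)) \<le> 2 * B + \<sigma>\<^sup>2 / (2 * pi) * A"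
proof (rule field_le_epsilon)
  let ?\<gamma> = "gauss_measure :: (real^'n) measure"
  fix \<tau> :: real assume \<tau>: "\<tau> > 0"
  have hm [measurable]: "h \<in> borel_measurable borel" unfolding h_def by measurable
  have h0: "h x \<ge> 0" for x by (simp add: h_def)
  have h1: "integrable ?\<gamma> h"
    using gauss.square_integrable_imp_integrable[of h] h2 by simp
  \<comment> \<open>\<delta> keeps the logarithm finite where f vanishes; its price in the final sum
    is \<delta> itself, through Gibbs' inequality against h + \<delta>.\<close>
  define \<delta> where "\<delta> = min 1 (\<tau> / 4)"
  have \<delta>: "0 < \<delta>" "\<delta> \<le> 1" "\<delta> \<le> \<tau> / 4" using \<tau> by (auto simp: \<delta>_def)
  define l where "l x = ln (h x + \<delta>)" for x
  have lm [measurable]: "l \<in> borel_measurable borel" unfolding l_def by measurable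
  have l2: "integrable ?\<gamma> (\<lambda>x. (l x)\<^sup>2)"
  proof (rule Bochner_Integration.integrable_bound)
    show "integrable ?\<gamma> (\<lambda>x. 2 * (ln \<delta>)\<^sup>2 + 2 * (h x)\<^sup>2)" using h2 by auto
    show "AE x in ?\<gamma>. norm ((l x)\<^sup>2) \<le> norm (2 * (ln \<delta>)\<^sup>2 + 2 * (h x)\<^sup>2)"
      using square_ln_add_le[OF h0 \<delta>(1,2)] by (auto simp: l_def)
  qed measurable
  define W where "W = (LINT x|?\<gamma>. (l x)\<^sup>2)"
  have W: "W \<ge> 0" by (simp add: W_def)
  have cancel: "x / y * y = x" if "y > 0" for x y :: real using that by simp
  \<comment> \<open>s is the weight in p r \<le> p^2 / s + s r^2 for p = h - q and r = l. As W
    depends on \<delta>, it is chosen after \<delta> and before the accuracy of the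
    approximation.\<close>
  define s where "s = \<tau> / 4 / (W + 1)"
  have s: "s > 0" using \<tau> W by (simp add: s_def)
  have sW: "s * W \<le> \<tau> / 4"
  proof -
    have "s * W \<le> s * (W + 1)" using s by simp
    also have "\<dots> = \<tau> / 4" unfolding s_def using W by (intro cancel) simp
    finally show ?thesis .
  qed
  \<comment> \<open>k collects the coefficients of \<epsilon> in the final sum: 1 / s from the
    weighted product, 2 from the noise and the last one from the energy.\<close>
  define k where "k = 1 / s + 2 + \<sigma>\<^sup>2 / (2 * pi)"
  have k: "k > 0" using s by (simp add: k_def add_pos_nonneg add_nonneg_pos)
  define \<epsilon> where "\<epsilon> = \<tau> / 4 / k"
  have \<epsilon>: "\<epsilon> > 0" "k * \<epsilon> = \<tau> / 4" using \<tau> k by (auto simp: \<epsilon>_def)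
  have f4: "(\<integral>\<^sup>+x. ennreal (norm (f x) ^ 4) \<partial>?\<gamma>) < \<infinity>"
    using integrableD(2)[OF h2] by (simp add: h_def less_top[symmetric] flip: power_mult)
  obtain g D a b L where cls: "log_sobolev_class g D a b L"
    and est1: "(\<integral>\<^sup>+x. ennreal (((g x)\<^sup>2 - (norm (f x))\<^sup>2)\<^sup>2) \<partial>?\<gamma>) \<le> ennreal \<epsilon>"
    and est2: "(\<integral>\<^sup>+x. ennreal ((norm (D x))\<^sup>2) \<partial>?\<gamma>) \<le> (\<integral>\<^sup>+x. ennreal ((norm (G x))\<^sup>2) \<partial>?\<gamma>) + ennreal \<epsilon>"
  proof (rule log_sobolev_class_approximation[OF fm G f4 _ \<epsilon>(1)])
    show "(\<integral>\<^sup>+x. ennreal ((norm (G x))\<^sup>2) \<partial>?\<gamma>) < \<infinity>" using G2 by simp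
  qed (rule that)
  interpret cls: log_sobolev_class g D a b L by (rule cls)
  define q where "q x = (g x)\<^sup>2" for x
  have qm [measurable]: "q \<in> borel_measurable borel" unfolding q_def by measurable
  have qb: "a\<^sup>2 \<le> q x" "q x \<le> b\<^sup>2" for x unfolding q_def by (rule cls.g2_bounds)+
  have q0: "q x > 0" for x using qb(1)[of x] cls.g2_bounds(1) by linarith
  have q1: "integrable ?\<gamma> q" by (rule gauss.integral_in_interval(1)[OF _ qb]) measurable
  have qlnq: "integrable ?\<gamma> (\<lambda>x. q x * ln (q x))"
    by (rule gauss.abs_entropy_of_le(1)[OF _ cls.g2_bounds(1) qb]) measurable
  have q2: "integrable ?\<gamma> (\<lambda>x. (q x)\<^sup>2)"
  proof (rule gauss.integral_in_interval(1)[of _ 0 "(b\<^sup>2)\<^sup>2"])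
    show "(q x)\<^sup>2 \<le> (b\<^sup>2)\<^sup>2" for x using qb(2)[of x] q0[of x] by (intro power_mono) auto
  qed auto
  have d2: "integrable ?\<gamma> (\<lambda>x. (h x - q x)\<^sup>2)" "(LINT x|?\<gamma>. (h x - q x)\<^sup>2) \<le> \<epsilon>"
  proof -
    have e: "(\<integral>\<^sup>+x. ennreal ((h x - q x)\<^sup>2) \<partial>?\<gamma>) \<le> ennreal \<epsilon>"
      using est1 by (simp add: h_def q_def power2_commute)
    show "integrable ?\<gamma> (\<lambda>x. (h x - q x)\<^sup>2)" "(LINT x|?\<gamma>. (h x - q x)\<^sup>2) \<le> \<epsilon>"
      by (rule integral_le_of_nn_integral_le[OF _ _ e]; use \<epsilon> in simp)+
  qed
  have ql: "integrable ?\<gamma> (\<lambda>x. q x * l x)" by (rule integrable_mult_square[OF _ _ q2 l2]) measurable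
  have hl: "integrable ?\<gamma> (\<lambda>x. h x * l x)" by (rule integrable_mult_square[OF _ _ h2 l2]) measurable
  have hlnh: "integrable ?\<gamma> (\<lambda>x. h x * ln (h x))"
    by (rule gauss.integrable_mult_ln[OF _ h2 h0]) simp
  have 1: "(LINT x|?\<gamma>. h x * ln (h x)) \<le> (LINT x|?\<gamma>. h x * l x)"
  proof (rule integral_mono[OF hlnh hl])
    fix x show "h x * ln (h x) \<le> h x * l x"
      using h0[of x] \<delta> unfolding l_def by (cases "h x = 0") (auto intro!: mult_left_mono)
  qed
  have 2: "(LINT x|?\<gamma>. h x * l x) - (LINT x|?\<gamma>. q x * l x) \<le> \<epsilon> / s + s * W"
  proof -
    have "(LINT x|?\<gamma>. h x * l x) - (LINT x|?\<gamma>. q x * l x) = (LINT x|?\<gamma>. (h x - q x) * l x)"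
      using hl ql by (simp add: left_diff_distrib)
    also have "\<dots> \<le> (LINT x|?\<gamma>. (h x - q x)\<^sup>2 / s + s * (l x)\<^sup>2)"
    proof (rule integral_mono)
      show "integrable ?\<gamma> (\<lambda>x. (h x - q x) * l x)" using hl ql by (simp add: left_diff_distrib)
      show "integrable ?\<gamma> (\<lambda>x. (h x - q x)\<^sup>2 / s + s * (l x)\<^sup>2)" using d2 l2 by auto
      fix x
      define p r where "p = h x - q x" and "r = l x"
      have "0 \<le> (p / sqrt s - sqrt s * r)\<^sup>2" by simp
      then have "2 * (p * r) \<le> p\<^sup>2 / s + s * r\<^sup>2"
        using s by (simp add: power2_diff power_divide power_mult_distrib)
      moreover have "0 \<le> p\<^sup>2 / s" "0 \<le> s * r\<^sup>2" using s by auto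
      ultimately have "p * r \<le> p\<^sup>2 / s + s * r\<^sup>2" by linarith
      then show "(h x - q x) * l x \<le> (h x - q x)\<^sup>2 / s + s * (l x)\<^sup>2" by (simp add: p_def r_def)
    qed
    also have "\<dots> = (LINT x|?\<gamma>. (h x - q x)\<^sup>2) / s + s * W" using d2 l2 by (simp add: W_def)
    also have "\<dots> \<le> \<epsilon> / s + s * W" using d2 s by (intro add_right_mono divide_right_mono) auto
    finally show ?thesis .
  qed
  have 3: "(LINT x|?\<gamma>. q x * l x) + (LINT x|?\<gamma>. q x) - (LINT x|?\<gamma>. h x) - \<delta> \<le> (LINT x|?\<gamma>. q x * ln (q x))"
  proof -
    have "(LINT x|?\<gamma>. q x * l x + q x - h x - \<delta>) \<le> (LINT x|?\<gamma>. q x * ln (q x))"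
    proof (rule integral_mono)
      fix x show "q x * l x + q x - h x - \<delta> \<le> q x * ln (q x)"
        using gibbs_pointwise[of "q x" "h x + \<delta>"] q0[of x] h0[of x] \<delta> by (simp add: l_def)
    qed (use ql q1 h1 qlnq in auto)
    then show ?thesis using ql q1 h1 by simp
  qed
  note [measurable] = borel_measurable_noise[OF hm] borel_measurable_noise[OF qm]
  have hq: "(\<lambda>x. q x - h x) \<in> borel_measurable borel" by measurable
  note [measurable] = borel_measurable_noise[OF hq]
  have 4: "(LINT y|?\<gamma>. (noise \<rho> \<sigma> q y - 1)\<^sup>2) \<le> 2 * \<epsilon> + 2 * B"
  proof -
    \<comment> \<open>\<open>noise\<close> is additive only where the shifted functions are
      integrable; for h this is known for almost every y, by rotation invariance.\<close>
    have fin: "AE y in ?\<gamma>. (\<integral>\<^sup>+z. ennreal ((h (\<rho> *\<^sub>R y + \<sigma> *\<^sub>R z))\<^sup>2) \<partial>?\<gamma>) \<noteq> \<infinity>"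
    proof (rule nn_integral_PInf_AE)
      have "(\<integral>\<^sup>+y. \<integral>\<^sup>+z. ennreal ((h (\<rho> *\<^sub>R y + \<sigma> *\<^sub>R z))\<^sup>2) \<partial>?\<gamma> \<partial>?\<gamma>) = (\<integral>\<^sup>+x. ennreal ((h x)\<^sup>2) \<partial>?\<gamma>)"
        by (rule nn_integral_gauss_rotation[OF \<sigma>]) measurable
      also have "\<dots> \<noteq> \<infinity>" using integrableD(2)[OF h2] by simp
      finally show "(\<integral>\<^sup>+y. \<integral>\<^sup>+z. ennreal ((h (\<rho> *\<^sub>R y + \<sigma> *\<^sub>R z))\<^sup>2) \<partial>?\<gamma> \<partial>?\<gamma>) \<noteq> \<infinity>" .
    qed measurable
    have pt: "AE y in ?\<gamma>. ennreal ((noise \<rho> \<sigma> q y - 1)\<^sup>2)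
        \<le> ennreal 2 * ennreal ((noise \<rho> \<sigma> (\<lambda>x. q x - h x) y)\<^sup>2) + ennreal 2 * ennreal ((noise \<rho> \<sigma> h y - 1)\<^sup>2)"
      using fin
    proof eventually_elim
      case (elim y)
      have lt: "(\<integral>\<^sup>+z. ennreal ((h (\<rho> *\<^sub>R y + \<sigma> *\<^sub>R z))\<^sup>2) \<partial>?\<gamma>) < \<infinity>"
        using elim unfolding infinity_ennreal_def top.not_eq_extremum .
      have "integrable ?\<gamma> (\<lambda>z. (h (\<rho> *\<^sub>R y + \<sigma> *\<^sub>R z))\<^sup>2)"
        by (rule integrableI_nonneg[OF _ _ lt]) simp_all
      then have ih: "integrable ?\<gamma> (\<lambda>z. h (\<rho> *\<^sub>R y + \<sigma> *\<^sub>R z))"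
        by (rule gauss.square_integrable_imp_integrable[rotated]) simp
      have iq: "integrable ?\<gamma> (\<lambda>z. q (\<rho> *\<^sub>R y + \<sigma> *\<^sub>R z))"
        by (rule gauss.integral_in_interval(1)[of _ "a\<^sup>2" "b\<^sup>2"]) (use qb in auto)
      define p r where "p = noise \<rho> \<sigma> (\<lambda>x. q x - h x) y" and "r = noise \<rho> \<sigma> h y - 1"
      have eq: "noise \<rho> \<sigma> q y - 1 = p + r"
        unfolding p_def r_def noise_def by (subst Bochner_Integration.integral_diff[OF iq ih]) simp
      \<comment> \<open>Origin of the factor 2 in front of B in the conclusion.\<close>
      have "(p + r)\<^sup>2 \<le> 2 * p\<^sup>2 + 2 * r\<^sup>2"
        using sum_squares_bound[of p r] by (simp add: power2_sum)
      then have "ennreal ((noise \<rho> \<sigma> q y - 1)\<^sup>2) \<le> ennreal (2 * p\<^sup>2 + 2 * r\<^sup>2)"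
        unfolding eq by (rule ennreal_leI)
      also have "\<dots> = ennreal 2 * ennreal (p\<^sup>2) + ennreal 2 * ennreal (r\<^sup>2)"
        by (simp add: ennreal_mult)
      finally show ?case unfolding p_def r_def .
    qed
    have "(\<integral>\<^sup>+y. ennreal ((noise \<rho> \<sigma> q y - 1)\<^sup>2) \<partial>?\<gamma>)
      \<le> (\<integral>\<^sup>+y. ennreal 2 * ennreal ((noise \<rho> \<sigma> (\<lambda>x. q x - h x) y)\<^sup>2) + ennreal 2 * ennreal ((noise \<rho> \<sigma> h y - 1)\<^sup>2) \<partial>?\<gamma>)"
      by (rule nn_integral_mono_AE[OF pt])
    also have "\<dots> = ennreal 2 * (\<integral>\<^sup>+y. ennreal ((noise \<rho> \<sigma> (\<lambda>x. q x - h x) y)\<^sup>2) \<partial>?\<gamma>) + ennreal 2 * (\<integral>\<^sup>+y. ennreal ((noise \<rho> \<sigma> h y - 1)\<^sup>2) \<partial>?\<gamma>)"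
      by (simp add: nn_integral_add nn_integral_cmult)
    also have "\<dots> \<le> ennreal 2 * ennreal \<epsilon> + ennreal 2 * ennreal B"
    proof (intro add_mono mult_left_mono B)
      have "(\<integral>\<^sup>+y. ennreal ((noise \<rho> \<sigma> (\<lambda>x. q x - h x) y)\<^sup>2) \<partial>?\<gamma>) \<le> (\<integral>\<^sup>+x. ennreal ((q x - h x)\<^sup>2) \<partial>?\<gamma>)"
        by (rule noise_contraction[OF \<sigma> hq])
      also have "\<dots> \<le> ennreal \<epsilon>" using est1 by (simp add: q_def h_def)
      finally show "(\<integral>\<^sup>+y. ennreal ((noise \<rho> \<sigma> (\<lambda>x. q x - h x) y)\<^sup>2) \<partial>?\<gamma>) \<le> ennreal \<epsilon>" .
    qed auto
    also have "\<dots> = ennreal (2 * \<epsilon> + 2 * B)" using \<epsilon> B by (simp add: ennreal_mult)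
    finally have e: "(\<integral>\<^sup>+y. ennreal ((noise \<rho> \<sigma> q y - 1)\<^sup>2) \<partial>?\<gamma>) \<le> ennreal (2 * \<epsilon> + 2 * B)" .
    show ?thesis by (rule integral_le_of_nn_integral_le[OF _ _ e]) (use \<epsilon> B in simp_all)
  qed
  have 5: "(LINT x|?\<gamma>. (norm (D x))\<^sup>2) \<le> A + \<epsilon>"
  proof -
    have "(\<integral>\<^sup>+x. ennreal ((norm (D x))\<^sup>2) \<partial>?\<gamma>) \<le> ennreal A + ennreal \<epsilon>"
      using est2 unfolding G2(1) .
    also have "\<dots> = ennreal (A + \<epsilon>)" using G2(2) \<epsilon>(1) by (intro ennreal_plus[symmetric]) auto
    finally show ?thesis by (rule integral_le_of_nn_integral_le(2)[rotated 2]) (use G2(2) \<epsilon>(1) in auto)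
  qed
  have 6: "(LINT x|?\<gamma>. q x * ln (q x)) \<le> (LINT y|?\<gamma>. (noise \<rho> \<sigma> q y - 1)\<^sup>2) + ((LINT x|?\<gamma>. q x) - 1)
      + \<sigma>\<^sup>2 / (2 * pi) * (LINT x|?\<gamma>. (norm (D x))\<^sup>2)"
    using cls.entropy_le_noise[OF \<sigma>] by (simp only: q_def[abs_def])
  have 7: "\<sigma>\<^sup>2 / (2 * pi) * (LINT x|?\<gamma>. (norm (D x))\<^sup>2) \<le> \<sigma>\<^sup>2 / (2 * pi) * (A + \<epsilon>)"
    by (rule mult_left_mono[OF 5]) simp
  \<comment> \<open>The mean of q occurs in \<open>3\<close> and in \<open>6\<close> and cancels, as
    h has mean 1; the approximant may therefore have any mean.\<close>
  have "(LINT x|?\<gamma>. h x * ln (h x)) \<le> \<epsilon> / s + s * W + \<delta> + 2 * \<epsilon> + 2 * B + \<sigma>\<^sup>2 / (2 * pi) * (A + \<epsilon>)"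
    using 1 2 3 4 6 7 hI by linarith
  also have "\<dots> = k * \<epsilon> + s * W + \<delta> + (2 * B + \<sigma>\<^sup>2 / (2 * pi) * A)" by (simp add: k_def algebra_simps add_divide_distrib)
  also have "\<dots> \<le> 2 * B + \<sigma>\<^sup>2 / (2 * pi) * A + \<tau>" using \<epsilon>(2) sW \<delta>(3) \<tau> by linarith
  finally show "(LINT x|?\<gamma>. h x * ln (h x)) \<le> 2 * B + \<sigma>\<^sup>2 / (2 * pi) * A + \<tau>" .
qed


section \<open>From the entropy bound to the energy\<close>

text \<open>Substituting \<sigma>^2 = 1 - \<rho>^2 in the entropy bound isolates \<rho>^2 times the
  energy. C and \<rho>_0 are fixed before f, so \<rho> can later be chosen uniformly along the
  sequence.\<close>

lemma energy_le_deficit: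
  fixes M :: real
  assumes M: "M \<ge> 0"
  obtains C \<rho>\<^sub>0 :: real where "C \<ge> 0" "0 < \<rho>\<^sub>0"
    "\<And>(f :: real^'n \<Rightarrow> complex) E \<rho>. f \<in> borel_measurable borel \<Longrightarrow> normalized f \<Longrightarrow> centered f \<Longrightarrow>
      (\<integral>\<^sup>+x. ennreal (cmod (f x) ^ 4) \<partial>gauss_measure) \<le> ennreal M \<Longrightarrow> dirichlet_energy f = ennreal E \<Longrightarrow> E \<ge> 0 \<Longrightarrow>
      0 < \<rho> \<Longrightarrow> \<rho> \<le> \<rho>\<^sub>0 \<Longrightarrow>
      \<rho>\<^sup>2 * (E / (2 * pi)) \<le> E / (2 * pi) - (LINT x|gauss_measure. (cmod (f x))\<^sup>2 * ln ((cmod (f x))\<^sup>2)) + C * \<rho> ^ 4"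
proof -
  let ?\<gamma> = "gauss_measure :: (real^'n) measure"
  obtain C \<rho>\<^sub>0 where C: "C \<ge> 0" and \<rho>\<^sub>0: "0 < \<rho>\<^sub>0" "\<rho>\<^sub>0 < 1" and
    bound: "\<And>(h :: real^'n \<Rightarrow> real) \<rho> \<sigma>. integrable ?\<gamma> h \<Longrightarrow> integrable ?\<gamma> (\<lambda>x. (h x)\<^sup>2) \<Longrightarrow>
       (LINT x|?\<gamma>. h x) = 1 \<Longrightarrow> integrable ?\<gamma> (\<lambda>x. h x *\<^sub>R x) \<Longrightarrow>
       (LINT x|?\<gamma>. h x *\<^sub>R x) = 0 \<Longrightarrow> 0 < \<rho> \<Longrightarrow> \<rho> \<le> \<rho>\<^sub>0 \<Longrightarrow> \<sigma> > 0 \<Longrightarrow> \<rho>\<^sup>2 + \<sigma>\<^sup>2 = 1 \<Longrightarrow>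
       (\<integral>\<^sup>+y. ennreal ((noise \<rho> \<sigma> h y - 1)\<^sup>2) \<partial>?\<gamma>) \<le> ennreal (C * \<rho> ^ 4 * (LINT x|?\<gamma>. (h x)\<^sup>2))"
    by (rule noise_centered_bound) (rule that)
  show ?thesis
  proof (rule that[of "2 * (C * M)" \<rho>\<^sub>0])
    fix f :: "real^'n \<Rightarrow> complex" and E \<rho> :: real
    assume fm [measurable]: "f \<in> borel_measurable borel" and norm: "normalized f" and cent: "centered f"
      and f4: "(\<integral>\<^sup>+x. ennreal (cmod (f x) ^ 4) \<partial>?\<gamma>) \<le> ennreal M" and E: "dirichlet_energy f = ennreal E" "E \<ge> 0"
      and \<rho>: "0 < \<rho>" "\<rho> \<le> \<rho>\<^sub>0"
    define h where "h x = (cmod (f x))\<^sup>2" for x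
    have hm [measurable]: "h \<in> borel_measurable borel" unfolding h_def by measurable
    have ex: "\<exists>G. has_weak_gradient f G"
      using E(1) unfolding dirichlet_energy_def by (auto split: if_splits)
    then have G: "has_weak_gradient f (weak_gradient f)" unfolding weak_gradient_def by (rule someI_ex)
    have GE: "(\<integral>\<^sup>+x. ennreal ((norm (weak_gradient f x))\<^sup>2) \<partial>?\<gamma>) = ennreal E"
      using E(1) ex unfolding dirichlet_energy_def by (simp only: if_True)
    have h2_le: "(\<integral>\<^sup>+x. ennreal ((h x)\<^sup>2) \<partial>?\<gamma>) \<le> ennreal M" using f4 by (simp add: h_def flip: power_mult)
    note h2 = integral_le_of_nn_integral_le[OF _ _ h2_le M, simplified]
    have "has_bochner_integral ?\<gamma> h 1"
      using norm by (intro has_bochner_integral_nn_integral) (auto simp: h_def normalized_def)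
    then have h1: "integrable ?\<gamma> h" "(LINT x|?\<gamma>. h x) = 1" by (auto simp: has_bochner_integral_iff)
    have hc: "integrable ?\<gamma> (\<lambda>x. h x *\<^sub>R x)" "(LINT x|?\<gamma>. h x *\<^sub>R x) = 0"
      using cent by (simp_all add: centered_def h_def)
    define \<sigma> where "\<sigma> = sqrt (1 - \<rho>\<^sup>2)"
    have "\<rho>\<^sup>2 < 1\<^sup>2" using \<rho> \<rho>\<^sub>0 by (intro power_strict_mono) auto
    then have \<sigma>: "\<sigma> > 0" "\<rho>\<^sup>2 + \<sigma>\<^sup>2 = 1" by (auto simp: \<sigma>_def)
    have "(\<integral>\<^sup>+y. ennreal ((noise \<rho> \<sigma> h y - 1)\<^sup>2) \<partial>?\<gamma>) \<le> ennreal (C * \<rho> ^ 4 * (LINT x|?\<gamma>. (h x)\<^sup>2))"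
      by (rule bound[OF h1(1) h2(1) h1(2) hc \<rho> \<sigma>])
    also have "\<dots> \<le> ennreal (C * \<rho> ^ 4 * M)"
      using h2(2) C by (intro ennreal_leI mult_left_mono) auto
    finally have nb: "(\<integral>\<^sup>+y. ennreal ((noise \<rho> \<sigma> h y - 1)\<^sup>2) \<partial>?\<gamma>) \<le> ennreal (C * \<rho> ^ 4 * M)" .
    have "(LINT x|?\<gamma>. h x * ln (h x)) \<le> 2 * (C * \<rho> ^ 4 * M) + \<sigma>\<^sup>2 / (2 * pi) * E"
      using entropy_le_weak[OF fm G _ _ GE E(2) \<sigma>] h1(2) h2(1) nb C M unfolding h_def by simp
    moreover have "\<sigma>\<^sup>2 / (2 * pi) * E = E / (2 * pi) - \<rho>\<^sup>2 * (E / (2 * pi))"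
    proof -
      have s: "\<sigma>\<^sup>2 = 1 - \<rho>\<^sup>2" using \<sigma>(2) by simp
      show ?thesis unfolding s by (simp add: left_diff_distrib diff_divide_distrib)
    qed
    ultimately show "\<rho>\<^sup>2 * (E / (2 * pi)) \<le> E / (2 * pi) - (LINT x|?\<gamma>. (cmod (f x))\<^sup>2 * ln ((cmod (f x))\<^sup>2)) + 2 * (C * M) * \<rho> ^ 4"
      by (simp add: h_def algebra_simps)
  qed (use C M \<rho>\<^sub>0 in auto)
qed

text \<open>The subtracted entropy is always a real number, so an infinite energy would make the
  deficit infinite.\<close>

lemma deficit_finiteD:
  assumes "deficit f < ereal c"
  obtains E where "dirichlet_energy f = ennreal E" "E \<ge> 0"
    "deficit f = ereal (E / (2 * pi) - (LINT x|gauss_measure. (cmod (f x))\<^sup>2 * ln ((cmod (f x))\<^sup>2)))"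
proof (cases "dirichlet_energy f")
  case (real E)
  then show ?thesis using that[of E] by (simp add: deficit_def)
next
  case top
  then show ?thesis using assms by (simp add: deficit_def)
qed

text \<open>The difference of the two sides is 2 t (t ln t - t + 1), nonnegative by Gibbs; at t = 0
  both sides are 1.\<close>

lemma square_minus_one_le:
  fixes t :: real
  assumes "t \<ge> 0"
  shows "(t - 1)\<^sup>2 \<le> t\<^sup>2 * ln (t\<^sup>2) - t\<^sup>2 + 1"
proof (cases "t = 0")
  case False
  then have t: "t > 0" using assms by simp
  have "0 \<le> t * (t * ln t - t + 1)" using gibbs_pointwise[of t 1] t by (intro mult_nonneg_nonneg) auto
  moreover have "ln (t\<^sup>2) = 2 * ln t" using t by (simp add: ln_realpow)
  ultimately show ?thesis by (simp only:) (simp add: power2_eq_square algebra_simps)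
qed simp

lemma nn_integral_minus_one_le:
  fixes f :: "real^'n \<Rightarrow> complex"
  assumes fm [measurable]: "f \<in> borel_measurable borel" and norm: "normalized f"
    and f4: "(\<integral>\<^sup>+x. ennreal (cmod (f x) ^ 4) \<partial>gauss_measure) < \<infinity>"
    and pos: "AE x in gauss_measure. f x \<in> \<real>\<^sub>\<ge>\<^sub>0"
  shows "(\<integral>\<^sup>+x. ennreal ((cmod (f x - 1))\<^sup>2) \<partial>gauss_measure)
    \<le> ennreal (LINT x|gauss_measure. (cmod (f x))\<^sup>2 * ln ((cmod (f x))\<^sup>2))"
proof -
  let ?\<gamma> = "gauss_measure :: (real^'n) measure"
  define h where "h x = (cmod (f x))\<^sup>2" for x
  have [measurable]: "h \<in> borel_measurable borel" unfolding h_def by measurable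
  have h0: "h x \<ge> 0" for x by (simp add: h_def)
  have "has_bochner_integral ?\<gamma> h 1"
    using norm by (intro has_bochner_integral_nn_integral) (auto simp: h_def normalized_def)
  then have h1: "integrable ?\<gamma> h" "(LINT x|?\<gamma>. h x) = 1" by (auto simp: has_bochner_integral_iff)
  have "integrable ?\<gamma> (\<lambda>x. cmod (f x) ^ 4)" by (rule integrableI_nonneg[OF _ _ f4]) auto
  then have h2: "integrable ?\<gamma> (\<lambda>x. (h x)\<^sup>2)" by (simp add: h_def flip: power_mult)
  have hl: "integrable ?\<gamma> (\<lambda>x. h x * ln (h x))"
    by (rule gauss.integrable_mult_ln[OF _ h2 h0]) simp
  have nonneg: "0 \<le> h x * ln (h x) - h x + 1" for x
    using square_minus_one_le[of "cmod (f x)"] zero_le_power2[of "cmod (f x) - 1"] unfolding h_def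
    by (metis norm_ge_zero order_trans)
  have "(\<integral>\<^sup>+x. ennreal ((cmod (f x - 1))\<^sup>2) \<partial>?\<gamma>) \<le> (\<integral>\<^sup>+x. ennreal (h x * ln (h x) - h x + 1) \<partial>?\<gamma>)"
  proof (rule nn_integral_mono_AE, use pos in eventually_elim)
    case (elim x)
    then obtain r where r: "f x = of_real r" "r \<ge> 0" by (auto elim: nonneg_Reals_cases)
    have "f x - 1 = of_real (r - 1)" by (simp add: r)
    then have "(cmod (f x - 1))\<^sup>2 = (r - 1)\<^sup>2" by (simp only: norm_of_real power2_abs)
    then show ?case using square_minus_one_le[OF r(2)] r by (intro ennreal_leI) (simp add: h_def)
  qed
  also have "\<dots> = ennreal (LINT x|?\<gamma>. h x * ln (h x) - h x + 1)"
    using hl h1 nonneg by (intro nn_integral_eq_integral) auto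
  also have "(LINT x|?\<gamma>. h x * ln (h x) - h x + 1) = (LINT x|?\<gamma>. h x * ln (h x))"
    using hl h1 by simp
  finally show ?thesis by (simp only: h_def)
qed

lemma tendsto_ennreal_0I:
  fixes F :: "'a filter" and g :: "'a \<Rightarrow> ennreal"
  assumes "\<And>e :: real. e > 0 \<Longrightarrow> \<forall>\<^sub>F k in F. g k \<le> ennreal e"
  shows "(g \<longlongrightarrow> 0) F"
proof (rule order_tendstoI)
  fix a :: ennreal assume "0 < a"
  then obtain b where b: "0 < b" "b < a" using dense by blast
  then have "b < top" using less_trans top.not_eq_extremum by fastforce
  then have eq: "b = ennreal (enn2real b)" "enn2real b > 0" using b(1) by (auto simp: enn2real_positive_iff)
  have "\<forall>\<^sub>F k in F. g k \<le> b" using assms[OF eq(2)] eq(1) by simp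
  then show "\<forall>\<^sub>F k in F. g k < a" by eventually_elim (use b(2) in auto)
qed auto

theorem corollary1p14:
  fixes M :: real and f :: "nat \<Rightarrow> real^'n \<Rightarrow> complex"
  assumes "M \<ge> 1"
    and "\<And>k. f k \<in> borel_measurable borel"
    and "\<And>k. normalized (f k)"
    and "\<And>k. centered (f k)"
    and "\<And>k. (\<integral>\<^sup>+x. ennreal (cmod (f k x) ^ 4) \<partial>gauss_measure) \<le> ennreal M"
    and "(\<lambda>k. deficit (f k)) \<longlonglongrightarrow> 0"
  shows "(\<lambda>k. dirichlet_energy (f k)) \<longlonglongrightarrow> 0 \<and>
    ((\<forall>k. AE x in gauss_measure. f k x \<in> \<real>\<^sub>\<ge>\<^sub>0) \<longrightarrow>
      (\<lambda>k. \<integral>\<^sup>+x. ennreal ((cmod (f k x - 1))\<^sup>2) \<partial>gauss_measure) \<longlonglongrightarrow> 0)"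
proof -
  let ?ent = "\<lambda>k. LINT x|gauss_measure. (cmod (f k x))\<^sup>2 * ln ((cmod (f k x))\<^sup>2)"
  have M0: "M \<ge> 0" using assms(1) by simp
  obtain C \<rho>\<^sub>0 :: real where C: "C \<ge> 0" "0 < \<rho>\<^sub>0" and
    bound: "\<And>(f :: real^'n \<Rightarrow> complex) E \<rho>. f \<in> borel_measurable borel \<Longrightarrow> normalized f \<Longrightarrow> centered f \<Longrightarrow>
      (\<integral>\<^sup>+x. ennreal (cmod (f x) ^ 4) \<partial>gauss_measure) \<le> ennreal M \<Longrightarrow> dirichlet_energy f = ennreal E \<Longrightarrow> E \<ge> 0 \<Longrightarrow>
      0 < \<rho> \<Longrightarrow> \<rho> \<le> \<rho>\<^sub>0 \<Longrightarrow>
      \<rho>\<^sup>2 * (E / (2 * pi)) \<le> E / (2 * pi) - (LINT x|gauss_measure. (cmod (f x))\<^sup>2 * ln ((cmod (f x))\<^sup>2)) + C * \<rho> ^ 4"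
    by (rule energy_le_deficit[OF M0]) (rule that)
  have small: "\<forall>\<^sub>F k in sequentially. dirichlet_energy (f k) \<le> ennreal e \<and> ?ent k \<le> e" if e: "e > 0" for e :: real
  proof -
    \<comment> \<open>The energy is 2 pi y, and 2 pi < 8; so y \<le> t suffices.\<close>
    define t where "t = e / 8"
    have t: "t > 0" using e by (simp add: t_def)
    define \<rho> where "\<rho> = min \<rho>\<^sub>0 (min 1 (t / (2 * (C + 1))))"
    have \<rho>: "0 < \<rho>" "\<rho> \<le> \<rho>\<^sub>0" "\<rho> \<le> 1" using C t by (auto simp: \<rho>_def)
    have C\<rho>: "C * \<rho>\<^sup>2 \<le> t / 2"
    proof -
      have "\<rho>\<^sup>2 \<le> \<rho>" using \<rho> by (simp add: power2_eq_square mult_left_le)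
      also have "\<rho> \<le> t / (2 * (C + 1))" by (simp add: \<rho>_def)
      finally have "C * \<rho>\<^sup>2 \<le> C * (t / (2 * (C + 1)))" using C by (intro mult_left_mono) auto
      also have "\<dots> \<le> t / 2" using C t by (simp add: field_simps)
      finally show ?thesis .
    qed
    \<comment> \<open>The deficit is required to be small relative to \<rho>^2, so that after
      division by \<rho>^2 it contributes t / 2, as does the error C \<rho>^2.\<close>
    define d where "d = \<rho>\<^sup>2 * (t / 2)"
    have d: "d > 0" "d \<le> t"
    proof -
      show "d > 0" using \<rho> t by (simp add: d_def)
      have "\<rho>\<^sup>2 * (t / 2) \<le> 1 * (t / 2)" using \<rho> t by (intro mult_right_mono) (auto simp: power_le_one)
      then show "d \<le> t" using t by (simp add: d_def)
    qed
    \<comment> \<open>The upper bound controls the energy; the lower bound then controls the entropy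
      by the energy.\<close>
    have "\<forall>\<^sub>F k in sequentially. deficit (f k) < ereal d" "\<forall>\<^sub>F k in sequentially. ereal (- d) < deficit (f k)"
      using assms(6) d by (auto intro: order_tendstoD)
    then show ?thesis
    proof eventually_elim
      case (elim k)
      obtain E where E: "dirichlet_energy (f k) = ennreal E" "E \<ge> 0" "deficit (f k) = ereal (E / (2 * pi) - ?ent k)"
        using deficit_finiteD[OF elim(1)] by blast
      define y where "y = E / (2 * pi)"
      have y: "y - ?ent k < d" "- d < y - ?ent k" using elim unfolding E(3) y_def by simp_all
      have "\<rho>\<^sup>2 * y \<le> y - ?ent k + C * \<rho> ^ 4"
        unfolding y_def by (rule bound[OF assms(2-5) E(1,2) \<rho>(1,2)])
      also have "C * \<rho> ^ 4 = \<rho>\<^sup>2 * (C * \<rho>\<^sup>2)" by (simp flip: power_add)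
      finally have "\<rho>\<^sup>2 * y \<le> d + \<rho>\<^sup>2 * (C * \<rho>\<^sup>2)" using y(1) by linarith
      also have "\<rho>\<^sup>2 * (C * \<rho>\<^sup>2) \<le> \<rho>\<^sup>2 * (t / 2)" by (rule mult_left_mono[OF C\<rho>]) simp
      finally have "\<rho>\<^sup>2 * y \<le> \<rho>\<^sup>2 * t" by (simp add: d_def mult.commute)
      then have yt: "y \<le> t" using \<rho> by simp
      have "E = y * (2 * pi)" by (simp add: y_def)
      also have "\<dots> \<le> t * (2 * pi)" using yt by (intro mult_right_mono) auto
      also have "\<dots> = 2 * pi * t" by simp
      also have "\<dots> \<le> 8 * t" using pi_less_4 t by (intro mult_right_mono) auto
      finally have "E \<le> e" by (simp add: t_def)
      moreover have "?ent k \<le> e" using y(2) yt d(2) e by (simp add: t_def)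
      ultimately show ?case unfolding E(1) by (simp add: ennreal_leI)
    qed
  qed
  show ?thesis
  proof (intro conjI impI)
    show "(\<lambda>k. dirichlet_energy (f k)) \<longlonglongrightarrow> 0"
    proof (rule tendsto_ennreal_0I)
      fix e :: real assume "e > 0"
      show "\<forall>\<^sub>F k in sequentially. dirichlet_energy (f k) \<le> ennreal e"
        using small[OF \<open>e > 0\<close>] by eventually_elim simp
    qed
    assume pos: "\<forall>k. AE x in gauss_measure. f k x \<in> \<real>\<^sub>\<ge>\<^sub>0"
    show "(\<lambda>k. \<integral>\<^sup>+x. ennreal ((cmod (f k x - 1))\<^sup>2) \<partial>gauss_measure) \<longlonglongrightarrow> 0"
    proof (rule tendsto_ennreal_0I)
      fix e :: real assume "e > 0"
      show "\<forall>\<^sub>F k in sequentially. (\<integral>\<^sup>+x. ennreal ((cmod (f k x - 1))\<^sup>2) \<partial>gauss_measure) \<le> ennreal e"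
        using small[OF \<open>e > 0\<close>]
      proof eventually_elim
        case (elim k)
        have "(\<integral>\<^sup>+x. ennreal (cmod (f k x) ^ 4) \<partial>gauss_measure) < \<infinity>"
          using assms(5)[of k] by (rule le_less_trans) simp
        then have "(\<integral>\<^sup>+x. ennreal ((cmod (f k x - 1))\<^sup>2) \<partial>gauss_measure) \<le> ennreal (?ent k)"
          using pos assms(2,3) by (intro nn_integral_minus_one_le) auto
        also have "\<dots> \<le> ennreal e" using elim by (intro ennreal_leI) simp
        finally show ?case .
      qed
    qed
  qed
qed


end
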